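(* Let $\tilde\mu$ be a full, strictly operator-stable distribution on $\mathbb{R}^{2m}$ with exponent $B\oplus B$ for some $B\in \mathrm{L}(\mathbb{R}^m)$. Let $M$ be the $\mathbb{R}^{2m}$-valued independently scattered random measure generated by $\tilde\mu$ and the Lebesgue measure on $\mathbb{R}^d$, and let $\widetilde M$ be the $\mathbb{C}^m$-valued random measure identified with $M$. Let $D\in Q(\mathbb{R}^m)$ and $E\in Q(\mathbb{R}^d)$ with $q:=\mathrm{trace}(E)$ such that $\lambda_E>\Lambda_D$. Furthermore, let $\phi:\mathbb{R}^d\to[0,\infty)$ be a continuous and $E^*$-homogeneous function with $\phi(x)>0$ for $x\neq0$. Then for each $t\in\mathbb{R}^d$ the stochastic integral $$\widetilde X_{\phi,D}(t):=\mathrm{Re}\int_{\mathbb{R}^d}\left(e^{\mathrm{i}\langle t,s\rangle}-1\right)\phi(s)^{-D}\phi(s)^{-qB}\,\widetilde M(ds)$$ exists in the partial sense, i.e. the integrand $s\mapsto(e^{\mathrm{i}\langle t,s\rangle}-1)\phi(s)^{-D}\phi(s)^{-qB}$ is partially integrable with respect to $\widetilde M$.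
   Context: Matrices: $\mathrm{L}(\mathbb{R}^m)$ is the set of real $m\times m$ matrices; $s^A:=\exp((\ln s)A)$ for $s>0$, and $0^A:=0$ by convention. $A^*$ is the adjoint. $B\oplus B=\begin{pmatrix}B&0\\0&B\end{pmatrix}\in \mathrm{L}(\mathbb{R}^{2m})$. $\lambda_A$ and $\Lambda_A$ denote the minimum and maximum of the real parts of the complex eigenvalues of $A$. $Q(\mathbb{R}^m):=\{A\in \mathrm{L}(\mathbb{R}^m):\lambda_A>0\}$. $\phi$ is $E^*$-homogeneous if $\phi(c^{E^*}x)=c\,\phi(x)$ for all $c>0$, $x\ne0$. Distributions: a probability measure on $\mathbb{R}^k$ is full if it is not concentrated on any hyperplane. An infinitely divisible distribution $\mu$ on $\mathbb{R}^{k}$ has log-characteristic function $\psi$, the unique continuous function with $\psi(0)=0$ and $\hat\mu=\exp(\psi)$. $\mu$ is strictly operator-stable with exponent $A$ if $s\,\psi(u)=\psi(s^{A^*}u)$ for all $s>0$, $u\in\mathbb{R}^{k}$. Random measure: let $\mathcal{S}$ be the Borel sets of $\mathbb{R}^d$ of finite Lebesgue measure $|A|$. The independently scattered random measure $M$ generated by $\tilde\mu$ (with log-characteristic function $\tilde\psi$) and Lebesgue measure is a family $\{M(A):A\in\mathcal{S}\}$ of $\mathbb{R}^{2m}$-valued random vectors on some probability space such that for pairwise disjoint $A_1,A_2,\dots\in\mathcal{S}$ the $M(A_n)$ are independent, $M(\bigcup_nA_n)=\sum_nM(A_n)$ a.s. if $\bigcup_nA_n\in\mathcal{S}$, and $\mathbb{E}e^{\mathrm{i}\langle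 M(A),u\rangle}=\exp(|A|\tilde\psi(u))$. $\widetilde M$ is the $\mathbb{C}^m$-valued random measure with $M(A)=(\mathrm{Re}\,\widetilde M(A),\mathrm{Im}\,\widetilde M(A))$. Integral: for simple $g=\sum_{j=1}^nR_j\mathbf{1}_{A_j}$ ($R_j\in \mathrm{L}(\mathbb{R}^{2m})$, $A_j\in\mathcal{S}$ disjoint) put $I_M(g)=\sum_jR_jM(A_j)$. A measurable $g:\mathbb{R}^d\to \mathrm{L}(\mathbb{R}^{2m})$ is integrable w.r.t. $M$ if there are simple $g_n\to g$ a.e. such that $I_M(g_n\mathbf{1}_A)$ converges in probability for every Borel $A$; then $I_M(g)$ is the limit for $A=\mathbb{R}^d$. A measurable $f:\mathbb{R}^d\to \mathrm{L}(\mathbb{C}^m)$ is partially integrable w.r.t. $\widetilde M$ if $g_f:=\begin{pmatrix}\mathrm{Re}f&-\mathrm{Im}f\\0&0\end{pmatrix}$ is integrable w.r.t. $M$; then $\mathrm{Re}\int f\,d\widetilde M$ denotes the vector of the first $m$ coordinates of $I_M(g_f)$. *)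

theory Defs
  imports "HOL-Probability.Probability"
begin

text \<open>
  \<open>L(\<real>\<^sup>m)\<close> is \<^typ>\<open>real^'m^'m\<close>, and \<open>\<real>\<^sup>2\<^sup>m\<close> is \<^typ>\<open>real^('m + 'm)\<close>: the summand \<^const>\<open>Inl\<close> indexes the
  first \<open>m\<close> coordinates, \<^const>\<open>Inr\<close> the last \<open>m\<close>.
\<close>

text \<open>The class operations \<open>*\<close>, \<open>^\<close> and \<open>1\<close> on \<^typ>\<open>real^'n^'n\<close> are componentwise, so matrix powers
  and the matrix exponential are built from \<open>**\<close> and \<open>mat 1\<close>.\<close>

primrec matrix_pow :: "real^'n^'n \<Rightarrow> nat \<Rightarrow> real^'n^'n" where
  "matrix_pow A 0 = mat 1"
| "matrix_pow A (Suc k) = A ** matrix_pow A k"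

definition matrix_exp :: "real^'n^'n \<Rightarrow> real^'n^'n" where
  "matrix_exp A = (\<Sum>k. (1 / fact k) *\<^sub>R matrix_pow A k)"

text \<open>\<open>s\<^sup>A\<close>; the value \<open>0\<close> at \<open>s = 0\<close> is part of the convention, negative \<open>s\<close> never occur.\<close>

definition matrix_powr :: "real \<Rightarrow> real^'n^'n \<Rightarrow> real^'n^'n" where
  "matrix_powr s A = (if s > 0 then matrix_exp (ln s *\<^sub>R A) else 0)"

definition block_matrix ::
  "real^'n^'n \<Rightarrow> real^'n^'n \<Rightarrow> real^'n^'n \<Rightarrow> real^'n^'n \<Rightarrow> real^('n + 'n)^('n + 'n)" where
  "block_matrix P Q R S = (\<chi> i j. case i of
      Inl i' \<Rightarrow> (case j of Inl j' \<Rightarrow> P $ i' $ j' | Inr j' \<Rightarrow> Q $ i' $ j')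
    | Inr i' \<Rightarrow> (case j of Inl j' \<Rightarrow> R $ i' $ j' | Inr j' \<Rightarrow> S $ i' $ j'))"

definition matrix_double :: "real^'n^'n \<Rightarrow> real^('n + 'n)^('n + 'n)" where
  "matrix_double B = block_matrix B 0 0 B"

definition complex_eigenvalue :: "real^'n^'n \<Rightarrow> complex \<Rightarrow> bool" where
  "complex_eigenvalue A c \<longleftrightarrow> (\<exists>v. v \<noteq> 0 \<and> map_matrix complex_of_real A *v v = c *s v)"

definition min_re_eigenvalue :: "real^'n^'n \<Rightarrow> real" where
  "min_re_eigenvalue A = Min (Re ` {c. complex_eigenvalue A c})"

definition max_re_eigenvalue :: "real^'n^'n \<Rightarrow> real" where
  "max_re_eigenvalue A = Max (Re ` {c. complex_eigenvalue A c})"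

definition Q_matrices :: "(real^'n^'n) set" where
  "Q_matrices = {A. min_re_eigenvalue A > 0}"

definition matrix_homogeneous :: "real^'n^'n \<Rightarrow> (real^'n \<Rightarrow> real) \<Rightarrow> bool" where
  "matrix_homogeneous A \<phi> \<longleftrightarrow>
     (\<forall>c>0. \<forall>x. x \<noteq> 0 \<longrightarrow> \<phi> (matrix_powr c A *v x) = c * \<phi> x)"

text \<open>Hyperplanes are affine, i.e. need not contain the origin.\<close>

definition full_measure :: "(real^'k) measure \<Rightarrow> bool" where
  "full_measure \<mu> \<longleftrightarrow> (\<forall>a c. a \<noteq> 0 \<longrightarrow> \<not> (AE x in \<mu>. a \<bullet> x = c))"

definition char_fun :: "(real^'k) measure \<Rightarrow> real^'k \<Rightarrow> complex" where
  "char_fun \<mu> u = (CLINT x|\<mu>. iexp (x \<bullet> u))"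

primrec convolution_pow :: "(real^'k) measure \<Rightarrow> nat \<Rightarrow> (real^'k) measure" where
  "convolution_pow \<nu> 0 = return borel 0"
| "convolution_pow \<nu> (Suc n) = convolution \<nu> (convolution_pow \<nu> n)"

definition infinitely_divisible :: "(real^'k) measure \<Rightarrow> bool" where
  "infinitely_divisible \<mu> \<longleftrightarrow> prob_space \<mu> \<and> sets \<mu> = sets borel \<and>
     (\<forall>n\<ge>1. \<exists>\<nu>. prob_space \<nu> \<and> sets \<nu> = sets borel \<and> convolution_pow \<nu> n = \<mu>)"

definition log_char_fun :: "(real^'k) measure \<Rightarrow> (real^'k \<Rightarrow> complex) \<Rightarrow> bool" where
  "log_char_fun \<mu> \<psi> \<longleftrightarrow> continuous_on UNIV \<psi> \<and> \<psi> 0 = 0 \<and> (\<forall>u. char_fun \<mu> u = exp (\<psi> u))"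

lemma log_char_fun_unique:
  assumes "log_char_fun \<mu> \<psi>" and "log_char_fun \<mu> \<psi>'"
  shows "\<psi> = \<psi>'"
proof
  fix u
  define h where "h = (\<lambda>x. \<psi> x - \<psi>' x)"
  have cont: "continuous_on UNIV h"
    using assms unfolding h_def log_char_fun_def by (auto intro: continuous_on_diff)
  have "exp (h x) = 1" for x
    using assms unfolding h_def log_char_fun_def by (simp add: exp_diff)
  then have im: "Re (h x) = 0" "\<exists>n::int. Im (h x) = of_int (2 * n) * pi" for x
    by (simp_all add: exp_eq_1)
  have dom: "\<exists>n::int. h x = complex_of_real (of_int (2 * n) * pi) * \<i>" for x
  proof -
    obtain n :: int where "Im (h x) = of_int (2 * n) * pi" using im(2) by blast
    with im(1) show ?thesis by (intro exI[of _ n] complex_eqI) simp_all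
  qed
  have "h constant_on UNIV"
  proof (rule continuous_discrete_range_constant[OF connected_UNIV cont])
    fix x
    show "\<exists>e>0. \<forall>y. y \<in> UNIV \<and> h y \<noteq> h x \<longrightarrow> e \<le> norm (h y - h x)"
    proof (intro exI[of _ "2 * pi"] conjI allI impI)
      fix y assume y: "y \<in> UNIV \<and> h y \<noteq> h x"
      obtain m n :: int where mn: "h y = complex_of_real (of_int (2 * m) * pi) * \<i>"
        "h x = complex_of_real (of_int (2 * n) * pi) * \<i>" using dom by blast
      with y have "m \<noteq> n" by auto
      then have "1 \<le> \<bar>m - n\<bar>" by linarith
      then have "1 \<le> \<bar>real_of_int (m - n)\<bar>" by linarith
      moreover have "h y - h x = complex_of_real (2 * pi * real_of_int (m - n)) * \<i>"
        unfolding mn by (simp add: algebra_simps)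
      then have "norm (h y - h x) = 2 * pi * \<bar>real_of_int (m - n)\<bar>"
        by (simp only: norm_mult norm_of_real norm_ii abs_mult) simp
      ultimately show "2 * pi \<le> norm (h y - h x)" by simp
    qed simp
  qed
  then have "h u = h 0" by (auto simp: constant_on_def)
  then show "\<psi> u = \<psi>' u" using assms by (simp add: h_def log_char_fun_def)
qed

definition strictly_operator_stable :: "(real^'k) measure \<Rightarrow> real^'k^'k \<Rightarrow> bool" where
  "strictly_operator_stable \<mu> A \<longleftrightarrow> infinitely_divisible \<mu> \<and>
     (\<exists>\<psi>. log_char_fun \<mu> \<psi> \<and>
       (\<forall>s>0. \<forall>u. of_real s * \<psi> u = \<psi> (matrix_powr s (transpose A) *v u)))"

definition finite_borel_sets :: "(real^'d) set set" where
  "finite_borel_sets = {A \<in> sets borel. emeasure lborel A < \<infinity>}"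

text \<open>Finite disjoint families are covered by the countable ones: the characteristic function forces
  \<open>M {} = 0\<close> almost surely, so they may be padded with empty sets.\<close>

definition random_measure_generated_by ::
  "'w measure \<Rightarrow> (real^'k) measure \<Rightarrow> ((real^'d) set \<Rightarrow> 'w \<Rightarrow> real^'k) \<Rightarrow> bool" where
  "random_measure_generated_by P \<mu> M \<longleftrightarrow> prob_space P \<and>
     (\<forall>A\<in>finite_borel_sets. M A \<in> borel_measurable P) \<and>
     (\<forall>A :: nat \<Rightarrow> (real^'d) set. range A \<subseteq> finite_borel_sets \<and> disjoint_family A \<longrightarrow>
        prob_space.indep_vars P (\<lambda>_. borel) (\<lambda>n. M (A n)) UNIV \<and>
        ((\<Union>n. A n) \<in> finite_borel_sets \<longrightarrow>
           (AE \<omega> in P. (\<lambda>n. M (A n) \<omega>) sums M (\<Union>n. A n) \<omega>))) \<and>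
     (\<exists>\<psi>. log_char_fun \<mu> \<psi> \<and>
        (\<forall>A\<in>finite_borel_sets. \<forall>u.
           (CLINT \<omega>|P. iexp (M A \<omega> \<bullet> u)) = exp (of_real (measure lborel A) * \<psi> u)))"

definition to_complex_vec :: "real^('m + 'm) \<Rightarrow> complex^'m" where
  "to_complex_vec x = (\<chi> i. Complex (x $ Inl i) (x $ Inr i))"

definition to_real_vec :: "complex^'m \<Rightarrow> real^('m + 'm)" where
  "to_real_vec z = (\<chi> k. case k of Inl i \<Rightarrow> Re (z $ i) | Inr i \<Rightarrow> Im (z $ i))"

definition complex_random_measure ::
  "((real^'d) set \<Rightarrow> 'w \<Rightarrow> real^('m + 'm)) \<Rightarrow> (real^'d) set \<Rightarrow> 'w \<Rightarrow> complex^'m" where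
  "complex_random_measure M = (\<lambda>A \<omega>. to_complex_vec (M A \<omega>))"

definition real_random_measure ::
  "((real^'d) set \<Rightarrow> 'w \<Rightarrow> complex^'m) \<Rightarrow> (real^'d) set \<Rightarrow> 'w \<Rightarrow> real^('m + 'm)" where
  "real_random_measure N = (\<lambda>A \<omega>. to_real_vec (N A \<omega>))"

lemma real_complex_random_measure: "real_random_measure (complex_random_measure M) = M"
  by (auto simp: real_random_measure_def complex_random_measure_def to_real_vec_def
      to_complex_vec_def vec_eq_iff fun_eq_iff split: sum.split)

definition simple_representation ::
  "nat \<Rightarrow> (nat \<Rightarrow> real^'k^'k) \<Rightarrow> (nat \<Rightarrow> (real^'d) set) \<Rightarrow> (real^'d \<Rightarrow> real^'k^'k) \<Rightarrow> bool" where
  "simple_representation n R A g \<longleftrightarrow>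
     (\<forall>j<n. A j \<in> finite_borel_sets) \<and> disjoint_family_on A {..<n} \<and>
     g = (\<lambda>s. \<Sum>j<n. indicator (A j) s *\<^sub>R R j)"

definition simple_integrand :: "(real^'d \<Rightarrow> real^'k^'k) \<Rightarrow> bool" where
  "simple_integrand g \<longleftrightarrow> (\<exists>n R A. simple_representation n R A g)"

text \<open>The integral of a simple integrand does not depend on the representation up to null sets only,
  hence a relation: \<open>X\<close> is a version of \<open>I\<^sub>M(g)\<close>.\<close>

definition is_simple_integral ::
  "((real^'d) set \<Rightarrow> 'w \<Rightarrow> real^'k) \<Rightarrow> (real^'d \<Rightarrow> real^'k^'k) \<Rightarrow> ('w \<Rightarrow> real^'k) \<Rightarrow> bool" where
  "is_simple_integral M g X \<longleftrightarrow>
     (\<exists>n R A. simple_representation n R A g \<and> X = (\<lambda>\<omega>. \<Sum>j<n. R j *v M (A j) \<omega>))"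

definition converges_in_probability ::
  "'w measure \<Rightarrow> (nat \<Rightarrow> 'w \<Rightarrow> real^'k) \<Rightarrow> ('w \<Rightarrow> real^'k) \<Rightarrow> bool" where
  "converges_in_probability P X Y \<longleftrightarrow> Y \<in> borel_measurable P \<and>
     (\<forall>\<epsilon>>0. (\<lambda>n. measure P {\<omega> \<in> space P. norm (X n \<omega> - Y \<omega>) > \<epsilon>}) \<longlonglongrightarrow> 0)"

definition integrable_wrt_random_measure ::
  "'w measure \<Rightarrow> ((real^'d) set \<Rightarrow> 'w \<Rightarrow> real^'k) \<Rightarrow> (real^'d \<Rightarrow> real^'k^'k) \<Rightarrow> bool" where
  "integrable_wrt_random_measure P M g \<longleftrightarrow> g \<in> borel_measurable borel \<and>
     (\<exists>G. (\<forall>n. simple_integrand (G n)) \<and>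
       (AE s in lborel. (\<lambda>n. G n s) \<longlonglongrightarrow> g s) \<and>
       (\<forall>A\<in>sets borel. \<exists>X Y.
          (\<forall>n. is_simple_integral M (\<lambda>s. indicator A s *\<^sub>R G n s) (X n)) \<and>
          converges_in_probability P X Y))"

definition partially_integrable ::
  "'w measure \<Rightarrow> ((real^'d) set \<Rightarrow> 'w \<Rightarrow> complex^'m) \<Rightarrow> (real^'d \<Rightarrow> complex^'m^'m) \<Rightarrow> bool" where
  "partially_integrable P N f \<longleftrightarrow> f \<in> borel_measurable borel \<and>
     integrable_wrt_random_measure P (real_random_measure N)
       (\<lambda>s. block_matrix (map_matrix Re (f s)) (- map_matrix Im (f s)) 0 0)"

definition harmonizable_kernel ::
  "real^'m^'m \<Rightarrow> real^'m^'m \<Rightarrow> real^'d^'d \<Rightarrow> (real^'d \<Rightarrow> real) \<Rightarrow> real^'d \<Rightarrow> real^'d \<Rightarrow> complex^'m^'m" where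
  "harmonizable_kernel B D E \<phi> t s =
     map_matrix (\<lambda>a. (iexp (t \<bullet> s) - 1) * complex_of_real a)
       (matrix_powr (\<phi> s) (- D) ** matrix_powr (\<phi> s) (- (trace E *\<^sub>R B)))"

end

theory Submission
  imports Defs "HOL-Computational_Algebra.Fundamental_Theorem_Algebra"
begin

text \<open>
  By the characteristic function of \<open>I\<^sub>M(G)\<close> for simple \<open>G\<close>, convergence in probability of the
  integrals of simple functions \<open>G\<^sub>n \<longrightarrow> g\<close> follows from dominated convergence as soon as
  \<open>\<psi>((G\<^sub>m - G\<^sub>n)\<^sup>T u)\<close> has an integrable majorant independent of \<open>m, n\<close>. Put \<open>A = B \<oplus> B\<close>. Stability gives
  \<open>\<psi>(v) = \<phi>\<^sup>-\<^sup>q \<psi>(\<phi>\<^sup>q\<^sup>A\<^sup>* v)\<close>; it also gives \<open>\<psi>(v) = O(\<bar>v\<bar>\<^sup>\<epsilon>)\<close> near \<open>0\<close>, by rescaling \<open>v\<close> with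
  \<open>s = \<bar>v\<bar>\<^sup>-\<^sup>\<epsilon>\<close> for small \<open>\<epsilon>\<close>, so that no Levy-Khinchin representation is needed. For the kernel \<open>g\<close>,
  the matrix \<open>g \<phi>\<^sup>q\<^sup>A\<close> only involves \<open>(e\<^sup>i\<^sup>t\<^sup>s - 1) \<phi>\<^sup>-\<^sup>D\<close>, which is \<open>O(min(\<phi>, 1/\<phi>)\<^sup>\<eta>)\<close> since
  \<open>0 < \<lambda>\<^sub>D\<close> and \<open>\<Lambda>\<^sub>D < \<lambda>\<^sub>E\<close>. Approximating \<open>g\<close> on \<open>{\<bar>ln \<phi>\<bar> \<le> n}\<close> with an error exponentially small in \<open>n\<close>
  preserves this bound, and \<open>\<phi>\<^sup>-\<^sup>q min(\<phi>, 1/\<phi>)\<^sup>\<eta>\<^sup>\<epsilon>\<close> is integrable because the shell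
  \<open>{e\<^sup>k \<le> \<phi> < e\<^sup>k\<^sup>+\<^sup>1}\<close> has measure proportional to \<open>e\<^sup>k\<^sup>q\<close>.
\<close>

section \<open>Matrices as a Banach algebra and the matrix exponential\<close>

text \<open>The limit of the integrals is not known in advance; what can be computed is the
  characteristic function of the difference of two simple integrals. Hence the Cauchy property in
  probability is the goal, and one approximating sequence serves every Borel set. The obstacle is
  that the size of g alone says little, because \<phi>^(-q B) varies at a polynomial rate dictated
  by B. Only g multiplied on the right by \<phi>^(q A) is controlled: there \<phi>^(-q B) meets its
  inverse directly, without commuting B and D. The remainder has two regimes. For \<phi> >= 1 the
  factor e^(i<t,s>) - 1 is at most 2 in modulus and \<phi>^(-D) decays. For \<phi> < 1 the factor is
  at most |t| |s|, and |s| = O(\<phi>^\<kappa>) for every \<kappa> < \<lambda>_E, which beats the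
  growth of \<phi>^(-D). Growth bounds read off from eigenvalues lose a small exponent, since Jordan
  blocks contribute polynomial factors; the strict inequalities on \<lambda>_D, \<Lambda>_D and
  \<lambda>_E pay for this loss. The number q is a trace because the dilation by
  \<open>matrix_exp (L *\<^sub>R transpose E)\<close> has determinant e^(L q).\<close>

text \<open>A copy of the square matrices on which \<open>*\<close> is matrix multiplication and the norm is the operator
  norm, so that the library's \<open>exp\<close> on Banach algebras applies.\<close>

typedef ('n::finite) sqmat = "UNIV :: (real^'n^'n) set"
  morphisms matrix_of sqmat_of ..

setup_lifting type_definition_sqmat

lemma matrix_matrix_mult_linear_simps:
  fixes A :: "real^'m^'n" and B C :: "real^'k^'m"
  shows "A ** (r *\<^sub>R B) = r *\<^sub>R (A ** B)" "(r *\<^sub>R A) ** B = r *\<^sub>R (A ** B)"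
    and "(A + A') ** B = A ** B + A' ** B" "(A - A') ** B = A ** B - A' ** B"
  by (simp_all add: matrix_matrix_mult_def vec_eq_iff sum_distrib_left algebra_simps
      sum.distrib sum_subtractf)

lemma sum_UNIV_sum: "sum f (UNIV :: ('a::finite + 'b::finite) set) = (\<Sum>i\<in>UNIV. f (Inl i)) + (\<Sum>i\<in>UNIV. f (Inr i))"
  by (simp add: UNIV_Plus_UNIV[symmetric] sum.Plus del: UNIV_Plus_UNIV)

text \<open>The class demands \<open>norm 1 = 1\<close>, which rules out the Euclidean norm of the
  entries in dimension above one; hence the operator norm.\<close>

instantiation sqmat :: (finite) real_normed_algebra_1
begin

lift_definition zero_sqmat :: "'a sqmat" is 0 .
lift_definition one_sqmat :: "'a sqmat" is "mat 1" .
lift_definition plus_sqmat :: "'a sqmat \<Rightarrow> 'a sqmat \<Rightarrow> 'a sqmat" is "(+)" .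
lift_definition minus_sqmat :: "'a sqmat \<Rightarrow> 'a sqmat \<Rightarrow> 'a sqmat" is "(-)" .
lift_definition uminus_sqmat :: "'a sqmat \<Rightarrow> 'a sqmat" is uminus .
lift_definition times_sqmat :: "'a sqmat \<Rightarrow> 'a sqmat \<Rightarrow> 'a sqmat" is "(**)" .
lift_definition scaleR_sqmat :: "real \<Rightarrow> 'a sqmat \<Rightarrow> 'a sqmat" is "(*\<^sub>R)" .
lift_definition norm_sqmat :: "'a sqmat \<Rightarrow> real" is "\<lambda>A. onorm ((*v) A)" .

definition dist_sqmat :: "'a sqmat \<Rightarrow> 'a sqmat \<Rightarrow> real"
  where "dist_sqmat a b = norm (a - b)"
definition sgn_sqmat :: "'a sqmat \<Rightarrow> 'a sqmat"
  where "sgn_sqmat x = scaleR (inverse (norm x)) x"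
definition uniformity_sqmat :: "('a sqmat \<times> 'a sqmat) filter"
  where "uniformity_sqmat = (INF e\<in>{0 <..}. principal {(x, y). dist x y < e})"
definition open_sqmat :: "'a sqmat set \<Rightarrow> bool"
  where "open_sqmat S = (\<forall>x\<in>S. \<forall>\<^sub>F (x', y) in uniformity. x' = x \<longrightarrow> y \<in> S)"

instance
proof
  fix a b c :: "'a sqmat" and r s :: real and U :: "'a sqmat set"
  show "a + b + c = a + (b + c)" "a + b = b + a" "0 + a = a" "- a + a = 0" "a - b = a + - b"
    "r *\<^sub>R (a + b) = r *\<^sub>R a + r *\<^sub>R b" "(r + s) *\<^sub>R a = r *\<^sub>R a + s *\<^sub>R a"
    "r *\<^sub>R s *\<^sub>R a = (r * s) *\<^sub>R a" "1 *\<^sub>R a = a"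
    by (transfer; simp add: algebra_simps)+
  show "a * b * c = a * (b * c)" by transfer (simp add: matrix_mul_assoc)
  show "1 * a = a" "a * 1 = a" by (transfer; simp)+
  show "(a + b) * c = a * c + b * c" "a * (b + c) = a * b + a * c"
    by (transfer; simp add: matrix_matrix_mult_linear_simps matrix_add_ldistrib)+
  show "r *\<^sub>R a * b = r *\<^sub>R (a * b)" by transfer (simp add: matrix_matrix_mult_linear_simps)
  show "a * r *\<^sub>R b = r *\<^sub>R (a * b)" by transfer (simp add: matrix_matrix_mult_linear_simps)
  show "(0::'a sqmat) \<noteq> 1" by transfer (simp add: mat_def vec_eq_iff)
  show "norm (1::'a sqmat) = 1" 
  proof transfer
    have "(*v) (mat 1 :: real^'a^'a) = (\<lambda>x. x)" by auto
    then show "onorm ((*v) (mat 1 :: real^'a^'a)) = 1" by (simp add: onorm_id)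
  qed
  show "norm (a + b) \<le> norm a + norm b"
  proof transfer
    fix a b :: "real^'a^'a"
    have "(*v) (a + b) = (\<lambda>x. a *v x + b *v x)" by (auto simp: matrix_vector_mult_add_rdistrib)
    then show "onorm ((*v) (a + b)) \<le> onorm ((*v) a) + onorm ((*v) b)"
      by (simp add: onorm_triangle matrix_vector_mul_bounded_linear)
  qed
  show "norm (r *\<^sub>R a) = \<bar>r\<bar> * norm a"
  proof transfer
    fix r and a :: "real^'a^'a"
    have "(*v) (r *\<^sub>R a) = (\<lambda>x. r *\<^sub>R (a *v x))" by (auto simp: scaleR_matrix_vector_assoc)
    then show "onorm ((*v) (r *\<^sub>R a)) = \<bar>r\<bar> * onorm ((*v) a)"
      by (simp add: onorm_scaleR matrix_vector_mul_bounded_linear)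
  qed
  show "norm (a * b) \<le> norm a * norm b"
  proof (transfer)
    fix a b :: "real^'a^'a"
    have "(*v) (a ** b) = (*v) a \<circ> (*v) b" by (auto simp: matrix_vector_mul_assoc)
    then show "onorm ((*v) (a ** b)) \<le> onorm ((*v) a) * onorm ((*v) b)"
      using onorm_compose[OF matrix_vector_mul_bounded_linear[of a] matrix_vector_mul_bounded_linear[of b]]
      by simp
  qed
  show "(norm a = 0) = (a = 0)"
    by transfer (auto simp: onorm_eq_0 matrix_vector_mul_bounded_linear matrix_eq)
  show "dist a b = norm (a - b)" "sgn a = inverse (norm a) *\<^sub>R a"
    "uniformity = (INF e\<in>{0<..}. principal {(x, y). dist (x::'a sqmat) y < e})"
    "open U = (\<forall>x\<in>U. \<forall>\<^sub>F (x', y) in uniformity. x' = x \<longrightarrow> y \<in> U)"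
    by (simp_all add: dist_sqmat_def sgn_sqmat_def uniformity_sqmat_def open_sqmat_def)
qed

end

section \<open>Comparison of the operator norm with the Euclidean norm, and the exponential
  series\<close>

lemma norm_matrix_le_sum_abs:
  fixes A :: "real^'m::finite^'n::finite"
  shows "norm A \<le> (\<Sum>i\<in>UNIV. \<Sum>j\<in>UNIV. \<bar>A $ i $ j\<bar>)"
proof -
  have "norm A \<le> (\<Sum>i\<in>UNIV. norm (A $ i))"
    unfolding norm_vec_def by (rule L2_set_le_sum) simp
  also have "\<dots> \<le> (\<Sum>i\<in>UNIV. \<Sum>j\<in>UNIV. \<bar>A $ i $ j\<bar>)"
    by (intro sum_mono norm_le_l1_cart)
  finally show ?thesis .
qed

lemma bounded_linear_matrix_of: "bounded_linear (matrix_of :: 'n::finite sqmat \<Rightarrow> real^'n^'n)"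
proof (rule bounded_linear_intro)
  fix x y :: "'n sqmat" and r :: real
  show "matrix_of (x + y) = matrix_of x + matrix_of y" by transfer simp
  show "matrix_of (r *\<^sub>R x) = r *\<^sub>R matrix_of x" by transfer simp
  have "norm (matrix_of x) \<le> (\<Sum>i::'n\<in>UNIV. \<Sum>j::'n\<in>UNIV. norm x)"
    by (rule order.trans[OF norm_matrix_le_sum_abs]; intro sum_mono)
      (transfer, rule matrix_component_le_onorm)
  then show "norm (matrix_of x) \<le> norm x * (real CARD('n) * real CARD('n))"
    by (simp add: mult_ac)
qed

lemma bounded_linear_sqmat_of: "bounded_linear (sqmat_of :: real^'n^'n \<Rightarrow> 'n::finite sqmat)"
proof (rule linear_conv_bounded_linear[THEN iffD1])
  show "linear (sqmat_of :: real^'n^'n \<Rightarrow> 'n::finite sqmat)"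
    by (rule linearI; transfer) auto
qed

text \<open>Both directions of the type isomorphism are bounded, so completeness is inherited from
  the Euclidean space of matrices.\<close>

instance sqmat :: (finite) banach
proof
  fix X :: "nat \<Rightarrow> 'a sqmat" assume "Cauchy X"
  then have "Cauchy (\<lambda>n. matrix_of (X n))"
    by (rule bounded_linear.Cauchy[OF bounded_linear_matrix_of])
  then obtain L where "(\<lambda>n. matrix_of (X n)) \<longlonglongrightarrow> L"
    by (metis Cauchy_convergent_iff convergent_def)
  then have "(\<lambda>n. sqmat_of (matrix_of (X n))) \<longlonglongrightarrow> sqmat_of L"
    by (rule bounded_linear.tendsto[OF bounded_linear_sqmat_of])
  then show "convergent X" by (auto simp: matrix_of_inverse convergent_def)
qed

lemma matrix_of_power: "matrix_of (a ^ k) = matrix_pow (matrix_of a) k"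
  by (induction k) (simp_all add: times_sqmat.rep_eq one_sqmat.rep_eq)

lemma matrix_pow_sums_exp: "(\<lambda>k. (1 / fact k) *\<^sub>R matrix_pow A k) sums matrix_of (exp (sqmat_of A))"
proof -
  have "(\<lambda>k. sqmat_of A ^ k /\<^sub>R fact k) sums exp (sqmat_of A)"
    by (rule exp_converges)
  then have "(\<lambda>k. matrix_of (sqmat_of A ^ k /\<^sub>R fact k)) sums matrix_of (exp (sqmat_of A))"
    by (rule bounded_linear.sums[OF bounded_linear_matrix_of])
  then show ?thesis
    by (simp add: scaleR_sqmat.rep_eq matrix_of_power sqmat_of_inverse inverse_eq_divide)
qed

lemma matrix_exp_conv_exp: "matrix_exp A = matrix_of (exp (sqmat_of A))"
  using matrix_pow_sums_exp[of A] by (simp add: matrix_exp_def sums_iff)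

lemma matrix_exp_sums: "(\<lambda>k. (1 / fact k) *\<^sub>R matrix_pow A k) sums matrix_exp A"
  using matrix_pow_sums_exp[of A] by (simp add: matrix_exp_conv_exp)

lemma sqmat_of_scaleR: "sqmat_of (r *\<^sub>R A) = r *\<^sub>R sqmat_of A"
  by (rule linear_simps(5)[OF bounded_linear_sqmat_of])

lemma matrix_exp_add_commuting:
  assumes "A ** B = B ** A" shows "matrix_exp (A + B) = matrix_exp A ** matrix_exp B"
proof -
  have "sqmat_of A * sqmat_of B = sqmat_of B * sqmat_of A"
    using assms by transfer simp
  then have "exp (sqmat_of A + sqmat_of B) = exp (sqmat_of A) * exp (sqmat_of B)"
    by (rule exp_add_commuting)
  moreover have "sqmat_of (A + B) = sqmat_of A + sqmat_of B" by transfer simp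
  ultimately show ?thesis by (simp add: matrix_exp_conv_exp times_sqmat.rep_eq)
qed

lemma matrix_exp_0 [simp]: "matrix_exp 0 = mat 1"
  by (simp add: matrix_exp_conv_exp zero_sqmat_def[symmetric] one_sqmat.rep_eq)

lemma matrix_exp_scaleR_add: "matrix_exp ((s + t) *\<^sub>R A) = matrix_exp (s *\<^sub>R A) ** matrix_exp (t *\<^sub>R A)"
  by (simp add: scaleR_add_left matrix_exp_add_commuting matrix_matrix_mult_linear_simps)

lemma matrix_exp_minus_cancel [simp]: "matrix_exp (- A) ** matrix_exp A = mat 1"
  using matrix_exp_scaleR_add[of "-1" 1 A] by simp

lemma matrix_exp_minus_cancel' [simp]: "matrix_exp A ** matrix_exp (- A) = mat 1"
  using matrix_exp_scaleR_add[of "1" "-1" A] by simp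

section \<open>The exponential under transposition, block sums and differentiation\<close>

lemma transpose_matrix_pow: "transpose (matrix_pow A k) = matrix_pow (transpose A) k"
proof -
  \<comment> \<open>The recursion multiplies by A on the left, while transposition moves that factor
    to the right.\<close>
  have comm: "matrix_pow A k ** A = A ** matrix_pow A k" for k and A :: "real^'n^'n"
    by (induction k) (simp_all add: matrix_mul_assoc[symmetric])
  show ?thesis by (induction k) (simp_all add: matrix_transpose_mul comm)
qed

lemma bounded_linear_transpose: "bounded_linear (transpose :: real^'n^'m \<Rightarrow> real^'m^'n)"
  by (rule linear_conv_bounded_linear[THEN iffD1], rule linearI)
    (simp_all add: transpose_def vec_eq_iff)

text \<open>Links the two sides of the argument: stability of \<psi> speaks of the transposed
  exponent, whereas the kernel is multiplied by the exponential of the exponent itself.\<close>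

lemma transpose_matrix_exp: "transpose (matrix_exp A) = matrix_exp (transpose A)"
proof -
  have "(\<lambda>k. transpose ((1 / fact k) *\<^sub>R matrix_pow A k)) sums transpose (matrix_exp A)"
    by (rule bounded_linear.sums[OF bounded_linear_transpose matrix_exp_sums])
  then show ?thesis
    by (simp add: linear_simps[OF bounded_linear_transpose] transpose_matrix_pow matrix_exp_def sums_iff)
qed

lemma block_matrix_mult:
  fixes P Q R S P' Q' R' S' :: "real^'n::finite^'n"
  shows "block_matrix P Q R S ** block_matrix P' Q' R' S' =
    block_matrix (P ** P' + Q ** R') (P ** Q' + Q ** S') (R ** P' + S ** R') (R ** Q' + S ** S')"
  by (auto simp: matrix_matrix_mult_def block_matrix_def vec_eq_iff sum_UNIV_sum
      split: sum.split)

lemma matrix_double_pow: "matrix_pow (matrix_double B) k = matrix_double (matrix_pow B k)"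
proof (induction k)
  case 0
  show ?case by (auto simp: matrix_double_def block_matrix_def mat_def vec_eq_iff split: sum.split)
next
  case (Suc k)
  then show ?case by (simp add: matrix_double_def block_matrix_mult)
qed

lemma bounded_linear_matrix_double: "bounded_linear (matrix_double :: real^'n^'n \<Rightarrow> _)"
  by (rule linear_conv_bounded_linear[THEN iffD1], rule linearI)
    (auto simp: matrix_double_def block_matrix_def vec_eq_iff split: sum.split)

text \<open>Powers of a block-diagonal matrix are taken blockwise. The exponential of B + B (direct
  sum) therefore acts on the real and the imaginary block of the integrand in the same way.\<close>

lemma matrix_exp_double: "matrix_exp (matrix_double B) = matrix_double (matrix_exp B)"
proof -
  have "(\<lambda>k. matrix_double ((1 / fact k) *\<^sub>R matrix_pow B k)) sums matrix_double (matrix_exp B)"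
    by (rule bounded_linear.sums[OF bounded_linear_matrix_double matrix_exp_sums])
  then show ?thesis
    by (simp add: linear_simps[OF bounded_linear_matrix_double] matrix_double_pow matrix_exp_def sums_iff)
qed

lemma matrix_exp_has_vector_derivative:
  "((\<lambda>t. matrix_exp (t *\<^sub>R A)) has_vector_derivative matrix_exp (t *\<^sub>R A) ** A) (at t within T)"
proof -
  have "((\<lambda>t. matrix_of (exp (t *\<^sub>R sqmat_of A))) has_vector_derivative
    matrix_of (exp (t *\<^sub>R sqmat_of A) * sqmat_of A)) (at t within T)"
    by (rule bounded_linear.has_vector_derivative[OF bounded_linear_matrix_of
          exp_scaleR_has_vector_derivative_right])
  then show ?thesis
    by (simp add: matrix_exp_conv_exp sqmat_of_scaleR times_sqmat.rep_eq sqmat_of_inverse)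
qed

lemma onorm_matrix_exp_le: "onorm ((*v) (matrix_exp A)) \<le> exp (onorm ((*v) A))"
proof -
  have "norm (exp (sqmat_of A)) \<le> exp (norm (sqmat_of A))" by (rule norm_exp)
  then show ?thesis
    by (simp add: matrix_exp_conv_exp norm_sqmat.rep_eq sqmat_of_inverse)
qed

lemma onorm_matrix_exp_scaleR_le: "onorm ((*v) (matrix_exp (t *\<^sub>R A))) \<le> exp (\<bar>t\<bar> * onorm ((*v) A))"
proof -
  have "onorm ((*v) (t *\<^sub>R A)) = \<bar>t\<bar> * onorm ((*v) A)"
    using norm_scaleR[of t "sqmat_of A"]
    by (simp add: norm_sqmat.rep_eq sqmat_of_inverse scaleR_sqmat.rep_eq)
  then show ?thesis using onorm_matrix_exp_le[of "t *\<^sub>R A"] by simp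
qed

lemma norm_matrix_exp_scaleR_mult_le:
  "norm (matrix_exp (t *\<^sub>R A) *v x) \<le> exp (\<bar>t\<bar> * onorm ((*v) A)) * norm x"
  by (rule order.trans[OF onorm[OF matrix_vector_mul_bounded_linear]])
    (intro mult_right_mono onorm_matrix_exp_scaleR_le norm_ge_zero)

section \<open>Growth of the matrix exponential\<close>

lemma norm_vector_scalar_mult: "norm (a *s x) = norm a * norm (x :: complex^'n)"
  by (simp add: norm_vec_def norm_mult L2_set_right_distrib)

lemma bounded_bilinear_vector_scalar_mult:
  "bounded_bilinear ((*s) :: complex \<Rightarrow> complex^'n \<Rightarrow> complex^'n)"
proof
  show "\<exists>K. \<forall>(a::complex) (b::complex^'n). norm (a *s b) \<le> norm a * norm b * K"
    by (intro exI[of _ 1]) (simp add: norm_vector_scalar_mult)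
qed (simp_all add: vec_eq_iff algebra_simps)

text \<open>The vector p(A) v by Horner's scheme. Working with vectors avoids powers of A, for which
  the class operation \<open>^\<close> would be componentwise.\<close>

definition poly_apply :: "'a::field^'n^'n \<Rightarrow> 'a poly \<Rightarrow> 'a^'n \<Rightarrow> 'a^'n" where
  "poly_apply A p v = fold_coeffs (\<lambda>a w. a *s v + A *v w) p 0"

lemma poly_apply_0 [simp]: "poly_apply A 0 v = 0"
  by (simp add: poly_apply_def)

lemma poly_apply_pCons [simp]: "poly_apply A (pCons a p) v = a *s v + A *v poly_apply A p v"
  by (cases "a = 0 \<and> p = 0") (auto simp: poly_apply_def)

lemma poly_apply_add: "poly_apply A (p + q) v = poly_apply A p v + poly_apply A q v"
  by (induction p q rule: poly_induct2) (simp_all add: algebra_simps vec.add)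

lemma poly_apply_smult: "poly_apply A (smult c p) v = c *s poly_apply A p v"
  by (induction p) (simp_all add: algebra_simps vec.scale)

lemma poly_apply_linear_factor:
  "poly_apply A ([:- c, 1:] * q) v = A *v poly_apply A q v - c *s poly_apply A q v"
proof -
  have "[:- c, 1:] * q = pCons 0 q + smult (- c) q" by simp
  then show ?thesis by (simp only: poly_apply_add poly_apply_smult poly_apply_pCons) simp
qed

text \<open>Polynomials in A commute with A - c. In the growth induction this shows that the
  cofactor q annihilates (A - c) v.\<close>

lemma poly_apply_commute:
  "poly_apply A q (A *v v - c *s v) = A *v poly_apply A q v - c *s poly_apply A q v"
proof (induction q)
  case (pCons a q)
  then show ?case
    by (simp only: poly_apply_pCons vec.scale vec.add vec.diff) (simp add: vec_eq_iff algebra_simps)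
qed simp

section \<open>Growth of the exponential on complex vectors\<close>

lemma map_matrix_of_real_mult:
  "map_matrix complex_of_real (X ** Y) = map_matrix complex_of_real X ** map_matrix complex_of_real Y"
  by (simp add: map_matrix_def matrix_matrix_mult_def vec_eq_iff)

lemma bounded_linear_complexified_mult:
  "bounded_linear (\<lambda>X :: real^'n^'n. map_matrix complex_of_real X *v v)"
proof -
  have "linear (\<lambda>X :: real^'n^'n. map_matrix complex_of_real X *v v)"
    by (rule linearI) (simp_all add: map_matrix_def matrix_vector_mult_def vec_eq_iff
        distrib_right sum.distrib scaleR_sum_right, simp add: scaleR_conv_of_real mult.assoc)
  then show ?thesis
    by (rule linear_conv_bounded_linear[THEN iffD1])
qed

lemma complexified_exp_has_vector_derivative:
  fixes A :: "real^'n^'n"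
  shows "((\<lambda>t. map_matrix complex_of_real (matrix_exp (t *\<^sub>R A)) *v v) has_vector_derivative
    map_matrix complex_of_real (matrix_exp (t *\<^sub>R A)) *v (map_matrix complex_of_real A *v v))
    (at t within T)"
  using bounded_linear.has_vector_derivative[OF bounded_linear_complexified_mult
      matrix_exp_has_vector_derivative]
  by (simp add: map_matrix_of_real_mult matrix_vector_mul_assoc)

text \<open>Induction on the degree of a polynomial \<open>p = (X - c) q\<close> annihilating \<open>v\<close>. If \<open>q\<close> does not annihilate
  \<open>v\<close>, then \<open>q(A) v\<close> is an eigenvector for \<open>c\<close>, hence \<open>Re c \<le> a\<close>; and \<open>e\<^sup>-\<^sup>c\<^sup>t e\<^sup>t\<^sup>A v\<close> has the derivative
  \<open>e\<^sup>-\<^sup>c\<^sup>t e\<^sup>t\<^sup>A w\<close>, where \<open>w = (A - c) v\<close> is annihilated by \<open>q\<close>.\<close>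

lemma complexified_exp_growth:
  fixes A :: "real^'n^'n" and v :: "complex^'n"
  assumes a: "\<And>c. complex_eigenvalue A c \<Longrightarrow> Re c \<le> a" and \<delta>: "\<delta> > 0"
    and "p \<noteq> 0" "poly_apply (map_matrix complex_of_real A) p v = 0"
  shows "\<exists>C. \<forall>t\<ge>0. norm (map_matrix complex_of_real (matrix_exp (t *\<^sub>R A)) *v v) \<le> C * exp ((a + \<delta>) * t)"
  using assms(3,4)
proof (induction "degree p" arbitrary: p v)
  case 0
  from degree_eq_zeroE[OF "0.hyps"[symmetric]] obtain b where "p = [:b:]" by blast
  with "0.prems" have "v = 0" by simp
  then show ?case by (intro exI[of _ 0]) simp
next
  case (Suc n)
  define AC where "AC = map_matrix complex_of_real A"
  define Y where "Y t = map_matrix complex_of_real (matrix_exp (t *\<^sub>R A))" for t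
  have "\<not> constant (poly p)" using Suc.hyps(2) by (simp add: constant_degree)
  then obtain c where "poly p c = 0" using fundamental_theorem_of_algebra by blast
  then obtain q where q: "p = [:- c, 1:] * q" by (metis poly_eq_0_iff_dvd dvdE)
  with Suc.prems have "q \<noteq> 0" by auto
  moreover from q this Suc.hyps(2) have deg: "n = degree q"
    by (metis degree_mult_eq degree_pCons_eq_if degree_0 one_poly_eq_simps(1) pCons_eq_0_iff
        diff_Suc_1 One_nat_def add_Suc add_0 zero_neq_one)
  ultimately have IH: "\<exists>C. \<forall>t\<ge>0. norm (Y t *v w) \<le> C * exp ((a + \<delta>) * t)"
    if "poly_apply AC q w = 0" for w
    using Suc.hyps(1)[of q w] that by (simp add: AC_def Y_def)
  show ?case
  proof (cases "poly_apply AC q v = 0")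
    case True
    then show ?thesis using IH by (simp add: Y_def)
  next
    case False
    have 0: "AC *v poly_apply AC q v - c *s poly_apply AC q v = 0"
      using Suc.prems(2) by (simp only: q AC_def poly_apply_linear_factor)
    with False have "complex_eigenvalue A c"
      unfolding complex_eigenvalue_def AC_def[symmetric]
      by (intro exI[of _ "poly_apply AC q v"]) simp
    then have ca: "Re c \<le> a" by (rule a)
    define w where "w = AC *v v - c *s v"
    have "poly_apply AC q w = 0" using 0 by (simp add: w_def poly_apply_commute)
    then obtain C where C: "\<And>t. t \<ge> 0 \<Longrightarrow> norm (Y t *v w) \<le> C * exp ((a + \<delta>) * t)"
      using IH by blast
    \<comment> \<open>The slack \<delta> keeps this rate positive even when Re c = a; otherwise the
      integral of e^(\<kappa> t) would produce a factor t instead of the constant C /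
      \<kappa>.\<close>
    define \<kappa> where "\<kappa> = a + \<delta> - Re c"
    have \<kappa>: "\<kappa> > 0" using ca \<delta> by (simp add: \<kappa>_def)
    define z where "z t = exp (of_real t * (- c)) *s (Y t *v v)" for t :: real
    have dz: "(z has_vector_derivative exp (of_real t * (- c)) *s (Y t *v w)) (at t within S)" for t S
    proof -
      have e: "((\<lambda>t. exp (of_real t * (- c))) has_vector_derivative exp (of_real t * (- c)) * (- c)) (at t within S)"
        using exp_scaleR_has_vector_derivative_right[of "-c" t S] by (simp add: scaleR_conv_of_real)
      have Y: "((\<lambda>t. Y t *v v) has_vector_derivative Y t *v (AC *v v)) (at t within S)"
        unfolding Y_def AC_def by (rule complexified_exp_has_vector_derivative)
      have "((\<lambda>t. exp (of_real t * (- c)) *s (Y t *v v)) has_vector_derivative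
         exp (of_real t * (- c)) *s (Y t *v (AC *v v)) + (exp (of_real t * (- c)) * (- c)) *s (Y t *v v)) (at t within S)"
        by (rule bounded_bilinear.has_vector_derivative[OF bounded_bilinear_vector_scalar_mult e Y])
      moreover have "exp (of_real t * (- c)) *s (Y t *v (AC *v v)) + (exp (of_real t * (- c)) * (- c)) *s (Y t *v v)
        = exp (of_real t * (- c)) *s (Y t *v w)"
        unfolding w_def by (simp add: vec.diff vec.scale vec_eq_iff algebra_simps)
      ultimately show ?thesis unfolding z_def by simp
    qed
    have Y0: "Y 0 *v x = x" for x :: "complex^'n"
    proof -
      have "Y 0 = mat 1" by (simp add: Y_def map_matrix_def mat_def vec_eq_iff)
      then show ?thesis by simp
    qed
    have zb: "norm (z t) \<le> norm v + C / \<kappa> * (exp (\<kappa> * t) - 1)" if "t \<ge> 0" for t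
    proof (cases "t = 0")
      case True
      then show ?thesis by (simp add: z_def Y0)
    next
      case False
      with that have "0 < t" by simp
      \<comment> \<open>Mean value inequality: the derivative of z is dominated by C e^(\<kappa> t),
        whose antiderivative is (C / \<kappa>) e^(\<kappa> t).\<close>
      have "norm (z t - z 0) \<le> C / \<kappa> * exp (\<kappa> * t) - C / \<kappa> * exp (\<kappa> * 0)"
      proof (rule differentiable_bound_general[OF \<open>0 < t\<close>, where f'="\<lambda>t. exp (of_real t * (- c)) *s (Y t *v w)"
            and \<phi>="\<lambda>t. C / \<kappa> * exp (\<kappa> * t)" and \<phi>'="\<lambda>t. C * exp (\<kappa> * t)"])
        show "continuous_on {0..t} z"
          by (rule continuous_on_vector_derivative) (rule dz)
        show "continuous_on {0..t} (\<lambda>t. C / \<kappa> * exp (\<kappa> * t))" by (intro continuous_intros)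
        show "(z has_vector_derivative exp (of_real x * (- c)) *s (Y x *v w)) (at x)" for x :: real by (rule dz)
        show "((\<lambda>t. C / \<kappa> * exp (\<kappa> * t)) has_vector_derivative C * exp (\<kappa> * x)) (at x)" for x :: real
          unfolding has_real_derivative_iff_has_vector_derivative[symmetric]
          using \<kappa> by (auto intro!: derivative_eq_intros)
        fix x :: real assume "0 < x"
        then have "norm (exp (of_real x * (- c)) *s (Y x *v w)) \<le> exp (- (x * Re c)) * (C * exp ((a + \<delta>) * x))"
          unfolding norm_vector_scalar_mult using C[of x] by simp
        also have "\<dots> = C * exp (\<kappa> * x)" by (simp add: \<kappa>_def exp_add[symmetric] algebra_simps)
        finally show "norm (exp (of_real x * (- c)) *s (Y x *v w)) \<le> C * exp (\<kappa> * x)" .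
      qed
      moreover have "z 0 = v" by (simp add: z_def Y0)
      moreover have "norm (z t) \<le> norm (z 0) + norm (z t - z 0)" by norm
      ultimately show ?thesis by (simp add: algebra_simps)
    qed
    show ?thesis unfolding Y_def[symmetric]
    proof (intro exI allI impI)
      fix t :: real assume t: "0 \<le> t"
      have C0: "C \<ge> 0" using order.trans[OF norm_ge_zero C[of 0]] by simp
      have "norm (Y t *v v) = exp (Re c * t) * norm (z t)"
      proof -
        have "norm (z t) = exp (- (Re c * t)) * norm (Y t *v v)" by (simp add: z_def norm_vector_scalar_mult mult.commute)
        then show ?thesis by (simp add: exp_minus)
      qed
      also have "\<dots> \<le> exp (Re c * t) * (norm v * exp (\<kappa> * t) + C / \<kappa> * exp (\<kappa> * t))"
      proof -
        have 1: "norm v \<le> norm v * exp (\<kappa> * t)" using \<kappa> t by (simp add: mult_le_cancel_left1)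
        have 2: "C / \<kappa> * (exp (\<kappa> * t) - 1) \<le> C / \<kappa> * exp (\<kappa> * t)" using C0 \<kappa>
          by (intro mult_left_mono) auto
        show ?thesis using zb[OF t] add_mono[OF 1 2] by (intro mult_left_mono) (linarith, simp)
      qed
      also have "\<dots> = (norm v + C / \<kappa>) * exp ((a + \<delta>) * t)"
      proof -
        have "exp (Re c * t) * exp (\<kappa> * t) = exp ((a + \<delta>) * t)"
          by (simp add: \<kappa>_def exp_add[symmetric] algebra_simps)
        then show ?thesis by (metis distrib_right mult.left_commute mult.assoc)
      qed
      finally show "norm (Y t *v v) \<le> (norm v + C / \<kappa>) * exp ((a + \<delta>) * t)" .
    qed
  qed
qed

section \<open>Annihilating polynomials and the spectrum\<close>

lemma poly_apply_monom:
  "poly_apply (map_matrix complex_of_real A) (monom c k) v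
    = c *s (map_matrix complex_of_real (matrix_pow A k) *v v)"
proof (induction k)
  case 0
  have "map_matrix complex_of_real (mat 1 :: real^'a^'a) = mat 1"
    by (simp add: map_matrix_def mat_def vec_eq_iff)
  then show ?case by (simp add: monom_0)
next
  case (Suc k)
  then show ?case
    by (simp add: monom_Suc vec.scale map_matrix_of_real_mult matrix_vector_mul_assoc)
qed

lemma poly_apply_sum: "poly_apply A (sum f I) v = (\<Sum>i\<in>I. poly_apply A (f i) v)"
  by (induction I rule: infinite_finite_induct) (simp_all add: poly_apply_add)

text \<open>Dimension count: there is one power more than the dimension of the space of
  matrices.\<close>

lemma powers_linearly_dependent:
  fixes A :: "real^'n^'n"
  shows "\<exists>N a. (\<exists>k\<le>N. a k \<noteq> 0) \<and> (\<Sum>k\<le>N. a k *\<^sub>R matrix_pow A k) = 0"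
proof -
  define N where "N = DIM(real^'n^'n)"
  show ?thesis
  proof (cases "inj_on (matrix_pow A) {..N}")
    case True
    then have "card (matrix_pow A ` {..N}) = Suc N" by (simp add: card_image)
    then have "dependent (matrix_pow A ` {..N})"
      by (intro dependent_biggerset) (simp add: N_def)
    then obtain u where u: "\<exists>X\<in>matrix_pow A ` {..N}. u X \<noteq> 0"
      "(\<Sum>X\<in>matrix_pow A ` {..N}. u X *\<^sub>R X) = 0"
      by (subst (asm) dependent_finite) auto
    then have "(\<Sum>k\<le>N. u (matrix_pow A k) *\<^sub>R matrix_pow A k) = 0"
      by (simp add: sum.reindex[OF True])
    with u(1) show ?thesis by (intro exI[of _ N] exI[of _ "\<lambda>k. u (matrix_pow A k)"]) auto
  next
    case False
    then obtain i j where ij: "i \<noteq> j" "i \<le> N" "j \<le> N" "matrix_pow A i = matrix_pow A j"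
      by (auto simp: inj_on_def)
    \<comment> \<open>Equal powers collapse in the image set, so a relation among its elements need
      not be available; the difference of the two equal powers is a relation directly.\<close>
    define a :: "nat \<Rightarrow> real" where "a k = (if k = i then 1 else 0) - (if k = j then 1 else 0)" for k
    have "(\<Sum>k\<le>N. a k *\<^sub>R matrix_pow A k) = 0"
      using ij by (simp add: a_def scaleR_diff_left sum_subtractf if_distrib[of "\<lambda>r. r *\<^sub>R _"] cong: if_cong)
    moreover have "a i \<noteq> 0" using ij by (simp add: a_def)
    ultimately show ?thesis using ij(2) by blast
  qed
qed

text \<open>The coefficients of a linear relation among the powers of A form the polynomial. It
  starts the growth induction for every vector and also has all eigenvalues among its roots.\<close>

lemma annihilating_poly_exists:
  fixes A :: "real^'n^'n"
  shows "\<exists>p. p \<noteq> 0 \<and> (\<forall>v. poly_apply (map_matrix complex_of_real A) p v = 0)"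
proof -
  obtain N a k where k: "k \<le> N" "a k \<noteq> 0" and sum0: "(\<Sum>k\<le>N. a k *\<^sub>R matrix_pow A k) = 0"
    using powers_linearly_dependent by blast
  define p where "p = (\<Sum>k\<le>N. monom (complex_of_real (a k)) k)"
  have "coeff p k = of_real (a k)"
    using k by (simp add: p_def coeff_sum if_distrib cong: if_cong)
  with k have "p \<noteq> 0" by auto
  moreover have "poly_apply (map_matrix complex_of_real A) p v = 0" for v
  proof -
    interpret bounded_linear "\<lambda>X :: real^'n^'n. map_matrix complex_of_real X *v v"
      by (rule bounded_linear_complexified_mult)
    have "complex_of_real c *s w = c *\<^sub>R w" for c and w :: "complex^'n"
      by (simp add: vec_eq_iff scaleR_conv_of_real[where 'a=complex])
    then have "poly_apply (map_matrix complex_of_real A) p v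
      = map_matrix complex_of_real (\<Sum>k\<le>N. a k *\<^sub>R matrix_pow A k) *v v"
      unfolding p_def poly_apply_sum poly_apply_monom sum scaleR by simp
    then show ?thesis by (simp add: sum0 zero)
  qed
  ultimately show ?thesis by blast
qed

lemma poly_apply_eigenvector:
  assumes "A *v v = c *s v" shows "poly_apply A p v = poly p c *s v"
  by (induction p) (simp_all add: vec.scale assms algebra_simps)

text \<open>Finiteness is what gives \<open>Min\<close> and \<open>Max\<close> in
  \<open>min_re_eigenvalue\<close> and \<open>max_re_eigenvalue\<close> their meaning. On an
  eigenvector p(A) acts as the scalar p(c), so every eigenvalue is a root of the annihilating
  polynomial.\<close>

lemma finite_complex_eigenvalues: "finite {c. complex_eigenvalue A c}"
proof -
  obtain p where p: "p \<noteq> 0" "\<And>v. poly_apply (map_matrix complex_of_real A) p v = 0"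
    using annihilating_poly_exists by blast
  have "poly p c = 0" if "complex_eigenvalue A c" for c
  proof -
    from that obtain v where v: "v \<noteq> 0" "map_matrix complex_of_real A *v v = c *s v"
      by (auto simp: complex_eigenvalue_def)
    then show ?thesis using p(2)[of v] poly_apply_eigenvector[OF v(2), of p] by simp
  qed
  then show ?thesis
    by (intro finite_subset[OF _ poly_roots_finite[OF p(1)]]) auto
qed

lemma min_re_eigenvalue_le: "complex_eigenvalue A c \<Longrightarrow> min_re_eigenvalue A \<le> Re c"
  by (simp add: min_re_eigenvalue_def finite_complex_eigenvalues)

lemma max_re_eigenvalue_ge: "complex_eigenvalue A c \<Longrightarrow> Re c \<le> max_re_eigenvalue A"
  by (simp add: max_re_eigenvalue_def finite_complex_eigenvalues)

lemma complex_eigenvalue_uminus: "complex_eigenvalue (- A) c \<longleftrightarrow> complex_eigenvalue A (- c)"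
proof -
  have "map_matrix complex_of_real (- A) *v v = - (map_matrix complex_of_real A *v v)" for v
    by (simp add: map_matrix_def matrix_vector_mult_def vec_eq_iff sum_negf)
  moreover have "- w = c *s v \<longleftrightarrow> w = (- c) *s v" for w v :: "complex^'a"
    by (metis minus_minus vec.scale_minus_left)
  ultimately show ?thesis by (simp add: complex_eigenvalue_def)
qed

text \<open>The columns of the exponential are the images of the vectors \<open>axis j 1\<close>,
  each of which obeys the growth bound for complex vectors; the finitely many constants are added
  up.\<close>

lemma matrix_exp_growth:
  fixes A :: "real^'n^'n"
  assumes "\<And>c. complex_eigenvalue A c \<Longrightarrow> Re c \<le> a" "\<delta> > 0"
  obtains C where "C > 0" "\<And>t. t \<ge> 0 \<Longrightarrow> norm (matrix_exp (t *\<^sub>R A)) \<le> C * exp ((a + \<delta>) * t)"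
proof -
  obtain p where p: "p \<noteq> 0" "\<And>v. poly_apply (map_matrix complex_of_real A) p v = 0"
    using annihilating_poly_exists by blast
  have "\<forall>j. \<exists>C. \<forall>t\<ge>0. norm (map_matrix complex_of_real (matrix_exp (t *\<^sub>R A)) *v axis j 1)
      \<le> C * exp ((a + \<delta>) * t)"
    by (intro allI complexified_exp_growth[OF assms p]) auto
  then obtain C where C: "\<And>j t. t \<ge> 0 \<Longrightarrow>
      norm (map_matrix complex_of_real (matrix_exp (t *\<^sub>R A)) *v axis j 1) \<le> C j * exp ((a + \<delta>) * t)"
    by metis
  have entry: "\<bar>matrix_exp (t *\<^sub>R A) $ i $ j\<bar> \<le> C j * exp ((a + \<delta>) * t)" if "t \<ge> 0" for t i j
  proof -
    have "\<bar>matrix_exp (t *\<^sub>R A) $ i $ j\<bar> =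
      cmod ((map_matrix complex_of_real (matrix_exp (t *\<^sub>R A)) *v axis j 1) $ i)"
      by (simp add: matrix_vector_mult_def axis_def map_matrix_def if_distrib cong: if_cong)
    also have "\<dots> \<le> norm (map_matrix complex_of_real (matrix_exp (t *\<^sub>R A)) *v axis j 1)"
      by (rule Finite_Cartesian_Product.norm_nth_le)
    finally show ?thesis using C[OF that, of j] by linarith
  qed
  define K where "K = max 1 (\<Sum>i::'n\<in>UNIV. \<Sum>j\<in>UNIV. C j)"
  show thesis
  proof
    show "K > 0" by (simp add: K_def)
    fix t :: real assume t: "t \<ge> 0"
    have "norm (matrix_exp (t *\<^sub>R A)) \<le> (\<Sum>i::'n\<in>UNIV. \<Sum>j\<in>UNIV. C j * exp ((a + \<delta>) * t))"
      by (rule order.trans[OF norm_matrix_le_sum_abs]) (intro sum_mono entry t)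
    also have "\<dots> = (\<Sum>i::'n\<in>UNIV. \<Sum>j\<in>UNIV. C j) * exp ((a + \<delta>) * t)"
      by (simp add: sum_distrib_right)
    also have "\<dots> \<le> K * exp ((a + \<delta>) * t)" by (intro mult_right_mono) (auto simp: K_def)
    finally show "norm (matrix_exp (t *\<^sub>R A)) \<le> K * exp ((a + \<delta>) * t)" .
  qed
qed

text \<open>As a function of t the determinant turns sums into products, so its derivative
  everywhere is determined by the one at 0, and that is found from the Leibniz formula. The result
  is the equation d' = (trace A) d with d(0) = 1.\<close>

lemma det_matrix_exp: "det (matrix_exp (t *\<^sub>R A)) = exp (t * trace A)"
proof -
  define d where "d t = det (matrix_exp (t *\<^sub>R A))" for t
  have dmult: "d (s + t) = d s * d t" for s t
    by (simp add: d_def matrix_exp_scaleR_add det_mul)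
  have entry: "((\<lambda>t. matrix_exp (t *\<^sub>R A) $ i $ j) has_field_derivative A $ i $ j) (at 0)" for i j
  proof -
    have "bounded_linear (\<lambda>X::real^'a^'a. X $ i $ j)"
      by (intro bounded_linear_intros bounded_linear_compose[OF bounded_linear_vec_nth])
    from bounded_linear.has_vector_derivative[OF this matrix_exp_has_vector_derivative[of A 0]]
    show ?thesis by (simp add: has_real_derivative_iff_has_vector_derivative)
  qed
  have d0: "(d has_field_derivative trace A) (at 0)"
  proof -
    have prodD: "((\<lambda>t. \<Prod>i\<in>UNIV. matrix_exp (t *\<^sub>R A) $ i $ p i) has_field_derivative
       (\<Sum>i\<in>UNIV. A $ i $ p i * (\<Prod>j\<in>UNIV - {i}. (mat 1 :: real^'a^'a) $ j $ p j))) (at 0)" for p :: "'a \<Rightarrow> 'a"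
      using has_field_derivative_prod[of UNIV "\<lambda>i t. matrix_exp (t *\<^sub>R A) $ i $ p i" "\<lambda>i. A $ i $ p i" 0] entry
      by simp
    have D: "(d has_field_derivative (\<Sum>p | p permutes (UNIV::'a set). of_int (sign p) *
       (\<Sum>i\<in>UNIV. A $ i $ p i * (\<Prod>j\<in>UNIV - {i}. (mat 1 :: real^'a^'a) $ j $ p j)))) (at 0)"
      unfolding d_def det_def by (intro DERIV_sum DERIV_cmult prodD)
    \<comment> \<open>A permutation other than the identity moves at least two points. After one
      factor is differentiated, some off-diagonal entry of the identity matrix is left, and it
      vanishes.\<close>
    have z: "(\<Sum>i\<in>UNIV. A $ i $ p i * (\<Prod>j\<in>UNIV - {i}. (mat 1 :: real^'a^'a) $ j $ p j)) = 0"
      if p: "p permutes UNIV" "p \<noteq> id" for p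
    proof (rule sum.neutral, rule ballI)
      fix i
      from p(2) obtain k where k: "p k \<noteq> k" by (auto simp: fun_eq_iff)
      have "\<exists>j. j \<noteq> i \<and> p j \<noteq> j"
      proof (cases "k = i")
        case True
        with k p(1) have "p (p k) \<noteq> p k" by (metis permutes_inv_eq)
        with True k show ?thesis by auto
      qed (use k in auto)
      then obtain j where "j \<noteq> i" "p j \<noteq> j" by blast
      then have "(\<Prod>j\<in>UNIV - {i}. (mat 1 :: real^'a^'a) $ j $ p j) = 0"
        by (intro prod_zero bexI[of _ j]) (auto simp: mat_def)
      then show "A $ i $ p i * (\<Prod>j\<in>UNIV - {i}. (mat 1 :: real^'a^'a) $ j $ p j) = 0" by simp
    qed
    have "(\<Sum>p | p permutes (UNIV::'a set). of_int (sign p) *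
       (\<Sum>i\<in>UNIV. A $ i $ p i * (\<Prod>j\<in>UNIV - {i}. (mat 1 :: real^'a^'a) $ j $ p j))) =
      (\<Sum>p\<in>{id}. of_int (sign p) *
       (\<Sum>i\<in>UNIV. A $ i $ p i * (\<Prod>j\<in>UNIV - {i}. (mat 1 :: real^'a^'a) $ j $ p j)))"
      by (rule sum.mono_neutral_right) (auto simp: permutes_id z finite_permutations)
    also have "\<dots> = trace A" by (simp add: trace_def mat_def sign_id)
    finally show ?thesis using D by simp
  qed
  have dd: "(d has_field_derivative d t * trace A) (at t)" for t
  proof -
    have "((\<lambda>s. d t * d (s - t)) has_field_derivative d t * trace A) (at t)"
      using d0 by (intro DERIV_cmult) (simp add: DERIV_shift[of d _ t "-t", simplified])
    moreover have "d t * d (s - t) = d s" for s using dmult[of t "s - t"] by simp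
    ultimately show ?thesis by simp
  qed
  have "((\<lambda>t. d t * exp (- t * trace A)) has_field_derivative 0) (at t)" for t
    by (rule derivative_eq_intros dd refl)+ (simp add: algebra_simps)
  then have "d t * exp (- t * trace A) = d 0 * exp (- 0 * trace A)"
    using DERIV_isconst_all by blast
  then have "d t = exp (t * trace A)"
    by (simp add: d_def exp_minus field_simps)
  then show ?thesis by (simp add: d_def)
qed

section \<open>Characteristic functions and convergence in probability\<close>

lemma measurable_vec_nth [measurable (raw)]:
  fixes f :: "'a \<Rightarrow> 'b::real_normed_vector^'k"
  assumes "f \<in> borel_measurable M" shows "(\<lambda>x. f x $ k) \<in> borel_measurable M"
  by (rule measurable_compose[OF assms borel_measurable_continuous_onI]) (intro continuous_intros)

context prob_space begin

text \<open>Levy's continuity theorem gives weak convergence to the point mass at 0, which does not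
  charge the boundary of the complement of the ball of radius \<epsilon>.\<close>

lemma char_tendsto_1_imp_prob_tendsto_0_real:
  fixes X :: "nat \<Rightarrow> 'a \<Rightarrow> real"
  assumes [measurable]: "\<And>n. X n \<in> borel_measurable M"
    and char: "\<And>t. (\<lambda>n. CLINT \<omega>|M. iexp (t * X n \<omega>)) \<longlonglongrightarrow> 1"
    and "\<epsilon> > 0"
  shows "(\<lambda>n. prob {\<omega> \<in> space M. \<bar>X n \<omega>\<bar> > \<epsilon>}) \<longlonglongrightarrow> 0"
proof -
  have rd: "real_distribution (distr M borel (X n))" for n
    by (intro real_distribution_distr) simp
  interpret R: real_distribution "return borel (0::real)"
    by (simp add: real_distribution_def real_distribution_axioms_def prob_space_return)
  have c: "(\<lambda>n. char (distr M borel (X n)) t) \<longlonglongrightarrow> char (return borel 0) t" for t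
  proof -
    have "char (distr M borel (X n)) t = (CLINT \<omega>|M. iexp (t * X n \<omega>))" for n
      unfolding char_def by (subst integral_distr) simp_all
    moreover have "char (return borel 0) t = 1"
      unfolding char_def by (subst integral_return) simp_all
    ultimately show ?thesis using char by simp
  qed
  have weak: "weak_conv_m (\<lambda>n. distr M borel (X n)) (return borel 0)"
    using rd R.real_distribution_axioms c by (rule levy_continuity)
  let ?A = "- cball (0::real) \<epsilon>"
  have "(\<lambda>n. measure (distr M borel (X n)) ?A) \<longlonglongrightarrow> measure (return borel 0) ?A"
    using \<open>\<epsilon> > 0\<close>
    by (intro weak_conv_imp_continuity_set_conv[OF rd R.real_distribution_axioms weak])
       (auto simp: frontier_complement emeasure_return indicator_def frontier_cball)
  moreover have "measure (distr M borel (X n)) ?A = prob {\<omega> \<in> space M. \<bar>X n \<omega>\<bar> > \<epsilon>}" for n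
    by (subst measure_distr) (auto intro!: arg_cong[where f=prob])
  moreover have "measure (return borel 0) ?A = 0"
    using \<open>\<epsilon> > 0\<close> by (simp add: measure_return)
  ultimately show ?thesis by simp
qed

lemma char_tendsto_1_imp_prob_tendsto_0:
  fixes X :: "nat \<Rightarrow> 'a \<Rightarrow> real^'k"
  assumes [measurable]: "\<And>n. X n \<in> borel_measurable M"
    and char: "\<And>u. (\<lambda>n. CLINT \<omega>|M. iexp (X n \<omega> \<bullet> u)) \<longlonglongrightarrow> 1"
    and "\<epsilon> > 0"
  shows "(\<lambda>n. prob {\<omega> \<in> space M. norm (X n \<omega>) > \<epsilon>}) \<longlonglongrightarrow> 0"
proof -
  \<comment> \<open>If all coordinates are at most this in modulus, the sum of their moduli, and
    with it the Euclidean norm, is at most \<epsilon>.\<close>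
  define e where "e = \<epsilon> / real CARD('k)"
  have e: "e > 0" using \<open>\<epsilon> > 0\<close> by (simp add: e_def)
  have comp: "(\<lambda>n. prob {\<omega> \<in> space M. \<bar>X n \<omega> $ k\<bar> > e}) \<longlonglongrightarrow> 0" for k
  proof (rule char_tendsto_1_imp_prob_tendsto_0_real[OF _ _ e])
    show "(\<lambda>n. CLINT \<omega>|M. iexp (t * X n \<omega> $ k)) \<longlonglongrightarrow> 1" for t
      using char[of "t *\<^sub>R axis k 1"] by (simp add: inner_axis)
  qed simp
  have "(\<lambda>n. \<Sum>k\<in>UNIV. prob {\<omega> \<in> space M. \<bar>X n \<omega> $ k\<bar> > e}) \<longlonglongrightarrow> (\<Sum>k\<in>(UNIV::'k set). 0)"
    by (intro tendsto_sum comp)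
  then have lim: "(\<lambda>n. \<Sum>k\<in>UNIV. prob {\<omega> \<in> space M. \<bar>X n \<omega> $ k\<bar> > e}) \<longlonglongrightarrow> 0" by simp
  have le: "prob {\<omega> \<in> space M. norm (X n \<omega>) > \<epsilon>} \<le> (\<Sum>k\<in>UNIV. prob {\<omega> \<in> space M. \<bar>X n \<omega> $ k\<bar> > e})" for n
  proof -
    have "\<exists>k. \<bar>x $ k\<bar> > e" if "norm x > \<epsilon>" for x :: "real^'k"
    proof (rule ccontr)
      assume "\<not> ?thesis"
      then have "(\<Sum>k\<in>UNIV. \<bar>x $ k\<bar>) \<le> (\<Sum>k\<in>(UNIV::'k set). e)" by (intro sum_mono) (simp add: not_less)
      also have "\<dots> = \<epsilon>" by (simp add: e_def)
      finally show False using norm_le_l1_cart[of x] that by simp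
    qed
    then have "{\<omega> \<in> space M. norm (X n \<omega>) > \<epsilon>} \<subseteq> (\<Union>k\<in>UNIV. {\<omega> \<in> space M. \<bar>X n \<omega> $ k\<bar> > e})" by auto
    then have "prob {\<omega> \<in> space M. norm (X n \<omega>) > \<epsilon>} \<le> prob (\<Union>k\<in>UNIV. {\<omega> \<in> space M. \<bar>X n \<omega> $ k\<bar> > e})"
      by (intro finite_measure_mono) auto
    also have "\<dots> \<le> (\<Sum>k\<in>UNIV. prob {\<omega> \<in> space M. \<bar>X n \<omega> $ k\<bar> > e})"
      by (intro finite_measure_subadditive_finite) auto
    finally show ?thesis .
  qed
  show ?thesis
    by (rule tendsto_sandwich[OF _ _ tendsto_const lim]) (auto intro!: always_eventually le)
qed

text \<open>Along a rapidly chosen subsequence the increments are almost surely summable by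
  Borel-Cantelli. Its limit Y then attracts the whole sequence, by comparing X n with late members
  of the subsequence.\<close>

lemma Cauchy_in_probability_converges:
  fixes X :: "nat \<Rightarrow> 'a \<Rightarrow> real^'k"
  assumes X[measurable]: "\<And>n. X n \<in> borel_measurable M"
    and Cauchy: "\<And>\<epsilon> \<eta>. \<epsilon> > 0 \<Longrightarrow> \<eta> > 0 \<Longrightarrow>
      \<exists>N. \<forall>m\<ge>N. \<forall>n\<ge>N. prob {\<omega> \<in> space M. norm (X m \<omega> - X n \<omega>) > \<epsilon>} < \<eta>"
  shows "\<exists>Y. converges_in_probability M X Y"
proof -
  have "\<forall>k. \<exists>N. \<forall>m\<ge>N. \<forall>n\<ge>N. prob {\<omega> \<in> space M. norm (X m \<omega> - X n \<omega>) > (1/2)^k} < (1/2)^k"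
    by (intro allI Cauchy) simp_all
  from choice[OF this] obtain N where "\<forall>k. \<forall>m\<ge>N k. \<forall>n\<ge>N k.
      prob {\<omega> \<in> space M. norm (X m \<omega> - X n \<omega>) > (1/2)^k} < (1/2)^k" ..
  then have N: "prob {\<omega> \<in> space M. norm (X m \<omega> - X n \<omega>) > (1/2)^k} < (1/2)^k"
    if "m \<ge> N k" "n \<ge> N k" for k m n using that by simp
  \<comment> \<open>Partial sums make r increasing, so both \<open>r k\<close> and
    \<open>r (Suc k)\<close> lie beyond \<open>N k\<close>; the summand 1 ensures that
    \<open>r k\<close> is at least k.\<close>
  define r where "r k = (\<Sum>i\<le>k. N i + 1)" for k
  have r_ge: "N k \<le> r k" for k
    unfolding r_def using member_le_sum[of k "{..k}" "\<lambda>i. N i + 1"] by simp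
  have r_Suc: "N k \<le> r (Suc k)" for k using r_ge[of k] by (simp add: r_def)
  have r_id: "k \<le> r k" for k
    by (induction k) (auto simp: r_def)
  define B where "B k = {\<omega> \<in> space M. norm (X (r (Suc k)) \<omega> - X (r k) \<omega>) > (1/2)^k}" for k
  have B: "prob (B k) \<le> (1/2)^k" for k
    unfolding B_def by (intro less_imp_le N r_ge r_Suc)
  have "AE \<omega> in M. eventually (\<lambda>k. \<omega> \<in> space M - B k) sequentially"
  proof (rule borel_cantelli_AE1)
    show "B k \<in> sets M" for k unfolding B_def by measurable
    show "summable (\<lambda>n. prob (B n))"
      by (rule summable_comparison_test[OF _ summable_geometric[of "1/2 :: real"]]) (auto intro!: B exI[of _ 0])
  qed (simp add: emeasure_eq_measure)
  then have conv: "AE \<omega> in M. convergent (\<lambda>k. X (r k) \<omega>)"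
  proof eventually_elim
    fix \<omega> assume ev: "eventually (\<lambda>k. \<omega> \<in> space M - B k) sequentially"
    have "summable (\<lambda>k. X (r (Suc k)) \<omega> - X (r k) \<omega>)"
    proof (rule summable_comparison_test_ev[OF _ summable_geometric[of "1/2 :: real"]])
      show "\<forall>\<^sub>F k in sequentially. norm (X (r (Suc k)) \<omega> - X (r k) \<omega>) \<le> (1/2)^k"
        using ev by eventually_elim (auto simp: B_def not_less)
    qed simp
    then have "convergent (\<lambda>n. \<Sum>k<n. X (r (Suc k)) \<omega> - X (r k) \<omega>)"
      by (simp add: summable_iff_convergent)
    moreover have "(\<Sum>k<n. X (r (Suc k)) \<omega> - X (r k) \<omega>) = X (r n) \<omega> - X (r 0) \<omega>" for n
      by (rule sum_lessThan_telescope)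
    ultimately have "convergent (\<lambda>n. X (r n) \<omega> - X (r 0) \<omega>)" by simp
    from convergent_add[OF this convergent_const[of "X (r 0) \<omega>"]]
    show "convergent (\<lambda>k. X (r k) \<omega>)" by simp
  qed
  \<comment> \<open>On the null set without convergence \<open>lim\<close> has an unspecified value,
    but Y is measurable all the same.\<close>
  define Y where "Y \<omega> = lim (\<lambda>k. X (r k) \<omega>)" for \<omega>
  have Y[measurable]: "Y \<in> borel_measurable M" unfolding Y_def by measurable
  have sub: "(\<lambda>k. prob {\<omega> \<in> space M. norm (X (r k) \<omega> - Y \<omega>) > \<epsilon>}) \<longlonglongrightarrow> 0" if "\<epsilon> > 0" for \<epsilon>
  proof -
    define F where "F k \<omega> = (indicator {\<omega> \<in> space M. norm (X (r k) \<omega> - Y \<omega>) > \<epsilon>} \<omega> :: real)" for k \<omega>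
    have "(\<lambda>k. integral\<^sup>L M (F k)) \<longlonglongrightarrow> integral\<^sup>L M (\<lambda>\<omega>. 0)"
    proof (rule integral_dominated_convergence[where w="\<lambda>_. 1"])
      show "F i \<in> borel_measurable M" for i unfolding F_def by measurable
      show "AE x in M. (\<lambda>i. F i x) \<longlonglongrightarrow> 0"
        using conv
      proof eventually_elim
        fix \<omega> assume "convergent (\<lambda>k. X (r k) \<omega>)"
        then have "(\<lambda>k. X (r k) \<omega>) \<longlonglongrightarrow> Y \<omega>" by (simp add: Y_def convergent_LIMSEQ_iff)
        then have "\<forall>\<^sub>F k in sequentially. dist (X (r k) \<omega>) (Y \<omega>) < \<epsilon>" using that by (rule tendstoD)
        then have "\<forall>\<^sub>F k in sequentially. F k \<omega> = 0" by eventually_elim (simp add: F_def dist_norm)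
        then show "(\<lambda>i. F i \<omega>) \<longlonglongrightarrow> 0" by (rule tendsto_eventually)
      qed
    qed (auto simp: F_def)
    then show ?thesis by (simp add: F_def[abs_def])
  qed
  have "(\<lambda>n. prob {\<omega> \<in> space M. norm (X n \<omega> - Y \<omega>) > \<epsilon>}) \<longlonglongrightarrow> 0" if \<epsilon>: "\<epsilon> > 0" for \<epsilon>
  proof (rule LIMSEQ_I)
    fix \<eta> :: real assume "\<eta> > 0"
    then obtain N where N: "\<And>m n. m \<ge> N \<Longrightarrow> n \<ge> N \<Longrightarrow>
      prob {\<omega> \<in> space M. norm (X m \<omega> - X n \<omega>) > \<epsilon>/2} < \<eta>/2"
      using Cauchy[of "\<epsilon>/2" "\<eta>/2"] \<epsilon> by auto
    have le: "prob {\<omega> \<in> space M. norm (X n \<omega> - Y \<omega>) > \<epsilon>} \<le> \<eta>/2" if "n \<ge> N" for n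
    proof (rule LIMSEQ_le_const)
      show "(\<lambda>k. \<eta>/2 + prob {\<omega> \<in> space M. norm (X (r k) \<omega> - Y \<omega>) > \<epsilon>/2}) \<longlonglongrightarrow> \<eta>/2"
        using tendsto_add[OF tendsto_const sub[of "\<epsilon>/2"], of "\<eta>/2"] \<epsilon> by simp
      have "prob {\<omega> \<in> space M. norm (X n \<omega> - Y \<omega>) > \<epsilon>}
        \<le> \<eta>/2 + prob {\<omega> \<in> space M. norm (X (r k) \<omega> - Y \<omega>) > \<epsilon>/2}" if "k \<ge> N" for k
      proof -
        have "prob {\<omega> \<in> space M. norm (X n \<omega> - Y \<omega>) > \<epsilon>}
          \<le> prob ({\<omega> \<in> space M. norm (X n \<omega> - X (r k) \<omega>) > \<epsilon>/2} \<union> {\<omega> \<in> space M. norm (X (r k) \<omega> - Y \<omega>) > \<epsilon>/2})"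
        proof (intro finite_measure_mono subsetI)
          fix \<omega> assume \<omega>: "\<omega> \<in> {\<omega> \<in> space M. norm (X n \<omega> - Y \<omega>) > \<epsilon>}"
          have "norm (X n \<omega> - Y \<omega>) \<le> norm (X n \<omega> - X (r k) \<omega>) + norm (X (r k) \<omega> - Y \<omega>)" by norm
          with \<omega> show "\<omega> \<in> {\<omega> \<in> space M. norm (X n \<omega> - X (r k) \<omega>) > \<epsilon>/2} \<union> {\<omega> \<in> space M. norm (X (r k) \<omega> - Y \<omega>) > \<epsilon>/2}"
            by auto
        qed simp
        also have "\<dots> \<le> prob {\<omega> \<in> space M. norm (X n \<omega> - X (r k) \<omega>) > \<epsilon>/2} +
            prob {\<omega> \<in> space M. norm (X (r k) \<omega> - Y \<omega>) > \<epsilon>/2}"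
          by (intro measure_Un_le) auto
        also have "prob {\<omega> \<in> space M. norm (X n \<omega> - X (r k) \<omega>) > \<epsilon>/2} \<le> \<eta>/2"
          using N[of n "r k"] r_id[of k] that \<open>n \<ge> N\<close> by simp
        finally show ?thesis by simp
      qed
      then show "\<exists>N. \<forall>k\<ge>N. prob {\<omega> \<in> space M. norm (X n \<omega> - Y \<omega>) > \<epsilon>}
        \<le> \<eta>/2 + prob {\<omega> \<in> space M. norm (X (r k) \<omega> - Y \<omega>) > \<epsilon>/2}" by blast
    qed
    have "norm (prob {\<omega> \<in> space M. norm (X n \<omega> - Y \<omega>) > \<epsilon>} - 0) < \<eta>" if "n \<ge> N" for n
      using le[OF that] \<open>\<eta> > 0\<close> by simp
    then show "\<exists>no. \<forall>n\<ge>no. norm (prob {\<omega> \<in> space M. norm (X n \<omega> - Y \<omega>) > \<epsilon>} - 0) < \<eta>"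
      by blast
  qed
  with Y show ?thesis unfolding converges_in_probability_def by blast
qed

end

section \<open>Integrals of simple functions\<close>

lemma finite_borel_sets_empty: "{} \<in> finite_borel_sets"
  by (simp add: finite_borel_sets_def)

lemma finite_borel_sets_Int: "A \<in> finite_borel_sets \<Longrightarrow> B \<in> sets borel \<Longrightarrow> A \<inter> B \<in> finite_borel_sets"
  using emeasure_mono[of "A \<inter> B" A lborel] by (auto simp: finite_borel_sets_def)

lemma finite_borel_sets_Diff: "A \<in> finite_borel_sets \<Longrightarrow> B \<in> sets borel \<Longrightarrow> A - B \<in> finite_borel_sets"
  using emeasure_mono[of "A - B" A lborel] by (auto simp: finite_borel_sets_def)

lemma finite_borel_sets_Un: "A \<in> finite_borel_sets \<Longrightarrow> B \<in> finite_borel_sets \<Longrightarrow> A \<union> B \<in> finite_borel_sets"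
  using emeasure_subadditive[of A lborel B] by (auto simp: finite_borel_sets_def less_top[symmetric] top_unique)

lemma finite_borel_sets_UN:
  "finite I \<Longrightarrow> (\<And>i. i \<in> I \<Longrightarrow> A i \<in> finite_borel_sets) \<Longrightarrow> (\<Union>i\<in>I. A i) \<in> finite_borel_sets"
  by (induction I rule: finite_induct) (auto simp: finite_borel_sets_empty finite_borel_sets_Un)

lemma finite_borel_setsD: "A \<in> finite_borel_sets \<Longrightarrow> A \<in> sets borel"
  by (simp add: finite_borel_sets_def)

lemma measurable_matrix_vector_mult [measurable (raw)]:
  fixes f :: "'a \<Rightarrow> real^'k"
  assumes "f \<in> borel_measurable M" shows "(\<lambda>x. R *v f x) \<in> borel_measurable M"
  by (rule measurable_compose[OF assms borel_measurable_continuous_onI])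
    (intro linear_continuous_on matrix_vector_mul_bounded_linear)

lemma sum_indicator_disjoint_family:
  fixes x :: "'i \<Rightarrow> 'x::real_vector"
  assumes "finite I" "disjoint_family_on C I" "i \<in> I" "s \<in> C i"
  shows "(\<Sum>j\<in>I. indicator (C j) s *\<^sub>R x j) = x i"
proof -
  have "(\<Sum>j\<in>I. indicator (C j) s *\<^sub>R x j) = (\<Sum>j\<in>I. if j = i then x j else 0)"
    using assms by (intro sum.cong refl) (auto simp: disjoint_family_on_def indicator_def)
  with assms show ?thesis by simp
qed

locale generated_random_measure = prob_space P for P :: "'w measure" +
  fixes M :: "(real^'d) set \<Rightarrow> 'w \<Rightarrow> real^'k" and \<psi> :: "real^'k \<Rightarrow> complex"
  assumes M_measurable: "A \<in> finite_borel_sets \<Longrightarrow> M A \<in> borel_measurable P"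
    and M_indep: "\<And>A :: nat \<Rightarrow> _. range A \<subseteq> finite_borel_sets \<Longrightarrow> disjoint_family A \<Longrightarrow>
       indep_vars (\<lambda>_. borel) (\<lambda>n. M (A n)) UNIV"
    and M_sums: "\<And>A :: nat \<Rightarrow> _. range A \<subseteq> finite_borel_sets \<Longrightarrow> disjoint_family A \<Longrightarrow>
       (\<Union>n. A n) \<in> finite_borel_sets \<Longrightarrow> (AE \<omega> in P. (\<lambda>n. M (A n) \<omega>) sums M (\<Union>n. A n) \<omega>)"
    and \<psi>_continuous: "continuous_on UNIV \<psi>" and \<psi>_0: "\<psi> 0 = 0"
    and M_char: "A \<in> finite_borel_sets \<Longrightarrow>
       (CLINT \<omega>|P. iexp (M A \<omega> \<bullet> u)) = exp (of_real (measure lborel A) * \<psi> u)"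
begin

lemma \<psi>_measurable [measurable]: "\<psi> \<in> borel_measurable borel"
  using \<psi>_continuous by (rule borel_measurable_continuous_onI)

text \<open>The characteristic function of \<open>M {}\<close> is constantly 1, so the criterion for
  convergence to 0 in probability applies to the constant sequence and makes every tail probability
  vanish.\<close>

lemma M_empty: "AE \<omega> in P. M {} \<omega> = 0"
proof -
  note [measurable] = M_measurable[OF finite_borel_sets_empty]
  have "AE \<omega> in P. norm (M {} \<omega>) \<le> 1 / real (Suc k)" for k
  proof -
    have "(\<lambda>n::nat. prob {\<omega> \<in> space P. norm (M {} \<omega>) > 1 / real (Suc k)}) \<longlonglongrightarrow> 0"
      by (rule char_tendsto_1_imp_prob_tendsto_0) (simp_all add: M_char finite_borel_sets_empty)
    then have "prob {\<omega> \<in> space P. norm (M {} \<omega>) > 1 / real (Suc k)} = 0"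
      by (simp add: LIMSEQ_const_iff)
    then have "AE \<omega> in P. \<not> norm (M {} \<omega>) > 1 / real (Suc k)"
      by (subst AE_iff_measurable[OF _ refl]) (auto simp: emeasure_eq_measure)
    then show ?thesis by (simp add: not_less)
  qed
  then have "AE \<omega> in P. \<forall>k. norm (M {} \<omega>) \<le> 1 / real (Suc k)" by (simp add: AE_all_countable)
  then show ?thesis
  proof eventually_elim
    fix \<omega> assume *: "\<forall>k. norm (M {} \<omega>) \<le> 1 / real (Suc k)"
    show "M {} \<omega> = 0"
    proof (rule ccontr)
      assume "M {} \<omega> \<noteq> 0"
      then obtain n where "inverse (real (Suc n)) < norm (M {} \<omega>)"
        using reals_Archimedean[of "norm (M {} \<omega>)"] by auto
      with * show False by (simp add: inverse_eq_divide not_less[symmetric])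
    qed
  qed
qed

lemma M_Un:
  assumes "A \<in> finite_borel_sets" "B \<in> finite_borel_sets" "A \<inter> B = {}"
  shows "AE \<omega> in P. M (A \<union> B) \<omega> = M A \<omega> + M B \<omega>"
proof -
  have "disjoint_family (binaryset A B)"
    using assms(3) by (auto simp: disjoint_family_on_def binaryset_def)
  then have "AE \<omega> in P. (\<lambda>n. M (binaryset A B n) \<omega>) sums M (A \<union> B) \<omega>"
    using M_sums[of "binaryset A B"] assms
    by (simp add: range_binaryset_eq UN_binaryset_eq finite_borel_sets_empty finite_borel_sets_Un)
  then show ?thesis using M_empty
  proof eventually_elim
    fix \<omega> assume s: "(\<lambda>n. M (binaryset A B n) \<omega>) sums M (A \<union> B) \<omega>" and 0: "M {} \<omega> = 0"
    have "(\<lambda>n. M (binaryset A B n) \<omega>) sums (\<Sum>n<2. M (binaryset A B n) \<omega>)"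
      by (rule sums_finite) (auto simp: binaryset_def 0)
    also have "(\<Sum>n<2. M (binaryset A B n) \<omega>) = M A \<omega> + M B \<omega>"
      by (simp add: numeral_2_eq_2 binaryset_def)
    finally show "M (A \<union> B) \<omega> = M A \<omega> + M B \<omega>" using s sums_unique2 by blast
  qed
qed

lemma M_UN:
  assumes "finite I" "disjoint_family_on C I" "\<And>i. i \<in> I \<Longrightarrow> C i \<in> finite_borel_sets"
  shows "AE \<omega> in P. M (\<Union>i\<in>I. C i) \<omega> = (\<Sum>i\<in>I. M (C i) \<omega>)"
  using assms
proof (induction I rule: finite_induct)
  case empty
  then show ?case using M_empty by simp
next
  case (insert i I)
  have "AE \<omega> in P. M (\<Union>i\<in>I. C i) \<omega> = (\<Sum>i\<in>I. M (C i) \<omega>)"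
    using insert.prems by (intro insert.IH) (auto simp: disjoint_family_on_def)
  moreover have "AE \<omega> in P. M (C i \<union> (\<Union>i\<in>I. C i)) \<omega> = M (C i) \<omega> + M (\<Union>i\<in>I. C i) \<omega>"
    using insert by (intro M_Un finite_borel_sets_UN) (auto simp: disjoint_family_on_def)
  ultimately show ?case by eventually_elim (simp add: insert.hyps)
qed

text \<open>Independence yields the product formula. As it is given only for sequences of disjoint
  sets, the finite index set is enumerated by h and the enumeration continued with empty
  sets.\<close>

lemma char_linear_combination:
  fixes C :: "'i \<Rightarrow> (real^'d) set" and R :: "'i \<Rightarrow> real^'k^'k"
  assumes I: "finite I" and disj: "disjoint_family_on C I" and C: "\<And>i. i \<in> I \<Longrightarrow> C i \<in> finite_borel_sets"
  shows "(CLINT \<omega>|P. iexp ((\<Sum>i\<in>I. R i *v M (C i) \<omega>) \<bullet> u)) =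
    exp (\<Sum>i\<in>I. of_real (measure lborel (C i)) * \<psi> (transpose (R i) *v u))"
proof -
  obtain h where h: "bij_betw h {..<card I} I" using I ex_bij_betw_nat_finite by (auto simp: atLeast0LessThan)
  define A where "A n = (if n < card I then C (h n) else {})" for n
  have hI: "h n \<in> I" if "n < card I" for n using h that by (auto simp: bij_betw_def)
  have "range A \<subseteq> finite_borel_sets" using C hI by (auto simp: A_def finite_borel_sets_empty)
  moreover have "disjoint_family A"
  proof -
    have "C (h m) \<inter> C (h n) = {}" if "m < card I" "n < card I" "m \<noteq> n" for m n
    proof -
      have "h m \<noteq> h n" using h that by (auto simp: bij_betw_def inj_on_def)
      then show ?thesis using disj hI that by (auto simp: disjoint_family_on_def)
    qed
    then show ?thesis by (auto simp: disjoint_family_on_def A_def)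
  qed
  ultimately have ind: "indep_vars (\<lambda>_. borel) (\<lambda>n. M (A n)) UNIV" by (rule M_indep)
  define Z where "Z n \<omega> = iexp (M (A n) \<omega> \<bullet> (transpose (R (h n)) *v u))" for n \<omega>
  have "indep_vars (\<lambda>_. borel) (\<lambda>n \<omega>. (\<lambda>x. iexp (x \<bullet> (transpose (R (h n)) *v u))) (M (A n) \<omega>)) UNIV"
    by (rule indep_vars_compose2[OF ind]) measurable
  then have indZ: "indep_vars (\<lambda>_. borel) Z {..<card I}"
    unfolding Z_def by (rule indep_vars_subset) simp
  have AC: "A n = C (h n)" if "n < card I" for n using that by (simp add: A_def)
  have Zint: "integrable P (Z n)" if "n < card I" for n
  proof (rule integrable_const_bound[where B=1])
    have [measurable]: "M (A n) \<in> borel_measurable P" using that by (simp add: AC M_measurable C hI)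
    show "Z n \<in> borel_measurable P" unfolding Z_def by measurable
  qed (simp add: Z_def)
  have "(CLINT \<omega>|P. iexp ((\<Sum>i\<in>I. R i *v M (C i) \<omega>) \<bullet> u)) = (CLINT \<omega>|P. (\<Prod>n<card I. Z n \<omega>))"
  proof (rule Bochner_Integration.integral_cong[OF refl])
    fix \<omega>
    have "(\<Sum>i\<in>I. R i *v M (C i) \<omega>) \<bullet> u = (\<Sum>n<card I. (R (h n) *v M (C (h n)) \<omega>) \<bullet> u)"
      using sum.reindex_bij_betw[OF h, of "\<lambda>i. (R i *v M (C i) \<omega>) \<bullet> u"] by (simp add: inner_sum_left)
    also have "\<dots> = (\<Sum>n<card I. M (A n) \<omega> \<bullet> (transpose (R (h n)) *v u))"
      by (intro sum.cong refl) (simp add: AC dot_lmul_matrix[symmetric] inner_commute)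
    finally show "iexp ((\<Sum>i\<in>I. R i *v M (C i) \<omega>) \<bullet> u) = (\<Prod>n<card I. Z n \<omega>)"
      by (simp add: Z_def exp_sum[symmetric] sum_distrib_left)
  qed
  also have "\<dots> = (\<Prod>n<card I. CLINT \<omega>|P. Z n \<omega>)"
    by (rule indep_vars_lebesgue_integral) (use indZ Zint in auto)
  also have "\<dots> = (\<Prod>n<card I. exp (of_real (measure lborel (C (h n))) * \<psi> (transpose (R (h n)) *v u)))"
    unfolding Z_def by (intro prod.cong refl) (simp add: AC M_char C hI)
  also have "\<dots> = exp (\<Sum>i\<in>I. of_real (measure lborel (C i)) * \<psi> (transpose (R i) *v u))"
    unfolding sum.reindex_bij_betw[OF h, symmetric] by (rule exp_sum[symmetric]) simp
  finally show ?thesis .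
qed

text \<open>Since \<psi> vanishes at 0, composing it with a simple function gives a simple function
  again. This turns the exponent of the characteristic function into an integral in which the
  representation no longer appears.\<close>

lemma \<psi>_simple_integral:
  fixes C :: "'i \<Rightarrow> (real^'d) set" and R :: "'i \<Rightarrow> real^'k^'k"
  assumes I: "finite I" and disj: "disjoint_family_on C I" and C: "\<And>i. i \<in> I \<Longrightarrow> C i \<in> finite_borel_sets"
  shows "(CLINT s|lborel. \<psi> (transpose (\<Sum>i\<in>I. indicator (C i) s *\<^sub>R R i) *v u)) =
    (\<Sum>i\<in>I. of_real (measure lborel (C i)) * \<psi> (transpose (R i) *v u))"
proof -
  have "\<psi> (transpose (\<Sum>i\<in>I. indicator (C i) s *\<^sub>R R i) *v u) =
    (\<Sum>i\<in>I. indicator (C i) s *\<^sub>R \<psi> (transpose (R i) *v u))" for s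
  proof (cases "\<exists>i\<in>I. s \<in> C i")
    case True
    then obtain i where i: "i \<in> I" "s \<in> C i" by blast
    then show ?thesis by (simp only: sum_indicator_disjoint_family[OF I disj])
  next
    case False
    then have "(\<Sum>j\<in>I. indicator (C j) s *\<^sub>R R j) = 0"
      "(\<Sum>j\<in>I. indicator (C j) s *\<^sub>R \<psi> (transpose (R j) *v u)) = 0"
      by (auto intro!: sum.neutral)
    moreover have "transpose (0 :: real^'k^'k) *v u = 0"
      by (simp add: matrix_vector_mult_def transpose_def vec_eq_iff)
    ultimately show ?thesis by (simp only: \<psi>_0)
  qed
  moreover have "integrable lborel (\<lambda>s. indicator (C i) s *\<^sub>R \<psi> (transpose (R i) *v u))" if "i \<in> I" for i
    using C[OF that] by (simp add: finite_borel_sets_def)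
  moreover have "(CLINT s|lborel. indicator (C i) s *\<^sub>R x) = of_real (measure lborel (C i)) * x" if "i \<in> I" for i and x :: complex
    using C[OF that] by (simp add: finite_borel_sets_def scaleR_conv_of_real)
  ultimately show ?thesis by (simp add: integral_sum)
qed

end

section \<open>Common refinements and convergence of simple integrals\<close>

lemma bounded_linear_transpose_mult: "bounded_linear (\<lambda>X :: real^'n^'m. transpose X *v u)"
  by (rule linear_conv_bounded_linear[THEN iffD1], rule linearI)
    (simp_all add: transpose_def matrix_vector_mult_def vec_eq_iff algebra_simps sum.distrib sum_distrib_left)

definition simple_sum :: "((real^'d) set \<Rightarrow> 'w \<Rightarrow> real^'k) \<Rightarrow> nat \<Rightarrow> (nat \<Rightarrow> real^'k^'k) \<Rightarrow>
    (nat \<Rightarrow> (real^'d) set) \<Rightarrow> 'w \<Rightarrow> real^'k" where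
  "simple_sum M n R A \<omega> = (\<Sum>j<n. R j *v M (A j) \<omega>)"

text \<open>Index n carries the rest of U with coefficient 0. Two simple functions completed in this
  way partition the same set, which a common refinement requires.\<close>

lemma simple_representation_complete:
  fixes A :: "nat \<Rightarrow> (real^'d) set" and M :: "(real^'d) set \<Rightarrow> 'w \<Rightarrow> real^'k"
  assumes rep: "simple_representation n R A g" and U: "U \<in> finite_borel_sets" "(\<Union>j<n. A j) \<subseteq> U"
  obtains R' A' where "\<And>j. j \<le> n \<Longrightarrow> A' j \<in> finite_borel_sets" "disjoint_family_on A' {..n}"
    "(\<Union>j\<le>n. A' j) = U" "\<And>s. g s = (\<Sum>j\<le>n. indicator (A' j) s *\<^sub>R R' j)"
    "\<And>\<omega>. simple_sum M n R A \<omega> = (\<Sum>j\<le>n. R' j *v M (A' j) \<omega>)"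
proof -
  define A' where "A' j = (if j < n then A j else U - (\<Union>j<n. A j))" for j
  define R' where "R' j = (if j < n then R j else 0)" for j
  have *: "(\<Sum>j\<le>n. f j) = (\<Sum>j<n. f j) + f n" for f :: "nat \<Rightarrow> 'x::comm_monoid_add"
    by (simp add: lessThan_Suc_atMost[symmetric])
  show thesis
  proof (rule that[of A' R'])
    have A: "A j \<in> finite_borel_sets" if "j < n" for j
      using rep that by (simp add: simple_representation_def)
    then show "A' j \<in> finite_borel_sets" if "j \<le> n" for j
      using U by (auto simp: A'_def intro!: finite_borel_sets_Diff finite_borel_setsD finite_borel_sets_UN)
    show "disjoint_family_on A' {..n}"
      using rep by (auto simp: simple_representation_def disjoint_family_on_def A'_def)
    show "(\<Union>j\<le>n. A' j) = U" using U(2) by (auto simp: A'_def lessThan_Suc_atMost[symmetric] less_Suc_eq)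
    show "g s = (\<Sum>j\<le>n. indicator (A' j) s *\<^sub>R R' j)" for s
      using rep by (simp add: lessThan_Suc_atMost[symmetric] simple_representation_def A'_def R'_def)
    show "simple_sum M n R A \<omega> = (\<Sum>j\<le>n. R' j *v M (A' j) \<omega>)" for \<omega>
      by (simp add: lessThan_Suc_atMost[symmetric] simple_sum_def A'_def R'_def)
  qed
qed

context generated_random_measure begin

text \<open>Both representations are extended to a common set U and refined to the cells
  \<open>A' i \<inter> B' j\<close>. Additivity of M rewrites the difference, almost surely, as one
  linear combination over disjoint cells.\<close>

lemma char_simple_sum_diff:
  assumes g: "simple_representation n R A g" and h: "simple_representation k S B h"
  shows "(CLINT \<omega>|P. iexp ((simple_sum M n R A \<omega> - simple_sum M k S B \<omega>) \<bullet> u)) =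
    exp (CLINT s|lborel. \<psi> (transpose (g s - h s) *v u))"
proof -
  define U where "U = (\<Union>j<n. A j) \<union> (\<Union>j<k. B j)"
  have U: "U \<in> finite_borel_sets"
    using g h unfolding U_def simple_representation_def
    by (intro finite_borel_sets_Un finite_borel_sets_UN) auto
  obtain R' A' where A': "\<And>j. j \<le> n \<Longrightarrow> A' j \<in> finite_borel_sets" "disjoint_family_on A' {..n}"
    "(\<Union>j\<le>n. A' j) = U" and g': "\<And>s. g s = (\<Sum>j\<le>n. indicator (A' j) s *\<^sub>R R' j)"
    and X: "\<And>\<omega>. simple_sum M n R A \<omega> = (\<Sum>j\<le>n. R' j *v M (A' j) \<omega>)"
    by (rule simple_representation_complete[OF g U, of M]) (auto simp: U_def)
  obtain S' B' where B': "\<And>j. j \<le> k \<Longrightarrow> B' j \<in> finite_borel_sets" "disjoint_family_on B' {..k}"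
    "(\<Union>j\<le>k. B' j) = U" and h': "\<And>s. h s = (\<Sum>j\<le>k. indicator (B' j) s *\<^sub>R S' j)"
    and Y: "\<And>\<omega>. simple_sum M k S B \<omega> = (\<Sum>j\<le>k. S' j *v M (B' j) \<omega>)"
    by (rule simple_representation_complete[OF h U, of M]) (auto simp: U_def)
  define C where "C = (\<lambda>(i, j). A' i \<inter> B' j)"
  define T where "T = (\<lambda>(i, j). R' i - S' j)"
  let ?I = "{..n} \<times> {..k}"
  have C: "C p \<in> finite_borel_sets" if "p \<in> ?I" for p
    using that by (auto simp: C_def intro!: finite_borel_sets_Int A' finite_borel_setsD B')
  have disj: "disjoint_family_on C ?I"
    using A'(2) B'(2) unfolding disjoint_family_on_def C_def by fastforce
  have MA: "AE \<omega> in P. \<forall>i\<in>{..n}. M (A' i) \<omega> = (\<Sum>j\<le>k. M (A' i \<inter> B' j) \<omega>)"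
  proof (intro AE_finite_allI)
    fix i assume i: "i \<in> {..n}"
    then have "A' i = (\<Union>j\<le>k. A' i \<inter> B' j)" using A'(3) B'(3) by blast
    moreover have "AE \<omega> in P. M (\<Union>j\<le>k. A' i \<inter> B' j) \<omega> = (\<Sum>j\<le>k. M (A' i \<inter> B' j) \<omega>)"
      using i B'(2) by (intro M_UN) (auto simp: disjoint_family_on_def intro!: finite_borel_sets_Int A' finite_borel_setsD B')
    ultimately show "AE \<omega> in P. M (A' i) \<omega> = (\<Sum>j\<le>k. M (A' i \<inter> B' j) \<omega>)" by simp
  qed simp
  have MB: "AE \<omega> in P. \<forall>j\<in>{..k}. M (B' j) \<omega> = (\<Sum>i\<le>n. M (A' i \<inter> B' j) \<omega>)"
  proof (intro AE_finite_allI)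
    fix j assume j: "j \<in> {..k}"
    then have "B' j = (\<Union>i\<le>n. A' i \<inter> B' j)" using A'(3) B'(3) by blast
    moreover have "AE \<omega> in P. M (\<Union>i\<le>n. A' i \<inter> B' j) \<omega> = (\<Sum>i\<le>n. M (A' i \<inter> B' j) \<omega>)"
      using j A'(2) by (intro M_UN) (auto simp: disjoint_family_on_def intro!: finite_borel_sets_Int A' finite_borel_setsD B')
    ultimately show "AE \<omega> in P. M (B' j) \<omega> = (\<Sum>i\<le>n. M (A' i \<inter> B' j) \<omega>)" by simp
  qed simp
  have XY: "AE \<omega> in P. simple_sum M n R A \<omega> - simple_sum M k S B \<omega> = (\<Sum>p\<in>?I. T p *v M (C p) \<omega>)"
    using MA MB
  proof eventually_elim
    fix \<omega> assume 1: "\<forall>i\<in>{..n}. M (A' i) \<omega> = (\<Sum>j\<le>k. M (A' i \<inter> B' j) \<omega>)"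
      and 2: "\<forall>j\<in>{..k}. M (B' j) \<omega> = (\<Sum>i\<le>n. M (A' i \<inter> B' j) \<omega>)"
    have "simple_sum M n R A \<omega> = (\<Sum>i\<le>n. \<Sum>j\<le>k. R' i *v M (A' i \<inter> B' j) \<omega>)"
      unfolding X using 1 by (intro sum.cong refl) (simp add: vec.sum)
    moreover have "simple_sum M k S B \<omega> = (\<Sum>j\<le>k. \<Sum>i\<le>n. S' j *v M (A' i \<inter> B' j) \<omega>)"
      unfolding Y using 2 by (intro sum.cong refl) (simp add: vec.sum)
    moreover have "(\<Sum>j\<le>k. \<Sum>i\<le>n. S' j *v M (A' i \<inter> B' j) \<omega>) = (\<Sum>i\<le>n. \<Sum>j\<le>k. S' j *v M (A' i \<inter> B' j) \<omega>)"
      by (rule sum.swap)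
    ultimately show "simple_sum M n R A \<omega> - simple_sum M k S B \<omega> = (\<Sum>p\<in>?I. T p *v M (C p) \<omega>)"
      by (simp add: T_def C_def sum.cartesian_product' sum_subtractf matrix_vector_mult_diff_rdistrib)
  qed
  have gh: "g s - h s = (\<Sum>p\<in>?I. indicator (C p) s *\<^sub>R T p)" for s
  proof -
    have "(\<Sum>j\<le>k. indicator (A' i \<inter> B' j) s) = (indicator (A' i) s :: real)" if "i \<le> n" for i
    proof -
      have "(\<Sum>j\<le>k. indicator (A' i \<inter> B' j) s) = (indicator (\<Union>j\<le>k. A' i \<inter> B' j) s :: real)"
        using B'(2) by (intro indicator_UN_disjoint[symmetric]) (auto simp: disjoint_family_on_def)
      also have "(\<Union>j\<le>k. A' i \<inter> B' j) = A' i" using that A'(3) B'(3) by blast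
      finally show ?thesis .
    qed
    then have 1: "g s = (\<Sum>i\<le>n. \<Sum>j\<le>k. indicator (A' i \<inter> B' j) s *\<^sub>R R' i)"
      unfolding g' scaleR_sum_left[symmetric] by (intro sum.cong refl) auto
    have "(\<Sum>i\<le>n. indicator (A' i \<inter> B' j) s) = (indicator (B' j) s :: real)" if "j \<le> k" for j
    proof -
      have "(\<Sum>i\<le>n. indicator (A' i \<inter> B' j) s) = (indicator (\<Union>i\<le>n. A' i \<inter> B' j) s :: real)"
        using A'(2) by (intro indicator_UN_disjoint[symmetric]) (auto simp: disjoint_family_on_def)
      also have "(\<Union>i\<le>n. A' i \<inter> B' j) = B' j" using that A'(3) B'(3) by blast
      finally show ?thesis .
    qed
    then have "h s = (\<Sum>j\<le>k. \<Sum>i\<le>n. indicator (A' i \<inter> B' j) s *\<^sub>R S' j)"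
      unfolding h' scaleR_sum_left[symmetric] by (intro sum.cong refl) auto
    also have "\<dots> = (\<Sum>i\<le>n. \<Sum>j\<le>k. indicator (A' i \<inter> B' j) s *\<^sub>R S' j)"
      by (rule sum.swap)
    finally show ?thesis
      by (simp add: 1 T_def C_def sum.cartesian_product' sum_subtractf scaleR_diff_right)
  qed
  have Mm: "M (C p) \<in> borel_measurable P" if "p \<in> ?I" for p
    using C[OF that] by (rule M_measurable)
  have Xm: "simple_sum M n R A \<in> borel_measurable P" "simple_sum M k S B \<in> borel_measurable P"
    using g h unfolding simple_sum_def[abs_def] simple_representation_def
    by (auto intro!: borel_measurable_sum measurable_matrix_vector_mult M_measurable)
  have "(CLINT \<omega>|P. iexp ((simple_sum M n R A \<omega> - simple_sum M k S B \<omega>) \<bullet> u)) =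
    (CLINT \<omega>|P. iexp ((\<Sum>p\<in>?I. T p *v M (C p) \<omega>) \<bullet> u))"
  proof (rule integral_cong_AE)
    show "(\<lambda>\<omega>. iexp ((simple_sum M n R A \<omega> - simple_sum M k S B \<omega>) \<bullet> u)) \<in> borel_measurable P"
      using Xm by measurable
    have "(\<lambda>\<omega>. \<Sum>p\<in>?I. T p *v M (C p) \<omega>) \<in> borel_measurable P"
      by (intro borel_measurable_sum measurable_matrix_vector_mult Mm)
    then show "(\<lambda>\<omega>. iexp ((\<Sum>p\<in>?I. T p *v M (C p) \<omega>) \<bullet> u)) \<in> borel_measurable P" by measurable
  qed (use XY in eventually_elim, simp)
  also have "\<dots> = exp (\<Sum>p\<in>?I. of_real (measure lborel (C p)) * \<psi> (transpose (T p) *v u))"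
    by (rule char_linear_combination[OF _ disj C]) auto
  also have "\<dots> = exp (CLINT s|lborel. \<psi> (transpose (\<Sum>p\<in>?I. indicator (C p) s *\<^sub>R T p) *v u))"
    by (subst \<psi>_simple_integral[OF _ disj C]) auto
  finally show ?thesis unfolding gh .
qed

text \<open>If the integrals were not Cauchy in probability, there would be index pairs tending to
  infinity whose differences stay large with probability at least \<eta>. Along these pairs G m - G
  n tends to 0, so dominated convergence sends the exponent of the characteristic function to 0, a
  contradiction. The majorant may depend on u because the characteristic functions only have to
  converge pointwise.\<close>

theorem integrableI_dominated:
  fixes g :: "real^'d \<Rightarrow> real^'k^'k"
  assumes g: "g \<in> borel_measurable borel" and G: "\<And>n. simple_integrand (G n)"
    and lim: "AE s in lborel. (\<lambda>n. G n s) \<longlonglongrightarrow> g s"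
    and F: "\<And>u. integrable lborel (F u)"
    and dom: "\<And>u m n. AE s in lborel. norm (\<psi> (transpose (G m s - G n s) *v u)) \<le> F u s"
  shows "integrable_wrt_random_measure P M g"
  unfolding integrable_wrt_random_measure_def
proof (intro conjI exI[of _ G] allI ballI g G lim)
  fix S :: "(real^'d) set" assume S: "S \<in> sets borel"
  obtain k R A where rep: "\<And>n. simple_representation (k n) (R n) (A n) (G n)"
    using G unfolding simple_integrand_def by metis
  have repS: "simple_representation (k n) (R n) (\<lambda>j. A n j \<inter> S) (\<lambda>s. indicator S s *\<^sub>R G n s)" for n
    unfolding simple_representation_def
  proof (intro conjI allI impI ext)
    show "A n j \<inter> S \<in> finite_borel_sets" if "j < k n" for j
      using rep[of n] S that by (auto simp: simple_representation_def intro!: finite_borel_sets_Int)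
    show "disjoint_family_on (\<lambda>j. A n j \<inter> S) {..<k n}"
      using rep[of n] unfolding simple_representation_def disjoint_family_on_def by blast
    have "indicator (A n j \<inter> S) s *\<^sub>R R n j = indicator S s *\<^sub>R indicator (A n j) s *\<^sub>R R n j" for j s
      by (auto simp: indicator_def)
    moreover have "G n = (\<lambda>s. \<Sum>j<k n. indicator (A n j) s *\<^sub>R R n j)"
      using rep[of n] by (simp only: simple_representation_def)
    ultimately show "indicator S s *\<^sub>R G n s = (\<Sum>j<k n. indicator (A n j \<inter> S) s *\<^sub>R R n j)" for s
      by (simp only: scaleR_sum_right)
  qed
  define X where "X n = simple_sum M (k n) (R n) (\<lambda>j. A n j \<inter> S)" for n
  have X[measurable]: "X n \<in> borel_measurable P" for n
    using repS[of n] unfolding X_def simple_sum_def[abs_def] simple_representation_def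
    by (auto intro!: borel_measurable_sum measurable_matrix_vector_mult M_measurable)
  have Gm: "G n \<in> borel_measurable lborel" for n
  proof -
    have "A n j \<in> sets borel" if "j < k n" for j
      using rep[of n] that by (auto simp: simple_representation_def dest: finite_borel_setsD)
    then have "(\<lambda>s. \<Sum>j<k n. indicator (A n j) s *\<^sub>R R n j) \<in> borel_measurable lborel"
      by (intro borel_measurable_sum borel_measurable_scaleR borel_measurable_indicator borel_measurable_const) simp
    moreover have "G n = (\<lambda>s. \<Sum>j<k n. indicator (A n j) s *\<^sub>R R n j)"
      using rep[of n] by (simp only: simple_representation_def)
    ultimately show ?thesis by (simp only:)
  qed
  have "\<exists>Y. converges_in_probability P X Y"
  proof (rule Cauchy_in_probability_converges[OF X], rule ccontr)
    fix \<epsilon> \<eta> :: real assume \<epsilon>: "\<epsilon> > 0" and \<eta>: "\<eta> > 0"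
    assume "\<not> (\<exists>N. \<forall>m\<ge>N. \<forall>n\<ge>N. prob {\<omega> \<in> space P. norm (X m \<omega> - X n \<omega>) > \<epsilon>} < \<eta>)"
    \<comment> \<open>The failing pairs are packed into one sequence p, so that a limit over a
      single index suffices.\<close>
    then have "\<forall>N. \<exists>p. fst p \<ge> N \<and> snd p \<ge> N \<and> prob {\<omega> \<in> space P. norm (X (fst p) \<omega> - X (snd p) \<omega>) > \<epsilon>} \<ge> \<eta>"
      by (simp add: not_less)
    from choice[OF this] obtain p where p: "\<And>N. fst (p N) \<ge> N" "\<And>N. snd (p N) \<ge> N"
      "\<And>N. prob {\<omega> \<in> space P. norm (X (fst (p N)) \<omega> - X (snd (p N)) \<omega>) > \<epsilon>} \<ge> \<eta>" by blast
    have fl: "filterlim (\<lambda>N. fst (p N)) at_top sequentially" "filterlim (\<lambda>N. snd (p N)) at_top sequentially"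
      using p(1,2) by (auto intro: filterlim_at_top_mono[OF filterlim_ident])
    have "(\<lambda>N. prob {\<omega> \<in> space P. norm (X (fst (p N)) \<omega> - X (snd (p N)) \<omega>) > \<epsilon>}) \<longlonglongrightarrow> 0"
    proof (rule char_tendsto_1_imp_prob_tendsto_0[OF _ _ \<epsilon>])
      fix u
      define H where "H N s = \<psi> (transpose (indicator S s *\<^sub>R G (fst (p N)) s - indicator S s *\<^sub>R G (snd (p N)) s) *v u)" for N s
      have "(\<lambda>N. CLINT s|lborel. H N s) \<longlonglongrightarrow> (CLINT s|(lborel :: (real^'d) measure). 0)"
      proof (rule integral_dominated_convergence[OF _ _ F[of u]])
        show "H N \<in> borel_measurable lborel" for N
        proof -
          have [measurable]: "(\<lambda>X. \<psi> (transpose X *v u)) \<in> borel_measurable borel"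
          proof (rule borel_measurable_continuous_onI)
            show "continuous_on UNIV (\<lambda>X. \<psi> (transpose X *v u))"
              by (intro continuous_on_compose2[OF \<psi>_continuous] linear_continuous_on bounded_linear_transpose_mult) auto
          qed
          note [measurable] = Gm S
          show ?thesis unfolding H_def by measurable
        qed
        show "AE s in lborel. (\<lambda>N. H N s) \<longlonglongrightarrow> 0"
          using lim
        proof eventually_elim
          fix s assume l: "(\<lambda>n. G n s) \<longlonglongrightarrow> g s"
          have "(\<lambda>N. indicator S s *\<^sub>R G (fst (p N)) s - indicator S s *\<^sub>R G (snd (p N)) s)
            \<longlonglongrightarrow> indicator S s *\<^sub>R g s - indicator S s *\<^sub>R g s"
            by (intro tendsto_intros filterlim_compose[OF l] fl)
          from bounded_linear.tendsto[OF bounded_linear_transpose_mult this, of u]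
          have "(\<lambda>N. transpose (indicator S s *\<^sub>R G (fst (p N)) s - indicator S s *\<^sub>R G (snd (p N)) s) *v u)
            \<longlonglongrightarrow> transpose 0 *v u" by (simp only: diff_self)
          moreover have "transpose (0 :: real^'k^'k) *v u = 0"
            by (simp add: matrix_vector_mult_def transpose_def vec_eq_iff)
          ultimately have "(\<lambda>N. transpose (indicator S s *\<^sub>R G (fst (p N)) s - indicator S s *\<^sub>R G (snd (p N)) s) *v u)
            \<longlonglongrightarrow> 0" by (simp only:)
          moreover have "isCont \<psi> 0" using \<psi>_continuous by (simp add: continuous_on_eq_continuous_at)
          ultimately have "(\<lambda>N. H N s) \<longlonglongrightarrow> \<psi> 0"
            unfolding H_def by (intro isCont_tendsto_compose[of 0 \<psi>])
          then show "(\<lambda>N. H N s) \<longlonglongrightarrow> 0" by (simp only: \<psi>_0)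
        qed
        \<comment> \<open>Restriction to S either leaves the value unchanged or replaces it by
          \<psi> 0 = 0, so the majorant for the whole space serves every S.\<close>
        have "H N s = (if s \<in> S then \<psi> (transpose (G (fst (p N)) s - G (snd (p N)) s) *v u) else 0)" for N s
        proof -
          have "transpose (0 :: real^'k^'k) *v u = 0"
            by (simp add: matrix_vector_mult_def transpose_def vec_eq_iff)
          then show ?thesis by (simp only: H_def indicator_def \<psi>_0 split: if_splits) (simp add: \<psi>_0)
        qed
        then have *: "norm (H N s) \<le> norm (\<psi> (transpose (G (fst (p N)) s - G (snd (p N)) s) *v u))" for N s
          by auto
        show "AE s in lborel. norm (H N s) \<le> F u s" for N
          using dom[of "fst (p N)" "snd (p N)" u] by eventually_elim (rule order.trans[OF *])
      qed simp
      then have "(\<lambda>N. exp (CLINT s|lborel. H N s)) \<longlonglongrightarrow> exp 0"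
        by (intro tendsto_exp) simp
      then show "(\<lambda>N. CLINT \<omega>|P. iexp ((X (fst (p N)) \<omega> - X (snd (p N)) \<omega>) \<bullet> u)) \<longlonglongrightarrow> 1"
        unfolding X_def char_simple_sum_diff[OF repS repS] H_def by simp
    qed simp
    then have "\<eta> \<le> 0" using p(3) by (intro LIMSEQ_le_const) auto
    with \<eta> show False by simp
  qed
  then obtain Y where Y: "converges_in_probability P X Y" ..
  have "is_simple_integral M (\<lambda>s. indicator S s *\<^sub>R G n s) (X n)" for n
    unfolding is_simple_integral_def X_def simple_sum_def[abs_def] using repS by blast
  with Y show "\<exists>X Y. (\<forall>n. is_simple_integral M (\<lambda>s. indicator S s *\<^sub>R G n s) (X n)) \<and>
      converges_in_probability P X Y" by blast
qed

end

section \<open>Homogeneous functions\<close>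

lemma norm_matrix_power2: "(norm (A :: real^'n^'m))\<^sup>2 = (\<Sum>i\<in>UNIV. \<Sum>j\<in>UNIV. (A $ i $ j)\<^sup>2)"
  by (simp add: norm_vec_def L2_set_def sum_nonneg)

lemma norm_transpose: "norm (transpose A) = norm (A :: real^'n^'m)"
proof -
  have "(norm (transpose A))\<^sup>2 = (norm A)\<^sup>2"
    unfolding norm_matrix_power2 transpose_def vec_lambda_beta by (rule sum.swap)
  then show ?thesis by (simp only: power2_eq_iff_nonneg norm_ge_zero)
qed

lemma norm_matrix_vector_mult_le: "norm (A *v x) \<le> norm A * norm (x :: real^'n)"
proof -
  have "norm (A *v x) \<le> L2_set (\<lambda>i. norm (A $ i) * norm x) UNIV"
    unfolding norm_vec_def[of "A *v x"]
    by (intro L2_set_mono) (auto simp: matrix_vector_mul_component Cauchy_Schwarz_ineq2)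
  also have "\<dots> = norm A * norm x" by (simp add: norm_vec_def[of A] L2_set_left_distrib)
  finally show ?thesis .
qed

lemma norm_matrix_matrix_mult_le: "norm (A ** B) \<le> norm A * norm (B :: real^'k^'n)"
proof -
  have "norm (A ** B) \<le> L2_set (\<lambda>i. norm (A $ i) * norm B) UNIV"
    unfolding norm_vec_def[of "A ** B"]
  proof (intro L2_set_mono)
    fix i
    have "(A ** B) $ i = transpose B *v (A $ i)"
      by (simp add: matrix_matrix_mult_def matrix_vector_mult_def transpose_def vec_eq_iff mult.commute)
    then show "norm ((A ** B) $ i) \<le> norm (A $ i) * norm B"
      using norm_matrix_vector_mult_le[of "transpose B" "A $ i"] by (simp only: norm_transpose mult.commute)
  qed simp
  also have "\<dots> = norm A * norm B" by (simp add: norm_vec_def[of A] L2_set_left_distrib)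
  finally show ?thesis .
qed

text \<open>For small v the stability relation trades the factor |v|^\<epsilon> for moving v to a
  point w of the unit ball, where \<psi> is bounded by compactness. For 1 < |v| <= R compactness
  alone is enough.\<close>

lemma stable_log_char_bound:
  fixes \<psi> :: "real^'k \<Rightarrow> complex"
  assumes cont: "continuous_on UNIV \<psi>"
    and stable: "\<And>L u. \<psi> (matrix_exp (L *\<^sub>R A) *v u) = of_real (exp L) * \<psi> u"
  obtains \<epsilon> where "\<epsilon> > 0" "\<And>R. \<exists>C\<ge>0. \<forall>v. norm v \<le> R \<longrightarrow> v \<noteq> 0 \<longrightarrow> norm (\<psi> v) \<le> C * norm v powr \<epsilon>"
proof -
  define a where "a = onorm ((*v) A)"
  have a: "a \<ge> 0" unfolding a_def by (rule onorm_pos_le[OF matrix_vector_mul_bounded_linear])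
  \<comment> \<open>Chosen so that \<epsilon> a <= 1: scaling by |v|^(-\<epsilon>) enlarges v at
    most by the factor |v|^(-\<epsilon> a), which keeps it in the unit ball. The 1 in the
    denominator covers a = 0.\<close>
  define \<epsilon> where "\<epsilon> = 1 / (1 + a)"
  have \<epsilon>: "\<epsilon> > 0" "\<epsilon> * a \<le> 1" using a by (auto simp: \<epsilon>_def field_simps)
  show thesis
  proof (rule that[OF \<epsilon>(1)])
    fix R :: real
    have "compact (\<psi> ` cball 0 (max 1 R))"
      by (intro compact_continuous_image continuous_on_subset[OF cont]) auto
    then obtain K where K: "\<And>v. norm v \<le> max 1 R \<Longrightarrow> norm (\<psi> v) \<le> K"
      using compact_imp_bounded bounded_iff by (metis image_eqI mem_cball_0)
    then have "K \<ge> 0" using order.trans[OF norm_ge_zero K[of 0]] by simp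
    moreover have "norm (\<psi> v) \<le> K * norm v powr \<epsilon>" if v: "norm v \<le> R" "v \<noteq> 0" for v
    proof (cases "norm v \<le> 1")
      case True
      define w where "w = matrix_exp ((- \<epsilon> * ln (norm v)) *\<^sub>R A) *v v"
      have "norm w \<le> exp (\<bar>- \<epsilon> * ln (norm v)\<bar> * a) * norm v"
        unfolding w_def a_def by (rule norm_matrix_exp_scaleR_mult_le)
      also have "\<bar>- \<epsilon> * ln (norm v)\<bar> * a = (\<epsilon> * a) * (- ln (norm v))"
        using True v \<epsilon> by (simp add: abs_mult)
      also have "exp \<dots> * norm v \<le> exp (- ln (norm v)) * norm v"
        using \<epsilon>(2) True v mult_right_mono[of "\<epsilon> * a" 1 "- ln (norm v)"] by (intro mult_right_mono) simp_all
      also have "exp (- ln (norm v)) * norm v = 1" using v by (simp add: exp_minus)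
      finally have "norm w \<le> 1" by simp
      then have "norm (\<psi> w) \<le> K" by (intro K) simp
      moreover have "norm (\<psi> w) = exp (- \<epsilon> * ln (norm v)) * norm (\<psi> v)"
        unfolding w_def stable by (simp add: norm_mult)
      ultimately show ?thesis using v by (simp add: powr_def exp_minus field_simps)
    next
      case False
      then have "1 \<le> norm v powr \<epsilon>" using \<epsilon> by (simp add: ge_one_powr_ge_zero)
      then have "K \<le> K * norm v powr \<epsilon>" using \<open>K \<ge> 0\<close> mult_left_mono[of 1 "norm v powr \<epsilon>" K] by simp
      moreover have "norm (\<psi> v) \<le> K" using v by (intro K) simp
      ultimately show ?thesis by (rule order.trans[rotated])
    qed
    ultimately show "\<exists>C\<ge>0. \<forall>v. norm v \<le> R \<longrightarrow> v \<noteq> 0 \<longrightarrow> norm (\<psi> v) \<le> C * norm v powr \<epsilon>" by blast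
  qed
qed

section \<open>Dilations contracting to the origin, and the size of x in terms of \<phi> x\<close>

locale homogeneous_function =
  fixes E :: "real^'d^'d" and \<phi> :: "real^'d \<Rightarrow> real"
  assumes E_Q: "E \<in> Q_matrices" and \<phi>_continuous: "continuous_on UNIV \<phi>"
    and \<phi>_homogeneous: "matrix_homogeneous (transpose E) \<phi>"
    and \<phi>_pos: "x \<noteq> 0 \<Longrightarrow> \<phi> x > 0"
begin

abbreviation E' where "E' \<equiv> transpose E"

lemma matrix_exp_E'_inverse: "matrix_exp (L *\<^sub>R E') *v (matrix_exp (- L *\<^sub>R E') *v x) = x"
  by (simp add: matrix_vector_mul_assoc)

lemma matrix_exp_E'_inverse': "matrix_exp (- L *\<^sub>R E') *v (matrix_exp (L *\<^sub>R E') *v x) = x"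
  by (simp add: matrix_vector_mul_assoc)

lemma matrix_exp_E'_nonzero: "x \<noteq> 0 \<Longrightarrow> matrix_exp (L *\<^sub>R E') *v x \<noteq> 0"
  by (metis matrix_exp_E'_inverse' matrix_vector_mult_0_right)

lemma \<phi>_exp: "x \<noteq> 0 \<Longrightarrow> \<phi> (matrix_exp (L *\<^sub>R E') *v x) = exp L * \<phi> x"
  using \<phi>_homogeneous[unfolded matrix_homogeneous_def, rule_format, of "exp L" x]
  by (simp add: matrix_powr_def)

text \<open>The growth bound applied to -E, whose eigenvalues have real part at most -\<lambda>_E.
  The norm is invariant under transposition, so the spectrum of the transpose is never
  examined.\<close>

lemma decay:
  assumes "\<kappa> < min_re_eigenvalue E"
  obtains C where "C > 0" "\<And>t. t \<ge> 0 \<Longrightarrow> norm (matrix_exp (- t *\<^sub>R E')) \<le> C * exp (- \<kappa> * t)"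
proof -
  have "Re c \<le> - min_re_eigenvalue E" if "complex_eigenvalue (- E) c" for c
    using min_re_eigenvalue_le[of E "- c"] that by (simp add: complex_eigenvalue_uminus)
  then show thesis
  proof (rule matrix_exp_growth[of "- E" "- min_re_eigenvalue E" "min_re_eigenvalue E - \<kappa>"])
    fix C assume C: "C > 0" "\<And>t. t \<ge> 0 \<Longrightarrow>
      norm (matrix_exp (t *\<^sub>R - E)) \<le> C * exp ((- min_re_eigenvalue E + (min_re_eigenvalue E - \<kappa>)) * t)"
    show thesis
    proof (rule that[OF C(1)])
      fix t :: real assume "t \<ge> 0"
      have "- t *\<^sub>R E' = transpose (t *\<^sub>R - E)" by (simp add: transpose_def vec_eq_iff)
      then have "matrix_exp (- t *\<^sub>R E') = transpose (matrix_exp (t *\<^sub>R - E))"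
        by (simp only: transpose_matrix_exp)
      then show "norm (matrix_exp (- t *\<^sub>R E')) \<le> C * exp (- \<kappa> * t)"
        using C(2)[OF \<open>t \<ge> 0\<close>] by (simp only: norm_transpose) simp
    qed
  next
    show "0 < min_re_eigenvalue E - \<kappa>" using assms by simp
  qed
qed

text \<open>A point outside the unit ball is carried inwards by the dilations and crosses the unit
  sphere at some time t, at a point z. On the sphere \<phi> has a positive minimum, so \<phi> x =
  e^t \<phi> z bounds t, and the norm of x grows at most exponentially in t.\<close>

lemma bounded_sublevel: "\<exists>K>0. \<forall>x. x \<noteq> 0 \<longrightarrow> \<phi> x \<le> R \<longrightarrow> norm x \<le> K"
proof -
  define \<kappa> where "\<kappa> = min_re_eigenvalue E / 2"
  have \<kappa>: "0 < \<kappa>" "\<kappa> < min_re_eigenvalue E" using E_Q by (auto simp: \<kappa>_def Q_matrices_def)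
  obtain C where C: "C > 0" "\<And>t. t \<ge> 0 \<Longrightarrow> norm (matrix_exp (- t *\<^sub>R E')) \<le> C * exp (- \<kappa> * t)"
    using decay[OF \<kappa>(2)] by blast
  have "compact (\<phi> ` sphere 0 1)" "\<phi> ` sphere (0 :: real^'d) 1 \<noteq> {}"
    using sphere_eq_empty[of "0::real^'d" 1]
    by (auto intro!: compact_continuous_image continuous_on_subset[OF \<phi>_continuous])
  then obtain y where y: "norm y = 1" "\<And>x. norm x = 1 \<Longrightarrow> \<phi> y \<le> \<phi> x"
    using compact_attains_inf[of "\<phi> ` sphere 0 1"] by auto
  have m: "\<phi> y > 0" using y(1) by (intro \<phi>_pos) auto
  \<comment> \<open>The bound on the crossing time. The outer maximum makes K at least 1, which
    handles points in the unit ball; the inner one keeps the argument of the logarithm positive for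
    every R.\<close>
  define T where "T = max 0 (ln (max R 1 / \<phi> y))"
  define K where "K = exp (T * onorm ((*v) E'))"
  have a: "onorm ((*v) E') \<ge> 0" by (rule onorm_pos_le[OF matrix_vector_mul_bounded_linear])
  have "norm x \<le> K" if x: "x \<noteq> 0" "\<phi> x \<le> R" for x
  proof (cases "norm x \<le> 1")
    case True
    then show ?thesis using a by (auto simp: K_def T_def intro!: order.trans[OF True])
  next
    case False
    define f where "f t = norm (matrix_exp (- t *\<^sub>R E') *v x)" for t
    have f0: "f 0 = norm x" by (simp add: f_def)
    have "((\<lambda>t. C * exp (- \<kappa> * t) * norm x) \<longlongrightarrow> C * 0 * norm x) at_top"
    proof (intro tendsto_intros filterlim_compose[OF exp_at_bot])
      show "filterlim (\<lambda>t. - \<kappa> * t) at_bot at_top"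
        using \<kappa>(1) by (simp add: filterlim_uminus_at_bot filterlim_tendsto_pos_mult_at_top[OF tendsto_const _ filterlim_ident])
    qed
    then have "eventually (\<lambda>t. C * exp (- \<kappa> * t) * norm x < 1) at_top"
      by (intro order_tendstoD(2)[where y="C * 0 * norm x"]) auto
    then obtain t0 where "\<And>t. t \<ge> t0 \<Longrightarrow> C * exp (- \<kappa> * t) * norm x < 1"
      unfolding eventually_at_top_linorder by blast
    then have "C * exp (- \<kappa> * max t0 0) * norm x < 1" by simp
    then obtain t1 where t1: "t1 \<ge> 0" "C * exp (- \<kappa> * t1) * norm x < 1"
      by (intro that[of "max t0 0"]) simp_all
    have "f t1 \<le> 1"
      unfolding f_def using norm_matrix_vector_mult_le[of "matrix_exp (- t1 *\<^sub>R E')" x] t1(2)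
        mult_right_mono[OF C(2)[OF t1(1)], of "norm x"] by simp
    moreover have "continuous_on {0..t1} f"
    proof -
      have "continuous_on {0..t1} (\<lambda>t. matrix_exp (t *\<^sub>R - E'))"
        by (rule continuous_on_vector_derivative[OF matrix_exp_has_vector_derivative])
      then have "continuous_on {0..t1} (\<lambda>t. matrix_exp (- t *\<^sub>R E'))" by simp
      then show ?thesis unfolding f_def
        by (intro continuous_on_norm bounded_linear.continuous_on[of "\<lambda>X. X *v x"])
          (auto intro!: linear_conv_bounded_linear[THEN iffD1] linearI simp: algebra_simps scaleR_matrix_vector_assoc)
    qed
    ultimately obtain t where t: "0 \<le> t" "t \<le> t1" "f t = 1"
      using IVT2'[of f t1 1 0] False f0 t1(1) by auto
    define z where "z = matrix_exp (- t *\<^sub>R E') *v x"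
    have "norm z = 1" using t(3) by (simp add: f_def z_def)
    then have "\<phi> y \<le> \<phi> z" by (rule y(2))
    also have "\<phi> z = exp (- t) * \<phi> x" unfolding z_def by (rule \<phi>_exp[OF x(1)])
    also have "\<dots> \<le> exp (- t) * max R 1" using x(2) by simp
    finally have "exp t \<le> max R 1 / \<phi> y" using m by (simp add: exp_minus field_simps)
    then have "t \<le> ln (max R 1 / \<phi> y)" using m by (subst ln_ge_iff) auto
    then have "t \<le> T" by (simp add: T_def)
    have "x = matrix_exp (t *\<^sub>R E') *v z" unfolding z_def by (simp add: matrix_exp_E'_inverse[simplified])
    then have "norm x \<le> exp (\<bar>t\<bar> * onorm ((*v) E')) * norm z"
      using norm_matrix_exp_scaleR_mult_le[of t E' z] by simp
    also have "\<dots> \<le> K" using \<open>norm z = 1\<close> \<open>t \<le> T\<close> t(1) a by (simp add: K_def mult_right_mono)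
    finally show ?thesis .
  qed
  then show ?thesis by (intro exI[of _ K]) (auto simp: K_def)
qed

text \<open>The point x is reached from the level set \<phi> = 1, which is bounded, by contracting
  for the time |ln (\<phi> x)|.\<close>

lemma norm_le_near_zero:
  assumes "\<kappa> < min_re_eigenvalue E"
  obtains C where "C > 0" "\<And>x. x \<noteq> 0 \<Longrightarrow> \<phi> x \<le> 1 \<Longrightarrow> norm x \<le> C * exp (- \<kappa> * \<bar>ln (\<phi> x)\<bar>)"
proof -
  obtain C where C: "C > 0" "\<And>t. t \<ge> 0 \<Longrightarrow> norm (matrix_exp (- t *\<^sub>R E')) \<le> C * exp (- \<kappa> * t)"
    using decay[OF assms] by blast
  obtain K where K: "K > 0" "\<And>x. x \<noteq> 0 \<Longrightarrow> \<phi> x \<le> 1 \<Longrightarrow> norm x \<le> K"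
    using bounded_sublevel[of 1] by blast
  show thesis
  proof (rule that[of "C * K"])
    fix x assume x: "x \<noteq> 0" "\<phi> x \<le> 1"
    define L where "L = ln (\<phi> x)"
    have L: "L \<le> 0" "exp L = \<phi> x" using x \<phi>_pos[OF x(1)] by (auto simp: L_def)
    define z where "z = matrix_exp (- L *\<^sub>R E') *v x"
    have z: "z \<noteq> 0" unfolding z_def by (rule matrix_exp_E'_nonzero[OF x(1)])
    have "\<phi> z = 1" unfolding z_def using L \<phi>_exp[OF x(1), of "-L"] \<phi>_pos[OF x(1)]
      by (simp add: exp_minus field_simps)
    then have "norm z \<le> K" using z by (intro K) auto
    have "x = matrix_exp (- \<bar>L\<bar> *\<^sub>R E') *v z" unfolding z_def using L(1) matrix_exp_E'_inverse[of L x] by simp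
    then have "norm x \<le> norm (matrix_exp (- \<bar>L\<bar> *\<^sub>R E')) * norm z"
      using norm_matrix_vector_mult_le by metis
    also have "\<dots> \<le> (C * exp (- \<kappa> * \<bar>L\<bar>)) * K"
      using \<open>norm z \<le> K\<close> C by (intro mult_mono C(2)) auto
    finally show "norm x \<le> C * K * exp (- \<kappa> * \<bar>ln (\<phi> x)\<bar>)" by (simp add: L_def mult_ac)
  qed (use C K in simp)
qed

end

section \<open>The image of Lebesgue measure under a matrix exponential\<close>

text \<open>The library has \<open>measure_linear_image\<close> only for vectors indexed by a well-ordered type; a finite
  type is replaced by a copy ordered through an injection into the natural numbers.\<close>

typedef ('n::finite) wo_copy = "UNIV :: 'n set"
  morphisms of_wo_copy to_wo_copy ..

setup_lifting type_definition_wo_copy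

instantiation wo_copy :: (finite) "{finite, wellorder}"
begin

lift_definition less_eq_wo_copy :: "'a wo_copy \<Rightarrow> 'a wo_copy \<Rightarrow> bool" is "\<lambda>x y. to_nat x \<le> to_nat y" .
lift_definition less_wo_copy :: "'a wo_copy \<Rightarrow> 'a wo_copy \<Rightarrow> bool" is "\<lambda>x y. to_nat x < to_nat y" .

instance
proof
  fix x y z :: "'a wo_copy" and P :: "'a wo_copy \<Rightarrow> bool"
  show "x < y \<longleftrightarrow> x \<le> y \<and> \<not> y \<le> x" "x \<le> x" "x \<le> y \<Longrightarrow> y \<le> z \<Longrightarrow> x \<le> z"
    "x \<le> y \<Longrightarrow> y \<le> x \<Longrightarrow> x = y" "x \<le> y \<or> y \<le> x"
    by (transfer; auto)+
  show "finite (UNIV :: 'a wo_copy set)"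
    unfolding type_definition.Abs_image[OF type_definition_wo_copy, symmetric]
    by (rule finite_imageI) simp
  assume step: "\<And>x. (\<And>y. y < x \<Longrightarrow> P y) \<Longrightarrow> P x"
  show "P x"
  proof (induction "to_nat (of_wo_copy x)" arbitrary: x rule: less_induct)
    case less
    show ?case by (rule step, rule less) (simp add: less_wo_copy.rep_eq)
  qed
qed

end

section \<open>Relabelling coordinates, and the Jacobian\<close>

lemma bij_of_wo_copy: "bij of_wo_copy"
  by (metis bijI' of_wo_copy_inject to_wo_copy_inverse UNIV_I)

definition reindex_vec :: "'a^'n \<Rightarrow> 'a^('n::finite wo_copy)" where
  "reindex_vec x = (\<chi> i. x $ of_wo_copy i)"

definition unreindex_vec :: "'a^('n::finite wo_copy) \<Rightarrow> 'a^'n" where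
  "unreindex_vec x = (\<chi> i. x $ to_wo_copy i)"

definition reindex_matrix :: "real^'n^'n \<Rightarrow> real^('n::finite wo_copy)^('n wo_copy)" where
  "reindex_matrix A = (\<chi> i j. A $ of_wo_copy i $ of_wo_copy j)"

lemma unreindex_reindex [simp]: "unreindex_vec (reindex_vec x) = x" "reindex_vec (unreindex_vec y) = y"
  by (simp_all add: reindex_vec_def unreindex_vec_def vec_eq_iff to_wo_copy_inverse of_wo_copy_inverse)

lemma sum_of_wo_copy: "(\<Sum>i\<in>UNIV. f (of_wo_copy i)) = (\<Sum>i\<in>UNIV. f i)"
  by (rule sum.reindex_bij_betw[OF bij_of_wo_copy])

lemma reindex_matrix_mult: "reindex_matrix (A ** B) = reindex_matrix A ** reindex_matrix B"
  by (simp add: reindex_matrix_def matrix_matrix_mult_def vec_eq_iff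
      sum_of_wo_copy[of "\<lambda>k. A $ _ $ k * B $ k $ _"])

lemma reindex_matrix_vector_mult: "reindex_vec (A *v x) = reindex_matrix A *v reindex_vec x"
  by (simp add: reindex_matrix_def reindex_vec_def matrix_vector_mult_def vec_eq_iff
      sum_of_wo_copy[of "\<lambda>k. A $ _ $ k * x $ k"])

lemma bounded_linear_reindex_matrix: "bounded_linear reindex_matrix"
  by (rule linear_conv_bounded_linear[THEN iffD1], rule linearI)
    (simp_all add: reindex_matrix_def vec_eq_iff)

lemma reindex_matrix_exp: "reindex_matrix (matrix_exp A) = matrix_exp (reindex_matrix A)"
proof -
  have 1: "reindex_matrix (mat 1) = mat 1"
    by (simp add: reindex_matrix_def mat_def vec_eq_iff of_wo_copy_inject)
  have pow: "reindex_matrix (matrix_pow A k) = matrix_pow (reindex_matrix A) k" for k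
    by (induct k) (simp_all add: reindex_matrix_mult 1)
  have "(\<lambda>k. reindex_matrix ((1 / fact k) *\<^sub>R matrix_pow A k)) sums reindex_matrix (matrix_exp A)"
    by (rule bounded_linear.sums[OF bounded_linear_reindex_matrix matrix_exp_sums])
  then show ?thesis
    by (simp add: linear_simps[OF bounded_linear_reindex_matrix] pow matrix_exp_def sums_iff)
qed

lemma trace_reindex_matrix: "trace (reindex_matrix A) = trace A"
  by (simp add: trace_def reindex_matrix_def sum_of_wo_copy[of "\<lambda>i. A $ i $ i"])

lemma bounded_linear_reindex_vec:
  "bounded_linear (reindex_vec :: real^'n \<Rightarrow> _)" "bounded_linear (unreindex_vec :: _ \<Rightarrow> real^'n)"
  by (rule linear_conv_bounded_linear[THEN iffD1], rule linearI,
      simp_all add: reindex_vec_def unreindex_vec_def vec_eq_iff)+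

lemma borel_measurable_reindex_vec:
  "(reindex_vec :: real^'n \<Rightarrow> _) \<in> borel_measurable borel"
  "(unreindex_vec :: _ \<Rightarrow> real^'n) \<in> borel_measurable borel"
  by (intro borel_measurable_continuous_onI linear_continuous_on bounded_linear_reindex_vec)+

lemma prod_Basis_vec: "(\<Prod>b\<in>Basis. f (x \<bullet> b)) = (\<Prod>i\<in>UNIV. f ((x :: real^'n) $ i))"
proof -
  have B: "(Basis :: (real^'n) set) = range (\<lambda>i. axis i 1)" by (auto simp: Basis_vec_def)
  have "inj (\<lambda>i::'n. axis i (1::real))" by (auto simp: inj_on_def axis_eq_axis)
  then show ?thesis unfolding B by (subst prod.reindex) (simp_all add: inner_axis)
qed

text \<open>Relabelling permutes the side lengths of a box, and the volumes of boxes determine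
  Lebesgue measure.\<close>

lemma distr_lborel_reindex_vec: "distr lborel borel (reindex_vec :: real^'n \<Rightarrow> _) = lborel"
proof (rule lborel_eqI[symmetric])
  fix l u :: "real^('n wo_copy)"
  assume lu: "\<And>b. b \<in> Basis \<Longrightarrow> l \<bullet> b \<le> u \<bullet> b"
  have nth: "l $ i \<le> u $ i" for i using lu[of "axis i 1"] by (auto simp: inner_axis Basis_vec_def)
  have "reindex_vec -` box l u = box (unreindex_vec l) (unreindex_vec u)"
  proof -
    have "reindex_vec x \<in> box l u \<longleftrightarrow> x \<in> box (unreindex_vec l) (unreindex_vec u)" for x
      unfolding mem_box_cart reindex_vec_def unreindex_vec_def vec_lambda_beta
      by (metis of_wo_copy_inverse to_wo_copy_inverse UNIV_I)
    then show ?thesis by auto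
  qed
  then have "emeasure (distr lborel borel reindex_vec) (box l u) = emeasure lborel (box (unreindex_vec l) (unreindex_vec u))"
    by (subst emeasure_distr) (simp_all add: borel_measurable_reindex_vec)
  also have "\<dots> = (\<Prod>b\<in>Basis. (unreindex_vec u - unreindex_vec l) \<bullet> b)"
  proof (rule emeasure_lborel_box)
    fix b :: "real^'n" assume "b \<in> Basis"
    then obtain i where "b = axis i 1" by (auto simp: Basis_vec_def)
    then show "unreindex_vec l \<bullet> b \<le> unreindex_vec u \<bullet> b"
      by (simp add: inner_axis unreindex_vec_def nth)
  qed
  also have "(\<Prod>b\<in>Basis. (unreindex_vec u - unreindex_vec l) \<bullet> b) = (\<Prod>b\<in>Basis. (u - l) \<bullet> b)"
    unfolding prod_Basis_vec[of "\<lambda>x. x"]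
    by (subst prod.reindex_bij_betw[OF bij_of_wo_copy, symmetric])
      (simp add: unreindex_vec_def of_wo_copy_inverse)
  finally show "emeasure (distr lborel borel (reindex_vec :: real^'n \<Rightarrow> _)) (box l u) = (\<Prod>b\<in>Basis. (u - l) \<bullet> b)" .
qed simp

lemma reindex_vec_image: "reindex_vec ` S = unreindex_vec -` S"
proof (intro equalityI subsetI)
  show "y \<in> reindex_vec ` S" if "y \<in> unreindex_vec -` S" for y
    using that image_eqI[of y reindex_vec "unreindex_vec y" S] by simp
qed auto

lemma measure_reindex_image:
  assumes "S \<in> sets borel"
  shows "reindex_vec ` S \<in> sets borel" "measure lborel (reindex_vec ` (S :: (real^'n) set)) = measure lborel S"
proof -
  show *: "reindex_vec ` S \<in> sets borel"
    unfolding reindex_vec_image using measurable_sets[OF borel_measurable_reindex_vec(2) assms] by simp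
  have "reindex_vec -` reindex_vec ` S = S" by (metis (mono_tags) inj_vimage_image_eq injI unreindex_reindex(1))
  then have "measure lborel S = measure (distr lborel borel reindex_vec) (reindex_vec ` S)"
    using * by (subst measure_distr) (simp_all add: borel_measurable_reindex_vec)
  then show "measure lborel (reindex_vec ` S) = measure lborel S"
    by (simp add: distr_lborel_reindex_vec)
qed

text \<open>The factor is the determinant of the exponential, which is positive. The image is
  computed on the relabelled coordinates; boundedness of S provides finite measure.\<close>

lemma measure_matrix_exp_image:
  fixes S :: "(real^'n) set"
  assumes S: "S \<in> sets borel" "bounded S" and T: "(*v) (matrix_exp (a *\<^sub>R A)) ` S \<in> sets borel"
  shows "measure lborel ((*v) (matrix_exp (a *\<^sub>R A)) ` S) = exp (a * trace A) * measure lborel S"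
proof -
  let ?X = "matrix_exp (a *\<^sub>R A)"
  have X: "reindex_matrix ?X = matrix_exp (a *\<^sub>R reindex_matrix A)"
    by (simp add: reindex_matrix_exp linear_simps[OF bounded_linear_reindex_matrix])
  have "bounded (reindex_vec ` S)"
    by (rule bounded_linear_image[OF S(2) bounded_linear_reindex_vec(1)])
  then have L: "reindex_vec ` S \<in> lmeasurable"
    using measure_reindex_image(1)[OF S(1)] by (intro bounded_set_imp_lmeasurable) simp_all
  have im: "reindex_vec ` (*v) ?X ` S = (*v) (reindex_matrix ?X) ` reindex_vec ` S"
    by (simp add: image_image reindex_matrix_vector_mult)
  have "measure lborel ((*v) ?X ` S) = measure lborel (reindex_vec ` (*v) ?X ` S)"
    by (rule measure_reindex_image(2)[OF T, symmetric])
  also have "\<dots> = measure lebesgue (reindex_vec ` (*v) ?X ` S)"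
    using measure_reindex_image(1)[OF T] by simp
  also have "\<dots> = \<bar>det (matrix ((*v) (reindex_matrix ?X)))\<bar> * measure lebesgue (reindex_vec ` S)"
    unfolding im by (rule measure_linear_image[OF matrix_vector_mul_linear L])
  also have "det (matrix ((*v) (reindex_matrix ?X))) = exp (a * trace A)"
    by (simp add: X det_matrix_exp trace_reindex_matrix)
  also have "measure lebesgue (reindex_vec ` S) = measure lborel S"
    using measure_reindex_image[OF S(1)] by simp
  finally show ?thesis by simp
qed

section \<open>Integrals of homogeneous functions\<close>

context homogeneous_function begin

text \<open>Half-open of width one in ln \<phi>, so that for integer a the shells partition the
  space without the origin.\<close>

definition shell :: "real \<Rightarrow> (real^'d) set" where
  "shell a = {x. x \<noteq> 0 \<and> a \<le> ln (\<phi> x) \<and> ln (\<phi> x) < a + 1}"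

lemma \<phi>_measurable [measurable]: "\<phi> \<in> borel_measurable borel"
  using \<phi>_continuous by (rule borel_measurable_continuous_onI)

lemma shell_borel [measurable]: "shell a \<in> sets borel"
proof -
  have "{x \<in> space borel. x \<noteq> 0 \<and> a \<le> ln (\<phi> x) \<and> ln (\<phi> x) < a + 1} \<in> sets borel" by measurable
  then show ?thesis by (simp add: shell_def)
qed

lemma bounded_log_sublevel: "bounded {x. x \<noteq> 0 \<and> ln (\<phi> x) \<le> a}"
proof -
  obtain K where K: "\<And>x. x \<noteq> 0 \<Longrightarrow> \<phi> x \<le> exp a \<Longrightarrow> norm x \<le> K"
    using bounded_sublevel[of "exp a"] by blast
  show ?thesis
    unfolding bounded_iff
  proof (intro exI ballI)
    fix x assume x: "x \<in> {x. x \<noteq> 0 \<and> ln (\<phi> x) \<le> a}"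
    then have "exp (ln (\<phi> x)) \<le> exp a" by simp
    with x \<phi>_pos[of x] have "\<phi> x \<le> exp a" by simp
    with x show "norm x \<le> K" by (intro K) auto
  qed
qed

lemma bounded_shell: "bounded (shell a)"
  by (rule bounded_subset[OF bounded_log_sublevel[of "a + 1"]]) (auto simp: shell_def)

lemma shell_eq_image: "shell a = (*v) (matrix_exp (a *\<^sub>R E')) ` shell 0"
proof (intro equalityI subsetI)
  fix x assume x: "x \<in> shell a"
  then have "x \<noteq> 0" by (simp add: shell_def)
  define z where "z = matrix_exp (- a *\<^sub>R E') *v x"
  have "\<phi> z = exp (- a) * \<phi> x" unfolding z_def by (rule \<phi>_exp[OF \<open>x \<noteq> 0\<close>])
  then have "ln (\<phi> z) = ln (\<phi> x) - a" using \<phi>_pos[OF \<open>x \<noteq> 0\<close>] by (simp add: ln_mult)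
  then have "z \<in> shell 0" using x matrix_exp_E'_nonzero[OF \<open>x \<noteq> 0\<close>, of "- a"] by (simp add: shell_def z_def)
  moreover have "x = matrix_exp (a *\<^sub>R E') *v z" unfolding z_def by (simp only: matrix_exp_E'_inverse)
  ultimately show "x \<in> (*v) (matrix_exp (a *\<^sub>R E')) ` shell 0" by blast
next
  fix x assume "x \<in> (*v) (matrix_exp (a *\<^sub>R E')) ` shell 0"
  then obtain z where z: "z \<in> shell 0" "x = matrix_exp (a *\<^sub>R E') *v z" by blast
  then have "z \<noteq> 0" by (simp add: shell_def)
  then have "ln (\<phi> x) = a + ln (\<phi> z)" unfolding z(2) \<phi>_exp[OF \<open>z \<noteq> 0\<close>]
    using \<phi>_pos[OF \<open>z \<noteq> 0\<close>] by (simp add: ln_mult)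
  then show "x \<in> shell a" using z matrix_exp_E'_nonzero[OF \<open>z \<noteq> 0\<close>, of a] by (simp add: shell_def)
qed

text \<open>Dilations translate ln \<phi>, so all shells are images of \<open>shell 0\<close>;
  boundedness of the shells makes their measures finite.\<close>

lemma emeasure_shell: "emeasure lborel (shell a) = ennreal (exp (a * trace E) * measure lborel (shell 0))"
proof -
  have fin: "emeasure lborel (shell b) \<noteq> top" for b
    using emeasure_bounded_finite[OF bounded_shell[of b]] by simp
  have "trace E' = trace E" by (simp add: trace_def transpose_def)
  have "measure lborel (shell a) = exp (a * trace E) * measure lborel (shell 0)"
    using measure_matrix_exp_image[OF shell_borel bounded_shell, of a E' 0]
    by (simp only: shell_eq_image[of a, symmetric] shell_borel \<open>trace E' = trace E\<close>)
  then show ?thesis using emeasure_eq_ennreal_measure[OF fin[of a]] by simp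
qed

lemma ennreal_le_suminf: "f i \<le> (\<Sum>i. f i)" for f :: "nat \<Rightarrow> ennreal"
  using sum_le_suminf[OF summableI, of "{i}" f] by simp

text \<open>The weight e^(-q c) cancels the volume e^(q c) of the shell at c, leaving a geometric
  series. The positions \<open>c i\<close> are arbitrary, so the same series serves the shells going
  outwards and those going inwards.\<close>

lemma nn_integral_shells_finite:
  assumes "\<eta> > 0"
  shows "(\<integral>\<^sup>+s. (\<Sum>i::nat. ennreal (K * exp (- trace E * c i) * exp (- \<eta> * real i)) * indicator (shell (c i)) s) \<partial>lborel) < \<infinity>"
proof -
  define V where "V = measure lborel (shell 0)"
  have "(\<integral>\<^sup>+s. (\<Sum>i::nat. ennreal (K * exp (- trace E * c i) * exp (- \<eta> * real i)) * indicator (shell (c i)) s) \<partial>lborel) =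
    (\<Sum>i::nat. \<integral>\<^sup>+s. ennreal (K * exp (- trace E * c i) * exp (- \<eta> * real i)) * indicator (shell (c i)) s \<partial>lborel)"
    by (rule nn_integral_suminf) measurable
  also have "\<dots> = (\<Sum>i::nat. ennreal (K * exp (- trace E * c i) * exp (- \<eta> * real i)) * ennreal (exp (c i * trace E) * V))"
    by (subst nn_integral_cmult_indicator) (simp_all add: emeasure_shell V_def)
  also have "\<dots> \<le> (\<Sum>i::nat. ennreal (\<bar>K\<bar> * V * exp (- \<eta>) ^ i))"
  proof (intro suminf_le summableI)
    fix i
    have "ennreal (K * exp (- trace E * c i) * exp (- \<eta> * real i)) * ennreal (exp (c i * trace E) * V)
      \<le> ennreal (\<bar>K\<bar> * exp (- trace E * c i) * exp (- \<eta> * real i)) * ennreal (exp (c i * trace E) * V)"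
      by (intro mult_right_mono ennreal_leI) simp_all
    also have "\<dots> = ennreal (\<bar>K\<bar> * V * exp (- \<eta>) ^ i)"
    proof (subst ennreal_mult[symmetric])
      have "exp (- trace E * c i) * exp (c i * trace E) = 1" by (simp add: exp_add[symmetric])
      moreover have "exp (- \<eta>) ^ i = exp (- \<eta> * real i)" by (simp add: exp_of_nat_mult[symmetric] mult.commute)
      ultimately show "ennreal (\<bar>K\<bar> * exp (- trace E * c i) * exp (- \<eta> * real i) * (exp (c i * trace E) * V)) =
          ennreal (\<bar>K\<bar> * V * exp (- \<eta>) ^ i)"
        by (intro arg_cong[where f=ennreal]) (metis (no_types, opaque_lifting) mult.commute mult.left_commute mult_1)
    qed (simp_all add: V_def)
    finally show "ennreal (K * exp (- trace E * c i) * exp (- \<eta> * real i)) * ennreal (exp (c i * trace E) * V)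
      \<le> ennreal (\<bar>K\<bar> * V * exp (- \<eta>) ^ i)" .
  qed
  also have "\<dots> < \<infinity>"
  proof -
    have "summable (\<lambda>i. \<bar>K\<bar> * V * exp (- \<eta>) ^ i)"
      using assms by (intro summable_mult summable_geometric) simp
    then have "(\<Sum>i. ennreal (\<bar>K\<bar> * V * exp (- \<eta>) ^ i)) \<noteq> top"
      by (rule ennreal_suminf_neq_top) (simp add: V_def)
    then show ?thesis by (simp add: less_top)
  qed
  finally show ?thesis .
qed

lemma integrable_homogeneous:
  assumes "\<eta> > 0"
  shows "integrable lborel (\<lambda>s. exp (- trace E * ln (\<phi> s)) * exp (- \<eta> * \<bar>ln (\<phi> s)\<bar>))"
proof (rule integrableI_bounded)
  show "(\<lambda>s. exp (- trace E * ln (\<phi> s)) * exp (- \<eta> * \<bar>ln (\<phi> s)\<bar>)) \<in> borel_measurable lborel" by simp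
  \<comment> \<open>Compensates for replacing ln \<phi> by the lower end \<open>c i\<close> of a
    shell of width one.\<close>
  define K where "K = exp \<bar>trace E\<bar>"
  define S where "S c s = (\<Sum>i::nat. ennreal (K * exp (- trace E * c i) * exp (- \<eta> * real i)) * indicator (shell (c i)) s)"
    for c :: "nat \<Rightarrow> real" and s
  have bound: "ennreal (exp (- trace E * ln (\<phi> s)) * exp (- \<eta> * \<bar>ln (\<phi> s)\<bar>)) \<le> S c s"
    if s: "s \<in> shell (c i)" "real i \<le> \<bar>ln (\<phi> s)\<bar>" for c s and i :: nat
  proof -
    have "- trace E * ln (\<phi> s) \<le> \<bar>trace E\<bar> + - trace E * c i"
    proof -
      have "\<bar>trace E * (c i - ln (\<phi> s))\<bar> \<le> \<bar>trace E\<bar> * 1"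
        unfolding abs_mult using s(1) by (intro mult_left_mono) (auto simp: shell_def)
      then show ?thesis by (simp add: algebra_simps)
    qed
    then have "exp (- trace E * ln (\<phi> s)) * exp (- \<eta> * \<bar>ln (\<phi> s)\<bar>) \<le> (K * exp (- trace E * c i)) * exp (- \<eta> * real i)"
    proof -
      have "\<eta> * real i \<le> \<eta> * \<bar>ln (\<phi> s)\<bar>" using s(2) assms by (intro mult_left_mono) auto
      with this \<open>- trace E * ln (\<phi> s) \<le> \<bar>trace E\<bar> + - trace E * c i\<close> show ?thesis
        unfolding K_def exp_add[symmetric] exp_le_cancel_iff by linarith
    qed
    then have "ennreal (exp (- trace E * ln (\<phi> s)) * exp (- \<eta> * \<bar>ln (\<phi> s)\<bar>)) \<le>
      ennreal (K * exp (- trace E * c i) * exp (- \<eta> * real i)) * indicator (shell (c i)) s"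
      using s(1) by (simp add: ennreal_leI)
    also have "\<dots> \<le> S c s"
      unfolding S_def by (rule ennreal_le_suminf)
    finally show ?thesis .
  qed
  have "(\<integral>\<^sup>+s. ennreal (norm (exp (- trace E * ln (\<phi> s)) * exp (- \<eta> * \<bar>ln (\<phi> s)\<bar>))) \<partial>lborel)
    \<le> (\<integral>\<^sup>+s. S (\<lambda>i. real i) s + S (\<lambda>i. - real i - 1) s \<partial>lborel)"
  proof (rule nn_integral_mono_AE)
    have "AE s in (lborel :: (real^'d) measure). s \<noteq> 0" by (rule AE_lborel_singleton)
    then show "AE s in lborel. ennreal (norm (exp (- trace E * ln (\<phi> s)) * exp (- \<eta> * \<bar>ln (\<phi> s)\<bar>)))
      \<le> S (\<lambda>i. real i) s + S (\<lambda>i. - real i - 1) s"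
    proof eventually_elim
      fix s :: "real^'d" assume "s \<noteq> 0"
      define L where "L = ln (\<phi> s)"
      have "ennreal (exp (- trace E * ln (\<phi> s)) * exp (- \<eta> * \<bar>ln (\<phi> s)\<bar>))
        \<le> S (\<lambda>i. real i) s + S (\<lambda>i. - real i - 1) s"
      proof (cases "L \<ge> 0")
        case True
        then have "real (nat \<lfloor>L\<rfloor>) \<le> L" "L < real (nat \<lfloor>L\<rfloor>) + 1" by linarith+
        then show ?thesis using \<open>s \<noteq> 0\<close>
          by (intro order.trans[OF bound[where c="\<lambda>i. real i" and i="nat \<lfloor>L\<rfloor>"]])
            (auto simp: shell_def L_def)
      next
        case False
        \<comment> \<open>The inward shells are [-i - 1, -i), so their index satisfies i < |L| and
          the decay in i is dominated correctly; this is why they start at -1 rather than at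
          0.\<close>
        then have "- real (nat (- \<lfloor>L\<rfloor> - 1)) - 1 \<le> L" "L < - real (nat (- \<lfloor>L\<rfloor> - 1))" by linarith+
        then show ?thesis using \<open>s \<noteq> 0\<close> False
          by (intro order.trans[OF bound[where c="\<lambda>i. - real i - 1" and i="nat (- \<lfloor>L\<rfloor> - 1)"]])
            (auto simp: shell_def L_def)
      qed
      then show "ennreal (norm (exp (- trace E * ln (\<phi> s)) * exp (- \<eta> * \<bar>ln (\<phi> s)\<bar>)))
        \<le> S (\<lambda>i. real i) s + S (\<lambda>i. - real i - 1) s" by simp
    qed
  qed
  also have "\<dots> = (\<integral>\<^sup>+s. S (\<lambda>i. real i) s \<partial>lborel) + (\<integral>\<^sup>+s. S (\<lambda>i. - real i - 1) s \<partial>lborel)"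
    unfolding S_def by (rule nn_integral_add) measurable
  also have "\<dots> < \<infinity>"
    unfolding S_def using nn_integral_shells_finite[OF assms, of K] by simp
  finally show "(\<integral>\<^sup>+s. ennreal (norm (exp (- trace E * ln (\<phi> s)) * exp (- \<eta> * \<bar>ln (\<phi> s)\<bar>))) \<partial>lborel) < \<infinity>" .
qed

end

text \<open>The image of S is totally bounded, so finitely many \<delta>-balls cover it; each s in S
  receives the centre of the first ball containing g s.\<close>

lemma simple_approximation:
  fixes g :: "real^'d \<Rightarrow> real^'k^'k"
  assumes [measurable]: "g \<in> borel_measurable borel" and S: "S \<in> finite_borel_sets"
    and bdd: "bounded (g ` S)" and "\<delta> > 0"
  shows "\<exists>G. simple_integrand G \<and> (\<forall>s\<in>S. norm (G s - g s) \<le> \<delta>) \<and> (\<forall>s. s \<notin> S \<longrightarrow> G s = 0)"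
proof -
  have "compact (closure (g ` S))" using bdd by simp
  then obtain X where X: "finite X" "closure (g ` S) \<subseteq> (\<Union>x\<in>X. ball x \<delta>)"
    using \<open>\<delta> > 0\<close> unfolding compact_eq_totally_bounded by meson
  then obtain h where h: "bij_betw h {..<card X} X"
    using ex_bij_betw_nat_finite by (auto simp: atLeast0LessThan)
  define A where "A j = S \<inter> (g -` ball (h j) \<delta> - (\<Union>i<j. g -` ball (h i) \<delta>))" for j
  have vim: "g -` ball x \<delta> \<in> sets borel" for x
    using measurable_sets[OF assms(1), of "ball x \<delta>"] by simp
  have A: "A j \<in> finite_borel_sets" for j
    unfolding A_def using vim by (intro finite_borel_sets_Int[OF S] sets.Diff sets.finite_UN) auto
  have disj: "disjoint_family_on A {..<card X}"
    unfolding disjoint_family_on_def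
  proof (intro ballI impI)
    fix m n :: nat assume "m \<noteq> n"
    then consider "m < n" | "n < m" by linarith
    then show "A m \<inter> A n = {}" by cases (auto simp: A_def)
  qed
  define G where "G = (\<lambda>s. \<Sum>j<card X. indicator (A j) s *\<^sub>R h j)"
  have "simple_integrand G"
    unfolding simple_integrand_def simple_representation_def G_def using A disj by blast
  moreover have "norm (G s - g s) \<le> \<delta>" if s: "s \<in> S" for s
  proof -
    have "g s \<in> closure (g ` S)" using s by (intro subsetD[OF closure_subset] imageI)
    then obtain x where x: "x \<in> X" "g s \<in> ball x \<delta>" using X(2) by blast
    from x(1) have "x \<in> h ` {..<card X}" using h by (simp add: bij_betw_def)
    then obtain j where "j < card X" "x = h j" by auto
    with x(2) have j: "j < card X" "g s \<in> ball (h j) \<delta>" by simp_all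
    define i where "i = (LEAST j. g s \<in> ball (h j) \<delta>)"
    have i: "g s \<in> ball (h i) \<delta>" "i \<le> j" "\<And>l. l < i \<Longrightarrow> g s \<notin> ball (h l) \<delta>"
      unfolding i_def by (rule LeastI, rule j(2), rule Least_le, rule j(2), rule not_less_Least)
    then have "s \<in> A i" using s by (auto simp: A_def)
    then have "G s = h i"
      unfolding G_def using i(2) j(1) by (intro sum_indicator_disjoint_family disj) auto
    then show ?thesis using i(1) by (simp add: dist_norm)
  qed
  moreover have "G s = 0" if "s \<notin> S" for s
    unfolding G_def using that by (intro sum.neutral) (auto simp: A_def)
  ultimately show ?thesis by blast
qed

section \<open>Integrability with respect to a strictly stable random measure\<close>

lemma norm_matrix_exp_scaleR_le:
  "norm (matrix_exp (t *\<^sub>R (A :: real^'n^'n))) \<le> real (CARD('n) * CARD('n)) * exp (\<bar>t\<bar> * onorm ((*v) A))"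
proof -
  have "norm (matrix_exp (t *\<^sub>R A)) \<le> (\<Sum>i::'n\<in>UNIV. \<Sum>j::'n\<in>UNIV. exp (\<bar>t\<bar> * onorm ((*v) A)))"
    by (rule order.trans[OF norm_matrix_le_sum_abs])
      (intro sum_mono order.trans[OF matrix_component_le_onorm onorm_matrix_exp_scaleR_le])
  then show ?thesis by (simp add: mult_ac)
qed

lemma matrix_mult_0_left [simp]: "(0 :: real^'m^'n) ** X = 0"
  by (simp add: matrix_matrix_mult_def vec_eq_iff)

lemma norm_block_matrix_le: "norm (block_matrix P Q R S) \<le> norm P + norm Q + norm R + norm (S :: real^'n^'n)"
proof (rule power2_le_imp_le)
  have "(norm (block_matrix P Q R S))\<^sup>2 = (norm P)\<^sup>2 + (norm Q)\<^sup>2 + (norm R)\<^sup>2 + (norm S)\<^sup>2"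
    unfolding norm_matrix_power2 by (simp add: sum_UNIV_sum block_matrix_def sum.distrib)
  also have "\<dots> \<le> (norm P + norm Q + norm R + norm S)\<^sup>2"
    by (simp add: power2_eq_square algebra_simps add_increasing)
  finally show "(norm (block_matrix P Q R S))\<^sup>2 \<le> (norm P + norm Q + norm R + norm S)\<^sup>2" .
qed simp

lemma continuous_on_matrix_exp: "continuous_on S (\<lambda>t. matrix_exp (t *\<^sub>R A))"
  by (rule continuous_on_vector_derivative[OF matrix_exp_has_vector_derivative])

lemma cmod_iexp_minus_1_le: "cmod (iexp x - 1) \<le> \<bar>x\<bar>" "cmod (iexp x - 1) \<le> 2"
proof -
  show "cmod (iexp x - 1) \<le> \<bar>x\<bar>" using iexp_approx1[of x 0] by simp
  show "cmod (iexp x - 1) \<le> 2" using norm_triangle_ineq4[of "iexp x" 1] by simp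
qed

locale stable_random_measure = generated_random_measure P M \<psi> + homogeneous_function E \<phi>
  for P :: "'w measure" and M :: "(real^'d) set \<Rightarrow> 'w \<Rightarrow> real^'k" and \<psi> and E :: "real^'d^'d" and \<phi> +
  fixes A :: "real^'k^'k"
  assumes \<psi>_stable: "\<psi> (matrix_exp (L *\<^sub>R transpose A) *v u) = of_real (exp L) * \<psi> u"
begin

lemma integrableI_weighted_bound:
  fixes g :: "real^'d \<Rightarrow> real^'k^'k"
  assumes g: "g \<in> borel_measurable borel" and \<eta>: "\<eta> > 0" "\<eta> \<le> 1"
    and bound: "\<And>s. s \<noteq> 0 \<Longrightarrow>
      norm (g s ** matrix_exp ((trace E * ln (\<phi> s)) *\<^sub>R A)) \<le> C * exp (- \<eta> * \<bar>ln (\<phi> s)\<bar>)"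
  shows "integrable_wrt_random_measure P M g"
proof -
  define X where "X s = matrix_exp ((trace E * ln (\<phi> s)) *\<^sub>R A)" for s
  define a where "a = onorm ((*v) A)"
  have a: "a \<ge> 0" unfolding a_def by (rule onorm_pos_le[OF matrix_vector_mul_bounded_linear])
  define N where "N = real (CARD('k) * CARD('k))"
  have C: "C \<ge> 0"
  proof -
    \<comment> \<open>Any nonzero point will do, in order to evaluate the bound somewhere.\<close>
    have "(axis undefined 1 :: real^'d) \<noteq> 0" by simp
    from order.trans[OF norm_ge_zero bound[OF this]] show ?thesis
      by (simp add: zero_le_mult_iff)
  qed
  define S where "S n = {s. s \<noteq> 0 \<and> \<bar>ln (\<phi> s)\<bar> \<le> real n}" for n
  \<comment> \<open>On S n the weight X s has norm at most N e^(|q| a n). The error times the weight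
    is thus at most N e^(-n), and this is below N e^(-\<eta> |ln \<phi>|) because \<eta> <= 1 and
    |ln \<phi>| <= n.\<close>
  define \<delta> where "\<delta> n = exp (- (\<bar>trace E\<bar> * a + 1) * real n)" for n
  have S: "S n \<in> finite_borel_sets" for n
  proof -
    have "{s \<in> space borel. s \<noteq> 0 \<and> \<bar>ln (\<phi> s)\<bar> \<le> real n} \<in> sets borel" by measurable
    moreover have "bounded (S n)"
      by (rule bounded_subset[OF bounded_log_sublevel[of "real n"]]) (auto simp: S_def)
    ultimately show ?thesis
      using emeasure_bounded_finite[of "S n"] by (simp add: finite_borel_sets_def S_def)
  qed
  have normX: "norm (matrix_exp (x *\<^sub>R A)) \<le> N * exp (\<bar>x\<bar> * a)" for x
    unfolding N_def a_def by (rule norm_matrix_exp_scaleR_le)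
  have bdd: "bounded (g ` S n)" for n
    unfolding bounded_iff
  proof (intro exI ballI)
    fix y assume "y \<in> g ` S n"
    then obtain s where s: "s \<in> S n" "y = g s" by blast
    let ?x = "trace E * ln (\<phi> s)"
    \<comment> \<open>The assumption bounds only the weighted kernel; undoing the weight costs a
      factor depending on n, which is acceptable for boundedness on a single S n.\<close>
    have "g s = (g s ** X s) ** matrix_exp ((- ?x) *\<^sub>R A)"
      by (simp add: X_def matrix_mul_assoc[symmetric])
    then have "norm (g s) \<le> norm (g s ** X s) * norm (matrix_exp ((- ?x) *\<^sub>R A))"
      using norm_matrix_matrix_mult_le by metis
    also have "\<dots> \<le> C * (N * exp ((\<bar>trace E\<bar> * real n) * a))"
    proof (intro mult_mono)
      have "C * exp (- \<eta> * \<bar>ln (\<phi> s)\<bar>) \<le> C * 1"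
        using C \<eta> by (intro mult_left_mono) (auto simp: mult_nonneg_nonneg)
      then show "norm (g s ** X s) \<le> C" using bound[of s] s by (simp add: S_def X_def)
      have "\<bar>?x\<bar> * a \<le> (\<bar>trace E\<bar> * real n) * a"
        using s a by (intro mult_right_mono) (auto simp: S_def abs_mult intro!: mult_left_mono)
      then have "N * exp (\<bar>- ?x\<bar> * a) \<le> N * exp ((\<bar>trace E\<bar> * real n) * a)"
        by (intro mult_left_mono) (auto simp: N_def)
      then show "norm (matrix_exp ((- ?x) *\<^sub>R A)) \<le> N * exp ((\<bar>trace E\<bar> * real n) * a)"
        using normX[of "- ?x"] by linarith
    qed (use C in auto)
    finally show "norm y \<le> C * (N * exp ((\<bar>trace E\<bar> * real n) * a))" using s by simp
  qed
  have "\<exists>G. simple_integrand G \<and> (\<forall>s\<in>S n. norm (G s - g s) \<le> \<delta> n) \<and> (\<forall>s. s \<notin> S n \<longrightarrow> G s = 0)" for n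
    by (rule simple_approximation[OF g S bdd]) (simp add: \<delta>_def)
  then obtain G where G: "\<And>n. simple_integrand (G n)"
    "\<And>n s. s \<in> S n \<Longrightarrow> norm (G n s - g s) \<le> \<delta> n" "\<And>n s. s \<notin> S n \<Longrightarrow> G n s = 0"
    by metis
  define C' where "C' = C + N"
  have GX: "norm (G n s ** X s) \<le> C' * exp (- \<eta> * \<bar>ln (\<phi> s)\<bar>)" if "s \<noteq> 0" for n s
  proof (cases "s \<in> S n")
    case False
    then show ?thesis using G(3) C by (simp add: C'_def N_def)
  next
    case True
    let ?l = "\<bar>ln (\<phi> s)\<bar>"
    have l: "?l \<le> real n" using True by (simp add: S_def)
    have "G n s ** X s = g s ** X s + (G n s - g s) ** X s"
      by (simp add: matrix_matrix_mult_linear_simps)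
    then have "norm (G n s ** X s) \<le> norm (g s ** X s) + norm ((G n s - g s) ** X s)"
      using norm_triangle_ineq by metis
    also have "norm ((G n s - g s) ** X s) \<le> N * exp (- \<eta> * ?l)"
    proof -
      have "norm ((G n s - g s) ** X s) \<le> \<delta> n * (N * exp (\<bar>trace E * ln (\<phi> s)\<bar> * a))"
        by (rule order.trans[OF norm_matrix_matrix_mult_le])
          (use G(2)[OF True] normX in \<open>auto simp: X_def \<delta>_def intro!: mult_mono\<close>)
      also have "\<dots> = N * exp (- (\<bar>trace E\<bar> * a + 1) * real n + \<bar>trace E * ln (\<phi> s)\<bar> * a)"
        by (simp add: \<delta>_def exp_add)
      also have "\<dots> \<le> N * exp (- \<eta> * ?l)"
      proof -
        have "\<bar>trace E * ln (\<phi> s)\<bar> * a \<le> \<bar>trace E\<bar> * a * real n"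
          using mult_left_mono[OF l, of "\<bar>trace E\<bar> * a"] a by (simp add: abs_mult mult_ac)
        moreover have "\<eta> * ?l \<le> 1 * real n" using l \<eta> by (intro mult_mono) auto
        ultimately have "- (\<bar>trace E\<bar> * a + 1) * real n + \<bar>trace E * ln (\<phi> s)\<bar> * a \<le> - \<eta> * ?l"
          by (simp add: algebra_simps)
        then show ?thesis by (intro mult_left_mono) (auto simp: N_def)
      qed
      finally show ?thesis .
    qed
    finally show ?thesis using bound[OF that] by (simp add: X_def C'_def algebra_simps)
  qed
  obtain \<epsilon> where \<epsilon>: "\<epsilon> > 0" "\<And>R. \<exists>K\<ge>0. \<forall>v. norm v \<le> R \<longrightarrow> v \<noteq> 0 \<longrightarrow> norm (\<psi> v) \<le> K * norm v powr \<epsilon>"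
    using stable_log_char_bound[OF \<psi>_continuous \<psi>_stable] by blast
  \<comment> \<open>The radius that contains all weighted vectors w below; the 2 comes from the two
    approximations in a difference.\<close>
  define R where "R u = 2 * C' * norm u" for u :: "real^'k"
  have R0: "R u \<ge> 0" for u using C by (simp add: R_def C'_def N_def)
  obtain K where K: "\<And>u. K u \<ge> 0"
    "\<And>u v. norm v \<le> R u \<Longrightarrow> v \<noteq> 0 \<Longrightarrow> norm (\<psi> v) \<le> K u * norm v powr \<epsilon>"
    using \<epsilon>(2)[of "R _"] by metis
  \<comment> \<open>The decay \<eta> of the weighted kernel becomes \<eta> \<epsilon> through the
    Hoelder bound on \<psi>, and e^(-q ln \<phi>) is the scalar released by stability.\<close>
  define F where "F u s = (K u * R u powr \<epsilon>) * (exp (- trace E * ln (\<phi> s)) * exp (- (\<eta> * \<epsilon>) * \<bar>ln (\<phi> s)\<bar>))" for u s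
  have AE0: "AE s in (lborel :: (real^'d) measure). s \<noteq> 0" by (rule AE_lborel_singleton)
  show ?thesis
  proof (rule integrableI_dominated[of g G F])
    show "AE s in lborel. (\<lambda>n. G n s) \<longlonglongrightarrow> g s"
      using AE0
    proof eventually_elim
      fix s :: "real^'d" assume s: "s \<noteq> 0"
      obtain n0 where n0: "\<bar>ln (\<phi> s)\<bar> \<le> real n0" using real_arch_simple by blast
      have "\<delta> \<longlonglongrightarrow> 0"
      proof -
        have "(\<lambda>n. exp (- (\<bar>trace E\<bar> * a + 1)) ^ n) \<longlonglongrightarrow> 0"
          using mult_nonneg_nonneg[OF abs_ge_zero a, of "trace E"] by (intro LIMSEQ_power_zero) simp
        then show ?thesis by (simp add: \<delta>_def[abs_def] exp_of_nat_mult[symmetric] mult.commute)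
      qed
      moreover have "eventually (\<lambda>n. norm (G n s - g s) \<le> \<delta> n) sequentially"
        using eventually_ge_at_top[of n0]
        by eventually_elim (use n0 s in \<open>auto intro!: G(2) simp: S_def\<close>)
      ultimately have "(\<lambda>n. G n s - g s) \<longlonglongrightarrow> 0" by (rule Lim_null_comparison[rotated])
      then show "(\<lambda>n. G n s) \<longlonglongrightarrow> g s" by (rule LIM_zero_cancel)
    qed
    show "integrable lborel (F u)" for u
      unfolding F_def using \<eta> \<epsilon>(1) by (intro integrable_mult_right integrable_homogeneous) simp
    show "AE s in lborel. norm (\<psi> (transpose (G m s - G n s) *v u)) \<le> F u s" for u m n
      using AE0
    proof eventually_elim
      fix s :: "real^'d" assume s: "s \<noteq> 0"
      define L where "L = ln (\<phi> s)"
      define v where "v = transpose (G m s - G n s) *v u"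
      \<comment> \<open>The rescaled vector: stability gives \<psi> v = \<phi>^(-q) \<psi> w, and w
        sees the approximations only through the weighted matrices already estimated.\<close>
      define w where "w = matrix_exp ((trace E * L) *\<^sub>R transpose A) *v v"
      have "w = transpose ((G m s - G n s) ** X s) *v u"
      proof -
        have "transpose (X s) = matrix_exp ((trace E * L) *\<^sub>R transpose A)"
          by (simp only: X_def L_def transpose_matrix_exp linear_simps[OF bounded_linear_transpose])
        then show ?thesis
          by (simp only: w_def v_def matrix_transpose_mul matrix_vector_mul_assoc)
      qed
      then have "norm w \<le> norm ((G m s - G n s) ** X s) * norm u"
        using norm_matrix_vector_mult_le[of "transpose ((G m s - G n s) ** X s)" u]
        by (simp only: norm_transpose)
      also have "\<dots> \<le> (2 * C' * exp (- \<eta> * \<bar>L\<bar>)) * norm u"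
      proof (intro mult_right_mono)
        have "norm ((G m s - G n s) ** X s) \<le> norm (G m s ** X s) + norm (G n s ** X s)"
          by (simp add: matrix_matrix_mult_linear_simps norm_triangle_ineq4)
        then show "norm ((G m s - G n s) ** X s) \<le> 2 * C' * exp (- \<eta> * \<bar>L\<bar>)"
          using GX[OF s, of m] GX[OF s, of n] by (simp add: L_def)
      qed simp
      finally have w: "norm w \<le> R u * exp (- \<eta> * \<bar>L\<bar>)"
        by (simp add: R_def mult_ac)
      also have "\<dots> \<le> R u * 1" using \<eta> R0 by (intro mult_left_mono) auto
      finally have wR: "norm w \<le> R u" by simp
      have "norm (\<psi> w) \<le> K u * R u powr \<epsilon> * exp (- (\<eta> * \<epsilon>) * \<bar>L\<bar>)"
      proof (cases "w = 0")
        case True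
        then show ?thesis using K(1)[of u] by (simp add: \<psi>_0)
      next
        case False
        have "norm (\<psi> w) \<le> K u * norm w powr \<epsilon>" by (rule K(2)[OF wR False])
        also have "\<dots> \<le> K u * (R u * exp (- \<eta> * \<bar>L\<bar>)) powr \<epsilon>"
          using w \<epsilon>(1) K(1)[of u] by (intro mult_left_mono powr_mono2) auto
        also have "\<dots> = K u * R u powr \<epsilon> * exp (- (\<eta> * \<epsilon>) * \<bar>L\<bar>)"
          using R0[of u] by (simp add: powr_mult exp_powr_real mult_ac)
        finally show ?thesis .
      qed
      moreover have "norm (\<psi> v) = exp (- trace E * L) * norm (\<psi> w)"
        unfolding w_def \<psi>_stable by (simp add: norm_mult exp_minus)
      ultimately have "norm (\<psi> v) \<le> exp (- trace E * L) * (K u * R u powr \<epsilon> * exp (- (\<eta> * \<epsilon>) * \<bar>L\<bar>))"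
        by simp
      then show "norm (\<psi> (transpose (G m s - G n s) *v u)) \<le> F u s"
        by (simp only: v_def F_def L_def mult_ac)
    qed
  qed (fact g G(1))+
qed

end

section \<open>The harmonizable kernel\<close>

lemma matrix_powr_exp: "matrix_powr (exp L) A = matrix_exp (L *\<^sub>R A)"
  by (simp add: matrix_powr_def)

lemma continuous_on_matrix_mult:
  fixes f :: "'a::topological_space \<Rightarrow> real^'m^'n" and g :: "'a \<Rightarrow> real^'k^'m"
  assumes "continuous_on S f" "continuous_on S g"
  shows "continuous_on S (\<lambda>x. f x ** g x)"
  unfolding matrix_matrix_mult_def
  by (intro continuous_on_vec_lambda continuous_intros continuous_on_component assms)

text \<open>The real matrix function g_f of partial integrability, taken for the kernel f.\<close>

definition harmonizable_integrand ::
  "real^'m^'m \<Rightarrow> real^'m^'m \<Rightarrow> real^'d^'d \<Rightarrow> (real^'d \<Rightarrow> real) \<Rightarrow> real^'d \<Rightarrow> real^'d \<Rightarrow> real^('m + 'm)^('m + 'm)" where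
  "harmonizable_integrand B D E \<phi> t s = block_matrix (map_matrix Re (harmonizable_kernel B D E \<phi> t s))
     (- map_matrix Im (harmonizable_kernel B D E \<phi> t s)) 0 0"

context homogeneous_function begin

text \<open>The logarithm of \<phi> is continuous off the origin, and one exceptional point does not
  affect measurability.\<close>

lemma harmonizable_kernel_measurable: "harmonizable_kernel B D E \<phi> t \<in> borel_measurable borel"
proof (rule borel_measurable_continuous_countable_exceptions[of "{0}"])
  have ln: "continuous_on (- {0}) (\<lambda>s. ln (\<phi> s))"
    by (intro continuous_on_ln continuous_on_subset[OF \<phi>_continuous]) (auto dest: \<phi>_pos)
  have powr: "continuous_on (- {0}) (\<lambda>s. matrix_powr (\<phi> s) A)" for A :: "real^'m^'m"
  proof -
    have "continuous_on (- {0}) (\<lambda>s. matrix_exp (ln (\<phi> s) *\<^sub>R A))"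
      by (rule continuous_on_compose2[OF continuous_on_matrix_exp[of UNIV] ln]) simp
    then show ?thesis
      by (rule continuous_on_eq) (simp add: matrix_powr_def \<phi>_pos)
  qed
  have F: "continuous_on (- {0}) (\<lambda>s. matrix_powr (\<phi> s) (- D) ** matrix_powr (\<phi> s) (- (trace E *\<^sub>R B)))"
    by (intro continuous_on_matrix_mult powr)
  show "continuous_on (- {0}) (harmonizable_kernel B D E \<phi> t)"
    unfolding harmonizable_kernel_def[abs_def] map_matrix_def
    by (intro continuous_on_vec_lambda continuous_intros continuous_on_component F)
qed simp

lemma harmonizable_integrand_measurable: "harmonizable_integrand B D E \<phi> t \<in> borel_measurable borel"
proof -
  have "bounded_linear (\<lambda>z :: complex^'m^'m. block_matrix (map_matrix Re z) (- map_matrix Im z) 0 0)"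
    by (rule linear_conv_bounded_linear[THEN iffD1], rule linearI)
      (auto simp: block_matrix_def map_matrix_def vec_eq_iff split: sum.split)
  then have "(\<lambda>z :: complex^'m^'m. block_matrix (map_matrix Re z) (- map_matrix Im z) 0 0) \<in> borel_measurable borel"
    by (intro borel_measurable_continuous_onI linear_continuous_on)
  from measurable_compose[OF harmonizable_kernel_measurable this]
  show ?thesis unfolding harmonizable_integrand_def[abs_def] .
qed

text \<open>The power with exponent -q B stands rightmost in the kernel and meets its inverse; the
  block-diagonal weight does this in the real and the imaginary block alike.\<close>

lemma harmonizable_integrand_mult:
  fixes B D :: "real^'m^'m" and s t :: "real^'d"
  assumes "s \<noteq> 0"
  defines "z \<equiv> iexp (t \<bullet> s) - 1" and "L \<equiv> ln (\<phi> s)"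
  shows "harmonizable_integrand B D E \<phi> t s ** matrix_exp ((trace E * L) *\<^sub>R matrix_double B) =
    block_matrix (Re z *\<^sub>R matrix_exp (L *\<^sub>R - D)) (- (Im z *\<^sub>R matrix_exp (L *\<^sub>R - D))) 0 0"
proof -
  define X where "X = matrix_exp ((trace E * L) *\<^sub>R B)"
  define F where "F = matrix_exp (L *\<^sub>R - D) ** matrix_exp (L *\<^sub>R - (trace E *\<^sub>R B))"
  have "L *\<^sub>R - (trace E *\<^sub>R B) = - ((trace E * L) *\<^sub>R B)" by (simp add: mult.commute)
  then have "matrix_exp (L *\<^sub>R - (trace E *\<^sub>R B)) ** X = mat 1"
    by (simp only: X_def matrix_exp_minus_cancel)
  then have FX: "F ** X = matrix_exp (L *\<^sub>R - D)"
    by (simp add: F_def matrix_mul_assoc[symmetric])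
  have k: "harmonizable_kernel B D E \<phi> t s = map_matrix (\<lambda>a. z * complex_of_real a) F"
    using \<phi>_pos[OF assms(1)]
    by (simp only: harmonizable_kernel_def matrix_powr_def F_def L_def z_def if_True)
  have Re: "map_matrix Re (harmonizable_kernel B D E \<phi> t s) = Re z *\<^sub>R F"
    and Im: "map_matrix Im (harmonizable_kernel B D E \<phi> t s) = Im z *\<^sub>R F"
    unfolding k by (simp_all add: map_matrix_def vec_eq_iff)
  have "matrix_exp ((trace E * L) *\<^sub>R matrix_double B) = block_matrix X 0 0 X"
    unfolding linear_simps(5)[OF bounded_linear_matrix_double, symmetric] matrix_exp_double
    by (simp add: matrix_double_def X_def)
  moreover have "(- (c *\<^sub>R F)) ** X = - (c *\<^sub>R (F ** X))" for c
    using matrix_matrix_mult_linear_simps(2)[of "- c" F X] by (simp add: scaleR_minus_left)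
  moreover have "P ** (0 :: real^'m^'m) = 0" for P :: "real^'m^'m"
    by (simp add: matrix_matrix_mult_def vec_eq_iff)
  ultimately show ?thesis
    unfolding harmonizable_integrand_def Re Im
    by (simp add: block_matrix_mult matrix_matrix_mult_linear_simps FX)
qed

lemma harmonizable_integrand_bound:
  fixes B D :: "real^'m^'m"
  assumes D: "D \<in> Q_matrices" and DE: "max_re_eigenvalue D < min_re_eigenvalue E"
  shows "\<exists>C \<eta>. 0 < \<eta> \<and> \<eta> \<le> 1 \<and> (\<forall>s. s \<noteq> 0 \<longrightarrow>
    norm (harmonizable_integrand B D E \<phi> t s ** matrix_exp ((trace E * ln (\<phi> s)) *\<^sub>R matrix_double B))
      \<le> C * exp (- \<eta> * \<bar>ln (\<phi> s)\<bar>))"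
proof -
  define d where "d = min_re_eigenvalue D / 2"
  have d: "d > 0" using D by (simp add: d_def Q_matrices_def)
  \<comment> \<open>A third of the gap: one share is lost in the decay of |s|, one in the growth of
    \<phi>^(-D), and one remains as the net rate.\<close>
  define e where "e = (min_re_eigenvalue E - max_re_eigenvalue D) / 3"
  have e: "e > 0" using DE by (simp add: e_def)
  have eig1: "Re c \<le> - min_re_eigenvalue D" if "complex_eigenvalue (- D) c" for c
    using min_re_eigenvalue_le[of D "- c"] that by (simp add: complex_eigenvalue_uminus)
  obtain C1 where C1: "C1 > 0" "\<And>r. r \<ge> 0 \<Longrightarrow> norm (matrix_exp (r *\<^sub>R - D)) \<le> C1 * exp ((- min_re_eigenvalue D + d) * r)"
    using matrix_exp_growth[OF eig1 d] by blast
  obtain C2 where C2: "C2 > 0" "\<And>r. r \<ge> 0 \<Longrightarrow> norm (matrix_exp (r *\<^sub>R D)) \<le> C2 * exp ((max_re_eigenvalue D + e) * r)"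
    using matrix_exp_growth[OF max_re_eigenvalue_ge e] by blast
  obtain C3 where C3: "C3 > 0" "\<And>x. x \<noteq> 0 \<Longrightarrow> \<phi> x \<le> 1 \<Longrightarrow> norm x \<le> C3 * exp (- (min_re_eigenvalue E - e) * \<bar>ln (\<phi> x)\<bar>)"
    using norm_le_near_zero[of "min_re_eigenvalue E - e"] e by auto
  define \<eta> where "\<eta> = min 1 (min d e)"
  \<comment> \<open>Sum of the constants of the two regimes. The two blocks give a factor 2 in each;
    for \<phi> >= 1 the bound 2 on the oscillating factor makes it 4.\<close>
  define C where "C = 4 * C1 + 2 * (norm t * C3 * C2)"
  have bound: "norm (harmonizable_integrand B D E \<phi> t s ** matrix_exp ((trace E * ln (\<phi> s)) *\<^sub>R matrix_double B))
      \<le> C * exp (- \<eta> * \<bar>ln (\<phi> s)\<bar>)" if s: "s \<noteq> 0" for s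
  proof -
    define L where "L = ln (\<phi> s)"
    define z where "z = iexp (t \<bullet> s) - 1"
    define N where "N = norm (matrix_exp (L *\<^sub>R - D))"
    have "norm (harmonizable_integrand B D E \<phi> t s ** matrix_exp ((trace E * ln (\<phi> s)) *\<^sub>R matrix_double B))
      = norm (block_matrix (Re z *\<^sub>R matrix_exp (L *\<^sub>R - D)) (- (Im z *\<^sub>R matrix_exp (L *\<^sub>R - D))) 0 0)"
      unfolding z_def L_def by (simp only: harmonizable_integrand_mult[OF s])
    also have "\<dots> \<le> \<bar>Re z\<bar> * N + \<bar>Im z\<bar> * N"
      unfolding N_def by (rule order.trans[OF norm_block_matrix_le]) simp
    also have "\<dots> \<le> 2 * (cmod z * N)"
      using mult_right_mono[OF abs_Re_le_cmod[of z], of N] mult_right_mono[OF abs_Im_le_cmod[of z], of N]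
      by (simp add: N_def)
    also have "\<dots> \<le> C * exp (- \<eta> * \<bar>L\<bar>)"
    proof (cases "L \<ge> 0")
      case True
      have "cmod z * N \<le> 2 * (C1 * exp (- d * L))"
        using C1(2)[OF True] cmod_iexp_minus_1_le(2)[of "t \<bullet> s"]
        unfolding N_def z_def by (intro mult_mono) (auto simp: d_def)
      moreover have "exp (- d * L) \<le> exp (- \<eta> * \<bar>L\<bar>)"
        using True mult_right_mono[of \<eta> d L] by (simp add: \<eta>_def)
      then have "4 * C1 * exp (- d * L) \<le> 4 * C1 * exp (- \<eta> * \<bar>L\<bar>)" using C1(1) by simp
      moreover have "0 \<le> 2 * (norm t * C3 * C2) * exp (- \<eta> * \<bar>L\<bar>)" using C2(1) C3(1) by simp
      ultimately show ?thesis unfolding C_def distrib_right by linarith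
    next
      case False
      then have "\<phi> s \<le> 1" using \<phi>_pos[OF s] by (simp add: L_def)
      then have "norm s \<le> C3 * exp (- (min_re_eigenvalue E - e) * \<bar>L\<bar>)"
        unfolding L_def by (rule C3(2)[OF s])
      then have "norm t * norm s \<le> norm t * (C3 * exp (- (min_re_eigenvalue E - e) * \<bar>L\<bar>))"
        by (rule mult_left_mono) simp
      moreover have "cmod z \<le> norm t * norm s"
        unfolding z_def using cmod_iexp_minus_1_le(1) Cauchy_Schwarz_ineq2 by (rule order.trans)
      ultimately have z: "cmod z \<le> norm t * (C3 * exp (- (min_re_eigenvalue E - e) * \<bar>L\<bar>))" by linarith
      have "L *\<^sub>R - D = \<bar>L\<bar> *\<^sub>R D" using False by simp
      then have N: "N \<le> C2 * exp ((max_re_eigenvalue D + e) * \<bar>L\<bar>)"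
        unfolding N_def using C2(2)[of "\<bar>L\<bar>"] by simp
      have "cmod z * N \<le> (norm t * (C3 * exp (- (min_re_eigenvalue E - e) * \<bar>L\<bar>))) * (C2 * exp ((max_re_eigenvalue D + e) * \<bar>L\<bar>))"
        using z N C3(1) by (intro mult_mono) (auto simp: N_def)
      also have "\<dots> = norm t * C3 * C2 * exp (- e * \<bar>L\<bar>)"
      proof -
        have "- (min_re_eigenvalue E - e) * \<bar>L\<bar> + (max_re_eigenvalue D + e) * \<bar>L\<bar> = - e * \<bar>L\<bar>"
          by (simp add: e_def field_simps)
        then have "exp (- (min_re_eigenvalue E - e) * \<bar>L\<bar>) * exp ((max_re_eigenvalue D + e) * \<bar>L\<bar>) = exp (- e * \<bar>L\<bar>)"
          by (simp only: exp_add[symmetric])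
        then show ?thesis by (simp only: mult.assoc mult.left_commute)
      qed
      also have "\<dots> \<le> norm t * C3 * C2 * exp (- \<eta> * \<bar>L\<bar>)"
        using C2(1) C3(1) mult_right_mono[of \<eta> e "\<bar>L\<bar>"] by (intro mult_left_mono) (auto simp: \<eta>_def)
      finally have "cmod z * N \<le> norm t * C3 * C2 * exp (- \<eta> * \<bar>L\<bar>)" .
      moreover have "0 \<le> 4 * C1 * exp (- \<eta> * \<bar>L\<bar>)" using C1(1) by simp
      ultimately show ?thesis unfolding C_def distrib_right by linarith
    qed
    finally show ?thesis by (simp only: L_def)
  qed
  show ?thesis
    by (intro exI[of _ C] exI[of _ \<eta>] conjI allI impI bound) (use d e in \<open>auto simp: \<eta>_def\<close>)
qed

end

theorem theorem5p1:
  fixes \<mu> :: "(real^('m::finite + 'm)) measure"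
    and B D :: "real^'m^'m"
    and E :: "real^'d::finite^'d"
    and P :: "'w measure"
    and M :: "(real^'d) set \<Rightarrow> 'w \<Rightarrow> real^('m + 'm)"
    and \<phi> :: "real^'d \<Rightarrow> real"
  assumes "full_measure \<mu>"
    and "strictly_operator_stable \<mu> (matrix_double B)"
    and "random_measure_generated_by P \<mu> M"
    and "D \<in> Q_matrices"
    and "E \<in> Q_matrices"
    and "min_re_eigenvalue E > max_re_eigenvalue D"
    and "continuous_on UNIV \<phi>"
    and "\<forall>x. \<phi> x \<ge> 0"
    and "matrix_homogeneous (transpose E) \<phi>"
    and "\<forall>x. x \<noteq> 0 \<longrightarrow> \<phi> x > 0"
  shows "\<forall>t :: real^'d. partially_integrable P (complex_random_measure M)
           (harmonizable_kernel B D E \<phi> t)"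
proof
  fix t :: "real^'d"
  obtain \<psi> where \<psi>: "log_char_fun \<mu> \<psi>"
    and stable: "\<And>s u. s > 0 \<Longrightarrow> of_real s * \<psi> u = \<psi> (matrix_powr s (transpose (matrix_double B)) *v u)"
    using assms(2) unfolding strictly_operator_stable_def by blast
  obtain \<psi>' where \<psi>': "log_char_fun \<mu> \<psi>'" and char': "\<And>A u. A \<in> finite_borel_sets \<Longrightarrow>
      (CLINT \<omega>|P. iexp (M A \<omega> \<bullet> u)) = exp (of_real (measure lborel A) * \<psi>' u)"
    using assms(3) unfolding random_measure_generated_by_def by blast
  \<comment> \<open>Stability and the random measure each supply a log-characteristic function
    existentially; uniqueness identifies the two.\<close>
  have char: "(CLINT \<omega>|P. iexp (M A \<omega> \<bullet> u)) = exp (of_real (measure lborel A) * \<psi> u)"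
    if "A \<in> finite_borel_sets" for A u
    using char'[OF that] by (simp only: log_char_fun_unique[OF \<psi>' \<psi>])
  interpret prob_space P using assms(3) by (simp add: random_measure_generated_by_def)
  interpret stable_random_measure P M \<psi> E \<phi> "matrix_double B"
  proof
    show "M A \<in> borel_measurable P" if "A \<in> finite_borel_sets" for A
      using assms(3) that by (simp add: random_measure_generated_by_def)
    show "indep_vars (\<lambda>_. borel) (\<lambda>n. M (A n)) UNIV"
      if "range A \<subseteq> finite_borel_sets" "disjoint_family A" for A :: "nat \<Rightarrow> (real^'d) set"
      using assms(3) that by (simp add: random_measure_generated_by_def)
    show "AE \<omega> in P. (\<lambda>n. M (A n) \<omega>) sums M (\<Union>n. A n) \<omega>"
      if "range A \<subseteq> finite_borel_sets" "disjoint_family A" "(\<Union>n. A n) \<in> finite_borel_sets"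
      for A :: "nat \<Rightarrow> (real^'d) set"
      using assms(3) that by (simp add: random_measure_generated_by_def)
    show "continuous_on UNIV \<psi>" "\<psi> 0 = 0" using \<psi> by (auto simp: log_char_fun_def)
    show "\<psi> (matrix_exp (L *\<^sub>R transpose (matrix_double B)) *v u) = of_real (exp L) * \<psi> u" for L u
      using stable[of "exp L" u] by (simp only: matrix_powr_exp exp_gt_zero)
  qed (use assms char in auto)
  obtain C \<eta> where "0 < \<eta>" "\<eta> \<le> 1" "\<And>s. s \<noteq> 0 \<Longrightarrow>
    norm (harmonizable_integrand B D E \<phi> t s ** matrix_exp ((trace E * ln (\<phi> s)) *\<^sub>R matrix_double B))
      \<le> C * exp (- \<eta> * \<bar>ln (\<phi> s)\<bar>)"
    using harmonizable_integrand_bound[OF assms(4,6)] by blast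
  then have "integrable_wrt_random_measure P M (harmonizable_integrand B D E \<phi> t)"
    by (rule integrableI_weighted_bound[OF harmonizable_integrand_measurable])
  then show "partially_integrable P (complex_random_measure M) (harmonizable_kernel B D E \<phi> t)"
    unfolding partially_integrable_def real_complex_random_measure harmonizable_integrand_def[abs_def]
    using harmonizable_kernel_measurable by blast
qed

end
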